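(* Let $\mu^{(e)}$ be the exponential Möbius function, i.e. the multiplicative function with $\mu^{(e)}(1)=1$ and $\mu^{(e)}(p^a)=\mu(a)$ for every prime $p$ and every $a\ge 1$. If the Riemann hypothesis is true, then \[ \sum_{n\le x}|\mu^{(e)}(n)|=\prod_p\left(1+\sum_{a=4}^{\infty}\frac{\mu^2(a)-\mu^2(a-1)}{p^a}\right)x+O(x^{1/5+\varepsilon}) \] for every $\varepsilon>0$.
   Context: Here $\mu$ is the classical Möbius function and the product is over all primes $p$. For $n=p_1^{a_1}\cdots p_r^{a_r}>1$ (canonical prime factorization), $\mu^{(e)}(n)=\mu(a_1)\cdots\mu(a_r)$; so $|\mu^{(e)}(n)|$ is $1$ or $0$ according as all exponents $a_1,\dots,a_r$ are squarefree or not (such $n$, together with $n=1$, are called exponentially squarefree). The $O$-estimate is as $x\to\infty$, with implied constant depending on $\varepsilon$. *)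

theory Defs
  imports
    "HOL-Complex_Analysis.Complex_Analysis"
    "HOL-Computational_Algebra.Squarefree"
    "HOL-Library.Landau_Symbols"
begin

text \<open>
  Being a zeta function means being an analytic continuation of the Dirichlet series
  to the complex plane without the point 1. It is unique away from 1, and its value
  at 1 is left unspecified.
\<close>
definition is_zeta :: "(complex \<Rightarrow> complex) \<Rightarrow> bool" where
  "is_zeta f \<longleftrightarrow> f holomorphic_on (- {1}) \<and>
     (\<forall>s. Re s > 1 \<longrightarrow> (\<lambda>n. 1 / of_nat (Suc n) powr s) sums f s)"

definition zeta :: "complex \<Rightarrow> complex" where
  "zeta = (SOME f. is_zeta f)"

definition riemann_hypothesis :: bool where
  "riemann_hypothesis \<longleftrightarrow>
     (\<forall>s. s \<noteq> 1 \<longrightarrow> zeta s = 0 \<longrightarrow> \<not> (\<exists>k::nat. k \<ge> 1 \<and> s = - (2 * of_nat k)) \<longrightarrow> Re s = 1 / 2)"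

lemma open_Re_gt: "open {s. Re s > c}"
  by (simp add: open_halfspace_Re_gt)

lemma connected_Re_gt: "connected {s. Re s > c}"
  by (intro convex_connected convex_halfspace_Re_gt)

lemma is_zeta_unique:
  assumes "is_zeta f" "is_zeta g" "s \<noteq> 1"
  shows   "f s = g s"
proof (rule analytic_continuation_open[of "{s. Re s > 1}" "- {1}" f g])
  show "{s. Re s > 1} \<noteq> {}" by (auto intro: exI[of _ 2])
  show "connected (- {1::complex})"
    by (intro connected_punctured_universe) auto
  show "f z = g z" if "z \<in> {s. Re s > 1}" for z
    using that assms(1,2) sums_unique2 unfolding is_zeta_def by blast
qed (use assms in \<open>auto simp: is_zeta_def open_Re_gt\<close>)

lemma gen_binomial_remainder:
  fixes A :: real and K :: nat
  obtains C where "C \<ge> 0"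
    "\<And>a z :: complex. norm a \<le> A \<Longrightarrow> norm z \<le> 1 / 2 \<Longrightarrow>
       norm ((1 + z) powr a - (\<Sum>k\<le>K. (a gchoose k) * z ^ k)) \<le> C * norm z ^ Suc K"
proof -
  define b where "b = (\<lambda>k. pochhammer A k / fact k)"
  have b_eq: "b k * (1/2) ^ k = ((- A) gchoose k) * (- 1 / 2) ^ k" for k
  proof -
    have "((- A) gchoose k) * (- 1 / 2) ^ k = pochhammer A k / fact k * ((-1) ^ k * (- 1 / 2) ^ k)"
      by (simp add: gbinomial_pochhammer mult_ac)
    also have "(-1) ^ k * (- 1 / 2 :: real) ^ k = (1/2) ^ k"
      by (simp only: power_mult_distrib[symmetric]) simp
    finally show ?thesis by (simp only: b_def)
  qed
  have "summable (\<lambda>k. ((- A) gchoose k) * (- 1 / 2) ^ k)"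
    using gen_binomial_real[of "- 1 / 2" "- A"] by (auto simp: sums_iff)
  hence sb: "summable (\<lambda>k. b k * (1/2) ^ k)" by (simp only: b_eq)
  hence sb': "summable (\<lambda>k. b (k + Suc K) * (1/2) ^ (k + Suc K))"
    using summable_iff_shift[of "\<lambda>k. b k * (1/2) ^ k" "Suc K"] by blast
  define C where "C = \<bar>2 ^ Suc K * (\<Sum>k. b (k + Suc K) * (1/2) ^ (k + Suc K))\<bar>"
  show ?thesis
  proof (rule that[of C])
    fix a z :: complex
    assume a: "norm a \<le> A" and z: "norm z \<le> 1 / 2"
    have gb: "norm (a gchoose k) \<le> b k" for k
    proof -
      have "norm (pochhammer (- a) k) \<le> pochhammer A k"
        unfolding pochhammer_prod prod_norm[symmetric]
      proof (intro prod_mono conjI norm_ge_zero)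
        show "norm (- a + of_nat i) \<le> A + of_nat i" for i
          using norm_triangle_ineq[of "- a" "of_nat i"] a by simp
      qed
      thus ?thesis
        by (simp add: gbinomial_pochhammer b_def norm_mult norm_divide norm_power divide_right_mono)
    qed
    have "(\<lambda>k. (a gchoose k) * z ^ k) sums ((1 + z) powr a)"
      using z by (intro gen_binomial_complex) auto
    hence "(\<lambda>k. (a gchoose (k + Suc K)) * z ^ (k + Suc K)) sums
             ((1 + z) powr a - (\<Sum>k<Suc K. (a gchoose k) * z ^ k))"
      by (subst sums_iff_shift) auto
    hence s: "(\<lambda>k. (a gchoose (k + Suc K)) * z ^ (k + Suc K)) sums
             ((1 + z) powr a - (\<Sum>k\<le>K. (a gchoose k) * z ^ k))"
      by (simp only: lessThan_Suc_atMost)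
    have le: "norm ((a gchoose (k + Suc K)) * z ^ (k + Suc K)) \<le>
                norm z ^ Suc K * 2 ^ Suc K * (b (k + Suc K) * (1/2) ^ (k + Suc K))" for k
    proof -
      have "norm ((a gchoose (k + Suc K)) * z ^ (k + Suc K)) =
              norm (a gchoose (k + Suc K)) * (norm z ^ k * norm z ^ Suc K)"
        by (simp only: norm_mult norm_power power_add)
      also have "\<dots> \<le> b (k + Suc K) * ((1/2) ^ k * norm z ^ Suc K)"
        using z by (intro mult_mono gb power_mono mult_nonneg_nonneg order.trans[OF norm_ge_zero gb]) auto
      also have "\<dots> = norm z ^ Suc K * 2 ^ Suc K * (b (k + Suc K) * (1/2) ^ (k + Suc K))"
        by (simp add: power_add power_divide)
      finally show ?thesis .
    qed
    have "norm (\<Sum>k. (a gchoose (k + Suc K)) * z ^ (k + Suc K)) \<le>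
            (\<Sum>k. norm z ^ Suc K * 2 ^ Suc K * (b (k + Suc K) * (1/2) ^ (k + Suc K)))"
      by (intro norm_suminf_le le summable_mult sb')
    also have "\<dots> = norm z ^ Suc K * (2 ^ Suc K * (\<Sum>k. b (k + Suc K) * (1/2) ^ (k + Suc K)))"
      using suminf_mult[OF sb', of "norm z ^ Suc K * 2 ^ Suc K"] by (simp only: mult.assoc)
    also have "\<dots> \<le> norm z ^ Suc K * C"
      unfolding C_def by (intro mult_left_mono) auto
    finally show "norm ((1 + z) powr a - (\<Sum>k\<le>K. (a gchoose k) * z ^ k)) \<le> C * norm z ^ Suc K"
      using sums_unique[OF s] by (simp only: mult.commute)
  qed (simp add: C_def)
qed

text \<open>
  Expanding (1 - 1/N) powr (1 - s) by the binomial series, N = n + 2, expresses the summand of a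
  telescoping series by the terms of the zeta series at s, s + 1, ..., s + K - 1 and this
  remainder. Summing over n continues zeta from one half plane to the next one to the left.
\<close>
definition zeta_rem :: "nat \<Rightarrow> nat \<Rightarrow> complex \<Rightarrow> complex" where
  "zeta_rem K n s = of_nat (n + 1) powr (1 - s) - of_nat (n + 2) powr (1 - s)
     - (\<Sum>j<K. pochhammer (s - 1) (Suc j) / fact (Suc j) * of_nat (n + 2) powr (- (s + of_nat j)))"

lemma zeta_rem_bound:
  fixes A :: real and K :: nat
  obtains C where "C \<ge> 0"
    "\<And>s n. norm (1 - s) \<le> A \<Longrightarrow> norm (zeta_rem K n s) \<le> C * real (n + 2) powr (- Re s - K)"
proof -
  obtain C where C: "C \<ge> 0" "\<And>a z :: complex. norm a \<le> A \<Longrightarrow> norm z \<le> 1 / 2 \<Longrightarrow>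
       norm ((1 + z) powr a - (\<Sum>k\<le>K. (a gchoose k) * z ^ k)) \<le> C * norm z ^ Suc K"
    using gen_binomial_remainder by metis
  show ?thesis
  proof (rule that[OF C(1)])
    fix s :: complex and n :: nat
    assume s: "norm (1 - s) \<le> A"
    define N where "N = real (n + 2)"
    have N: "N \<ge> 2" by (simp add: N_def)
    define z where "z = complex_of_real (- 1 / N)"
    have nz: "norm z = 1 / N" using N unfolding z_def norm_of_real by simp
    have 1: "of_nat (n + 1) powr (1 - s) = of_real N powr (1 - s) * (1 + z) powr (1 - s)"
    proof -
      have "complex_of_nat (n + 1) = of_real N * of_real (1 - 1 / N)"
      proof -
        have "N * (1 - 1 / N) = real (n + 1)" using N by (simp add: N_def field_simps)
        hence "complex_of_real (N * (1 - 1 / N)) = of_real (real (n + 1))" by (rule arg_cong)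
        thus ?thesis by (simp only: of_real_mult of_real_of_nat_eq)
      qed
      also have "\<dots> powr (1 - s) = of_real N powr (1 - s) * of_real (1 - 1 / N) powr (1 - s)"
        using N by (intro powr_times_real) auto
      also have "complex_of_real (1 - 1 / N) = 1 + z" by (simp add: z_def)
      finally show ?thesis .
    qed
    have 2: "pochhammer (s - 1) (Suc j) / fact (Suc j) * of_nat (n + 2) powr (- (s + of_nat j)) =
               of_real N powr (1 - s) * ((1 - s gchoose Suc j) * z ^ Suc j)" for j
    proof -
      have "complex_of_real N powr (- (s + of_nat j)) = of_real N powr ((1 - s) - of_nat (Suc j))"
        by (simp add: algebra_simps)
      also have "\<dots> = of_real N powr (1 - s) / of_real N ^ Suc j"
      proof -
        have "complex_of_real N powr of_nat (Suc j) = of_real N ^ Suc j"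
          by (rule powr_nat') simp
        thus ?thesis by (simp only: powr_diff)
      qed
      finally have eq: "complex_of_real N powr (- (s + of_nat j)) = of_real N powr (1 - s) / of_real N ^ Suc j" .
      have z': "z ^ Suc j = (-1) ^ Suc j / of_real N ^ Suc j"
        by (simp only: z_def of_real_divide of_real_minus of_real_1 power_divide)
      have "(-1::complex) ^ Suc j * (-1) ^ Suc j = 1"
        by (simp only: power_mult_distrib[symmetric]) simp
      hence "((1 - s gchoose Suc j) * z ^ Suc j) = pochhammer (s - 1) (Suc j) / fact (Suc j) / of_real N ^ Suc j"
        unfolding gbinomial_pochhammer z' by (simp del: power_Suc pochhammer_Suc fact_Suc add: mult_ac)
      moreover have "complex_of_nat (n + 2) = of_real N" by (simp add: N_def)
      ultimately show ?thesis using eq by (simp only:) simp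
    qed
    have "(\<Sum>k\<le>K. (1 - s gchoose k) * z ^ k) = 1 + (\<Sum>j<K. (1 - s gchoose Suc j) * z ^ Suc j)"
      unfolding lessThan_Suc_atMost[symmetric] by (subst sum.lessThan_Suc_shift) simp
    hence "zeta_rem K n s = of_real N powr (1 - s) *
             ((1 + z) powr (1 - s) - (\<Sum>k\<le>K. (1 - s gchoose k) * z ^ k))"
      unfolding zeta_rem_def 1 2 by (simp add: N_def sum_distrib_left algebra_simps del: power_Suc)
    hence "norm (zeta_rem K n s) = N powr (1 - Re s) *
             norm ((1 + z) powr (1 - s) - (\<Sum>k\<le>K. (1 - s gchoose k) * z ^ k))"
      using N by (simp add: norm_mult norm_powr_real_powr)
    also have "\<dots> \<le> N powr (1 - Re s) * (C * norm z ^ Suc K)"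
      using N s by (intro mult_left_mono C) (auto simp: nz)
    also have "norm z ^ Suc K = N powr (- real (Suc K))"
      using N unfolding nz by (simp add: powr_minus powr_realpow field_simps del: of_nat_Suc power_Suc)
    also have "N powr (1 - Re s) * (C * N powr (- real (Suc K))) = C * N powr (- Re s - K)"
      by (simp add: powr_add[symmetric] mult.left_commute)
    finally show "norm (zeta_rem K n s) \<le> C * real (n + 2) powr (- Re s - K)"
      by (simp only: N_def)
  qed
qed

lemma summable_powr_shift2:
  assumes "e < -1"
  shows   "summable (\<lambda>n. C * real (n + 2) powr e)"
  using summable_iff_shift[of "\<lambda>n. real n powr e" 2] assms
  by (intro summable_mult) (simp only: summable_real_powr_iff)

lemma holomorphic_series:
  fixes f :: "nat \<Rightarrow> complex \<Rightarrow> complex"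
  assumes "open S" "\<And>n. f n holomorphic_on S"
    and "\<And>x. x \<in> S \<Longrightarrow> \<exists>d h. 0 < d \<and> summable h \<and> (\<forall>n. \<forall>y\<in>ball x d. norm (f n y) \<le> h n)"
  shows "\<exists>g. g holomorphic_on S \<and> (\<forall>x\<in>S. (\<lambda>n. f n x) sums g x)"
proof -
  have "\<exists>g g'. \<forall>x\<in>S. ((\<lambda>n. f n x) sums g x) \<and> ((\<lambda>n. deriv (f n) x) sums g' x) \<and>
          (g has_field_derivative g' x) (at x)"
  proof (rule series_and_derivative_comparison_local)
    show "(f n has_field_derivative deriv (f n) x) (at x)" if "x \<in> S" for n x
      using that assms by (intro holomorphic_derivI) auto
    fix x assume "x \<in> S"
    then obtain d h where "0 < d" "summable h" "\<forall>n. \<forall>y\<in>ball x d. norm (f n y) \<le> h n"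
      using assms(3) by blast
    thus "\<exists>d h. 0 < d \<and> summable h \<and>
            (\<forall>\<^sub>F n in sequentially. \<forall>y\<in>ball x d \<inter> S. norm (f n y) \<le> h n)"
      by (intro exI[of _ d] exI[of _ h]) (auto intro: always_eventually)
  qed (fact assms)
  thus ?thesis using assms(1) by (meson holomorphic_on_open)
qed

lemma Re_ball:
  assumes "y \<in> ball x d"
  shows   "Re y > Re x - d"
  using assms abs_Re_le_cmod[of "x - y"] by (auto simp: dist_norm)

lemma zeta_rem_series:
  "\<exists>G. G holomorphic_on {s. Re s > 1 - real K} \<and>
       (\<forall>s\<in>{s. Re s > 1 - real K}. (\<lambda>n. zeta_rem K n s) sums G s)"
proof (rule holomorphic_series)
  fix x assume x: "x \<in> {s. Re s > 1 - real K}"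
  define d where "d = (Re x - (1 - real K)) / 2"
  have d: "d > 0" using x by (simp add: d_def)
  obtain C where C: "C \<ge> 0" "\<And>s n. norm (1 - s) \<le> norm (1 - x) + d \<Longrightarrow>
      norm (zeta_rem K n s) \<le> C * real (n + 2) powr (- Re s - K)"
    using zeta_rem_bound by metis
  show "\<exists>d h. 0 < d \<and> summable h \<and> (\<forall>n. \<forall>y\<in>ball x d. norm (zeta_rem K n y) \<le> h n)"
  proof (intro exI conjI allI ballI)
    show "d > 0" by fact
    show "summable (\<lambda>n. C * real (n + 2) powr (- (Re x - d) - K))"
      using x by (intro summable_powr_shift2) (simp add: d_def field_simps)
    fix n y assume y: "y \<in> ball x d"
    have "norm (1 - y) \<le> norm (1 - x) + d"
      using y norm_triangle_ineq[of "1 - x" "x - y"] by (auto simp: dist_norm)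
    hence "norm (zeta_rem K n y) \<le> C * real (n + 2) powr (- Re y - K)" by (rule C)
    also have "\<dots> \<le> C * real (n + 2) powr (- (Re x - d) - K)"
      using Re_ball[OF y] C(1) by (intro mult_left_mono powr_mono) auto
    finally show "norm (zeta_rem K n y) \<le> C * real (n + 2) powr (- (Re x - d) - K)" .
  qed
qed (auto simp: open_Re_gt zeta_rem_def pochhammer_prod intro!: holomorphic_intros simp del: of_nat_add)

lemma zeta_tail_series:
  "\<exists>U. U holomorphic_on {s. Re s > 1} \<and>
       (\<forall>s\<in>{s. Re s > 1}. (\<lambda>n. of_nat (n + 2) powr (- s)) sums U s)"
proof (rule holomorphic_series)
  fix x assume x: "x \<in> {s. Re s > 1}"
  define d where "d = (Re x - 1) / 2"
  have d: "d > 0" using x by (simp add: d_def)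
  show "\<exists>d h. 0 < d \<and> summable h \<and>
          (\<forall>n. \<forall>y\<in>ball x d. norm (of_nat (n + 2) powr (- y)) \<le> h n)"
  proof (intro exI conjI allI ballI)
    show "d > 0" by fact
    show "summable (\<lambda>n. 1 * real (n + 2) powr (- (Re x - d)))"
      using x by (intro summable_powr_shift2) (simp add: d_def field_simps)
    fix n y assume y: "y \<in> ball x d"
    have "norm (of_nat (n + 2) powr (- y) :: complex) = real (n + 2) powr (- Re y)"
      using norm_powr_real_powr[of "of_nat (n + 2)" "- y"] by simp
    also have "\<dots> \<le> real (n + 2) powr (- (Re x - d))"
      using Re_ball[OF y] by (intro powr_mono) auto
    finally show "norm (of_nat (n + 2) powr (- y) :: complex) \<le> 1 * real (n + 2) powr (- (Re x - d))"
      by simp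
  qed
qed (auto simp: open_Re_gt intro!: holomorphic_intros simp del: of_nat_add)

lemma telescope_powr:
  assumes "Re s > 1"
  shows   "(\<lambda>n. of_nat (n + 1) powr (1 - s) - of_nat (n + 2) powr (1 - s)) sums (1 :: complex)"
proof -
  have "(\<lambda>n. real (Suc n) powr (1 - Re s)) \<longlonglongrightarrow> 0"
    using assms
    by (intro tendsto_neg_powr filterlim_compose[OF filterlim_real_sequentially filterlim_Suc]) auto
  moreover have "norm (of_nat (Suc n) powr (1 - s) :: complex) = real (Suc n) powr (1 - Re s)" for n
    using norm_powr_real_powr[of "of_nat (Suc n)" "1 - s"] by simp
  ultimately have "(\<lambda>n. of_nat (Suc n) powr (1 - s) :: complex) \<longlonglongrightarrow> 0"
    by (subst tendsto_norm_zero_iff[symmetric]) (simp only:)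
  from telescope_sums'[OF this] show ?thesis by simp
qed

lemma zeta_continuation_halfplane:
  assumes U: "\<forall>s\<in>{s. Re s > 1}. (\<lambda>n. of_nat (n + 2) powr (- s)) sums U s"
    and holo: "U holomorphic_on {s. Re s > 1}"
  shows "\<exists>W. W holomorphic_on {s. Re s > 1 - real m} \<and> (\<forall>s. Re s > 1 \<longrightarrow> W s = (s - 1) * U s)"
proof (induction m)
  case 0
  show ?case using holo by (intro exI[of _ "\<lambda>s. (s - 1) * U s"]) (auto intro!: holomorphic_intros)
next
  case (Suc m)
  then obtain W where W: "W holomorphic_on {s. Re s > 1 - real m}"
    "\<And>s. Re s > 1 \<Longrightarrow> W s = (s - 1) * U s" by blast
  obtain G where G: "G holomorphic_on {s. Re s > 1 - real (Suc m)}"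
    "\<And>s. Re s > 1 - real (Suc m) \<Longrightarrow> (\<lambda>n. zeta_rem (Suc m) n s) sums G s"
    using zeta_rem_series[of "Suc m"] by blast
  define q where "q = (\<lambda>j (s::complex). pochhammer (s - 1) j / fact (Suc j))"
  define V where "V = (\<lambda>s. 1 - (\<Sum>j<m. q (Suc j) s * W (s + of_nat (Suc j))) - G s)"
  have "W \<circ> (\<lambda>s. s + of_nat (Suc j)) holomorphic_on {s. Re s > 1 - real (Suc m)}" for j
    by (rule holomorphic_on_compose_gen[OF _ W(1)]) (auto intro!: holomorphic_intros)
  hence "V holomorphic_on {s. Re s > 1 - real (Suc m)}"
    unfolding V_def q_def pochhammer_prod o_def using G(1)
    by (auto intro!: holomorphic_intros simp del: fact_Suc of_nat_Suc)
  moreover have "V s = (s - 1) * U s" if s: "Re s > 1" for s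
  proof -
    have "(\<lambda>n. zeta_rem (Suc m) n s) sums
            (1 - (\<Sum>j<Suc m. pochhammer (s - 1) (Suc j) / fact (Suc j) * U (s + of_nat j)))"
      unfolding zeta_rem_def using s
      by (intro sums_diff telescope_powr sums_sum sums_mult U[rule_format]) auto
    moreover have "(\<lambda>n. zeta_rem (Suc m) n s) sums G s"
      using s by (intro G) auto
    ultimately have "G s = 1 - (\<Sum>j<Suc m. pochhammer (s - 1) (Suc j) / fact (Suc j) * U (s + of_nat j))"
      using sums_unique2 by blast
    also have "(\<Sum>j<Suc m. pochhammer (s - 1) (Suc j) / fact (Suc j) * U (s + of_nat j)) =
                 (\<Sum>j<Suc m. q j s * W (s + of_nat j))"
    proof (intro sum.cong refl)
      fix j
      have "W (s + of_nat j) = (s - 1 + of_nat j) * U (s + of_nat j)"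
        using s by (subst W(2)) (auto simp: algebra_simps)
      thus "pochhammer (s - 1) (Suc j) / fact (Suc j) * U (s + of_nat j) = q j s * W (s + of_nat j)"
        by (simp add: q_def pochhammer_Suc mult_ac)
    qed
    also have "\<dots> = W s + (\<Sum>j<m. q (Suc j) s * W (s + of_nat (Suc j)))"
      by (subst sum.lessThan_Suc_shift) (simp add: q_def)
    finally show ?thesis using W(2)[OF s] by (simp add: V_def)
  qed
  ultimately show ?case by blast
qed

lemma is_zeta_exists: "\<exists>f. is_zeta f"
proof -
  obtain U where U: "U holomorphic_on {s. Re s > 1}"
    "\<forall>s\<in>{s. Re s > 1}. (\<lambda>n. of_nat (n + 2) powr (- s)) sums U s"
    using zeta_tail_series by blast
  obtain W where W: "\<And>m. W m holomorphic_on {s. Re s > 1 - real m}"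
    "\<And>m s. Re s > 1 \<Longrightarrow> W m s = (s - 1) * U s"
    using zeta_continuation_halfplane[OF U(2,1)] by metis
  have W_eq: "W m s = W m' s" if "m \<le> m'" "Re s > 1 - real m" for m m' s
  proof (rule analytic_continuation_open[of "{s. Re s > 1}" "{s. Re s > 1 - real m}" "W m" "W m'"])
    show "{s. Re s > 1} \<noteq> {}" by (auto intro: exI[of _ 2])
    show "W m' holomorphic_on {s. Re s > 1 - real m}"
      using that by (intro holomorphic_on_subset[OF W(1)[of m']]) auto
  qed (use that W in \<open>auto simp: open_Re_gt connected_Re_gt\<close>)
  define M where "M = (\<lambda>s. nat \<lceil>2 - Re s\<rceil>)"
  have M: "Re s > 1 - real (M s)" for s unfolding M_def by linarith
  define Z where "Z = (\<lambda>s. W (M s) s)"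
  have Z_eq: "Z s = W m s" if "Re s > 1 - real m" for s m
  proof (cases "m \<le> M s")
    case True
    thus ?thesis unfolding Z_def using that by (intro W_eq[symmetric])
  next
    case False
    thus ?thesis unfolding Z_def by (intro W_eq M) simp
  qed
  have Z: "Z holomorphic_on UNIV"
    unfolding holomorphic_on_def
  proof
    fix s :: complex
    have "W (M s) field_differentiable (at s)"
      using M[of s] by (intro holomorphic_on_imp_differentiable_at[OF W(1) open_Re_gt]) simp
    moreover have "\<forall>\<^sub>F t in nhds s. Z t = W (M s) t"
      using eventually_nhds_in_open[OF open_Re_gt, of s "1 - real (M s)"] M[of s]
      by (auto elim!: eventually_mono intro: Z_eq)
    ultimately show "Z field_differentiable (at s within UNIV)"
      unfolding field_differentiable_def using DERIV_cong_ev[of s s Z "W (M s)"] by auto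
  qed
  have "is_zeta (\<lambda>s. 1 + Z s / (s - 1))"
    unfolding is_zeta_def
  proof (intro conjI allI impI)
    show "(\<lambda>s. 1 + Z s / (s - 1)) holomorphic_on - {1}"
      by (intro holomorphic_intros holomorphic_on_subset[OF Z]) auto
    fix s assume s: "Re s > 1"
    have "Z s = (s - 1) * U s" using Z_eq[of 0 s] W(2)[OF s, of 0] s by simp
    hence "1 + Z s / (s - 1) = 1 + U s" using s by auto
    moreover have "(\<lambda>n. 1 / of_nat (Suc (Suc n)) powr s) sums U s"
      using U(2) s by (simp add: powr_minus field_simps)
    hence "(\<lambda>n. 1 / of_nat (Suc n) powr s) sums (U s + 1 / of_nat (Suc 0) powr s)"
      by (rule sums_Suc)
    ultimately show "(\<lambda>n. 1 / of_nat (Suc n) powr s) sums (1 + Z s / (s - 1))"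
      by (simp add: add.commute)
  qed
  thus ?thesis by blast
qed

lemma is_zeta_zeta: "is_zeta zeta"
  unfolding zeta_def using is_zeta_exists by (rule someI_ex)

definition moebius_mu :: "nat \<Rightarrow> int" where
  "moebius_mu n = (if squarefree n then (-1) ^ card (prime_factors n) else 0)"

text \<open>The value at 0 is a dummy.\<close>
definition exp_moebius :: "nat \<Rightarrow> int" where
  "exp_moebius n = (\<Prod>p\<in>prime_factors n. moebius_mu (multiplicity p n))"

lemma exp_moebius_1: "exp_moebius 1 = 1"
  by (simp add: exp_moebius_def)

lemma exp_moebius_prime_power:
  assumes "prime p" "a \<ge> 1"
  shows   "exp_moebius (p ^ a) = moebius_mu a"
  using assms by (simp add: exp_moebius_def prime_factorization_prime_power)

lemma exp_moebius_mult_coprime: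
  assumes "coprime m n" "m > 0" "n > 0"
  shows   "exp_moebius (m * n) = exp_moebius m * exp_moebius n"
proof -
  have disj: "prime_factors m \<inter> prime_factors n = {}"
  proof -
    have False if "p \<in> prime_factors m" "p \<in> prime_factors n" for p
      using coprime_common_divisor[OF assms(1), of p] that
      by (metis in_prime_factors_iff not_prime_unit)
    thus ?thesis by blast
  qed
  have "multiplicity p n = 0" if "p \<in> prime_factors m" for p
    using that disj by (auto simp: prime_factors_multiplicity)
  moreover have "multiplicity p m = 0" if "p \<in> prime_factors n" for p
    using that disj by (auto simp: prime_factors_multiplicity)
  moreover have "multiplicity p (m * n) = multiplicity p m + multiplicity p n"
    if "p \<in> prime_factors m \<union> prime_factors n" for p
    using that assms by (intro prime_elem_multiplicity_mult_distrib) (auto simp: prime_factors_dvd)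
  moreover have "prime_factors (m * n) = prime_factors m \<union> prime_factors n"
    using assms by (intro prime_factors_product) auto
  ultimately show ?thesis
    unfolding exp_moebius_def by (simp add: prod.union_disjoint disj)
qed

definition euler_factor :: "nat \<Rightarrow> real" where
  "euler_factor p =
     1 + (\<Sum>\<^sub>\<infinity>a\<in>{4::nat..}. real_of_int ((moebius_mu a)\<^sup>2 - (moebius_mu (a - 1))\<^sup>2) / real p ^ a)"

lemma moebius_mu_square: "(moebius_mu a)\<^sup>2 = (if squarefree a then 1 else 0)"
  by (simp add: moebius_mu_def power2_eq_square flip: power_mult_distrib)

lemma euler_factor_term_bound:
  "norm (real_of_int ((moebius_mu a)\<^sup>2 - (moebius_mu (a - 1))\<^sup>2) / real p ^ a) \<le> (1 / real p) ^ a"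
  by (simp add: moebius_mu_square power_divide)

lemma euler_factor_norm_summable:
  assumes "p \<ge> 2"
  shows   "summable (\<lambda>a. norm (real_of_int ((moebius_mu a)\<^sup>2 - (moebius_mu (a - 1))\<^sup>2) / real p ^ a))"
proof (rule summable_comparison_test')
  show "summable (\<lambda>a. (1 / real p) ^ a)"
    using assms by (intro summable_geometric) simp
  show "norm (norm (real_of_int ((moebius_mu a)\<^sup>2 - (moebius_mu (a - 1))\<^sup>2) / real p ^ a)) \<le> (1 / real p) ^ a"
    if "a \<ge> 0" for a
    using euler_factor_term_bound[of a p] by simp
qed

lemma euler_factor_summable:
  assumes "p \<ge> 2"
  shows   "(\<lambda>a. real_of_int ((moebius_mu a)\<^sup>2 - (moebius_mu (a - 1))\<^sup>2) / real p ^ a) summable_on {4..}"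
proof (rule summable_on_subset_banach)
  show "(\<lambda>a. real_of_int ((moebius_mu a)\<^sup>2 - (moebius_mu (a - 1))\<^sup>2) / real p ^ a) summable_on UNIV"
    by (rule norm_summable_imp_summable_on[OF euler_factor_norm_summable[OF assms]])
qed auto

lemma euler_factor_bound:
  assumes "p \<ge> 2"
  shows   "\<bar>euler_factor p - 1\<bar> \<le> 2 / real p ^ 4"
proof -
  define f where "f = (\<lambda>a. real_of_int ((moebius_mu a)\<^sup>2 - (moebius_mu (a - 1))\<^sup>2) / real p ^ a)"
  have "(f has_sum infsum f {4..}) {4..}"
    unfolding f_def by (rule has_sum_infsum[OF euler_factor_summable[OF assms]])
  moreover have "bij_betw (\<lambda>k. k + 4) UNIV {4::nat..}"
    by (rule bij_betw_byWitness[of _ "\<lambda>k. k - 4"]) auto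
  ultimately have "((\<lambda>k. f (k + 4)) has_sum infsum f {4..}) UNIV"
    using has_sum_reindex_bij_betw by blast
  hence sums: "(\<lambda>k. f (k + 4)) sums infsum f {4..}"
    by (rule has_sum_imp_sums)
  have geo: "(\<lambda>k. (1 / real p) ^ 4 * (1 / real p) ^ k) sums ((1 / real p) ^ 4 * (1 / (1 - 1 / real p)))"
    using assms by (intro sums_mult geometric_sums) simp
  have "norm (f (k + 4)) \<le> (1 / real p) ^ 4 * (1 / real p) ^ k" for k
    using euler_factor_term_bound[of "k + 4" p] unfolding f_def power_add
    by (simp only: mult.commute)
  hence "norm (\<Sum>k. f (k + 4)) \<le> (\<Sum>k. (1 / real p) ^ 4 * (1 / real p) ^ k)"
    by (rule norm_suminf_le) (rule sums_summable[OF geo])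
  hence "norm (infsum f {4..}) \<le> (1 / real p) ^ 4 * (1 / (1 - 1 / real p))"
    by (simp only: sums_unique[OF sums, symmetric] sums_unique[OF geo, symmetric])
  also have "1 / (1 - 1 / real p) \<le> 2"
    using assms by (simp add: field_simps)
  finally show ?thesis
    by (simp add: euler_factor_def f_def power_divide mult_left_mono divide_right_mono)
qed

lemma euler_product_convergent: "convergent_prod (\<lambda>p. if prime p then euler_factor p else 1)"
proof -
  have "summable (\<lambda>p. norm ((if prime p then euler_factor p else 1) - 1))"
  proof (rule summable_comparison_test')
    show "summable (\<lambda>p. 2 * inverse (real p ^ 4))"
      by (intro summable_mult inverse_power_summable) simp
    show "norm (norm ((if prime p then euler_factor p else 1) - 1)) \<le> 2 * inverse (real p ^ 4)"
      if "p \<ge> 0" for p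
      using euler_factor_bound[of p] prime_ge_2_nat[of p] by (auto simp: field_simps)
  qed
  thus ?thesis
    by (intro abs_convergent_prod_imp_convergent_prod summable_imp_abs_convergent_prod)
qed

end

theory Submission
  imports Defs
begin

text \<open>
  Write the Dirichlet series of \<open>|exp_moebius n|\<close> as \<open>(zeta s / zeta (4 s)) * H s\<close>. The first
  factor belongs to the indicator \<open>free4\<close> of the integers free of fourth powers. The second belongs
  to the multiplicative function \<open>cofactor\<close>, which vanishes at the prime powers \<open>p ^ a\<close> with
  \<open>1 \<le> a \<le> 4\<close>, because the exponents 1, 2, 3 are squarefree and 4 is not. So the series of
  \<open>cofactor\<close> converges absolutely for \<open>Re s > 1 / 5\<close> (\<open>cofactor_euler_product\<close>), and summing the
  count of the integers \<open>\<le> x / m\<close> free of fourth powers against \<open>cofactor m\<close> reduces the theorem to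
  that count: its error must be \<open>O(y powr (1 / 5 + \<epsilon>))\<close> (\<open>RH_free4_count\<close>). The constant comes out
  as a product over primes from the Euler products of both factors (\<open>euler_constant\<close>).

  The number of \<open>m \<le> N\<close> free of fourth powers is the sum of \<open>moebius_mu d\<close> over the pairs with
  \<open>n * d ^ 4 \<le> N\<close>. Bounding the partial sums of the Moebius function under the Riemann hypothesis
  does not suffice here (it yields the exponent 2/9); as Montgomery and Vaughan observed, the
  cancellation in the sum over \<open>n\<close> has to be used too. Let \<open>z = N powr (1 / 5)\<close> and split
  \<open>moebius_mu d\<close> by the smooth weight \<open>cutoff z d = max 0 (1 - (d / z)\<^sup>2)\<close>. The part with the weight
  lives on \<open>d \<le> z\<close> and is counted trivially, with error \<open>O(z)\<close>. The complementary part has Dirichlet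
  series \<open>zeta s * moebius_tail z (4 * s)\<close>; it is recovered by a Perron integral, and the line of
  integration is moved from \<open>Re s = 2\<close> past the pole at 1 to \<open>Re s = 1 / 2 + \<delta>\<close>. There
  \<open>moebius_tail z (4 * s)\<close> is small, of size \<open>z powr (-3 / 2)\<close> up to an arbitrarily small power of
  \<open>\<bar>Im s\<bar>\<close> (\<open>RH_moebius_tail_bound\<close>, itself a second contour shift, for \<open>1 / zeta\<close>), and
  \<open>N powr (1 / 2) * z powr (-3 / 2) = N powr (1 / 5)\<close>.

  Both shifts need that \<open>zeta\<close> and \<open>1 / zeta\<close> grow slower than every power of \<open>\<bar>Im s\<bar>\<close> to the right
  of the critical line (\<open>RH_log_zeta_bound\<close>). This is where the Riemann hypothesis enters: it
  gives a holomorphic logarithm of \<open>zeta\<close> on the discs about \<open>2 + i t\<close> that extend up to the critical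
  line. Its real part is \<open>O(ln \<bar>t\<bar>)\<close> from above on the whole disc and bounded near the centre; comparing
  its Taylor coefficients on both scales gives the bound.

  Perron's formula is used with the kernels \<open>1 / (s * (s + \<alpha>))\<close>, for which all integrals
  converge absolutely. The kernel with \<open>\<alpha> = 2\<close> produces the weight \<open>cutoff\<close>. The kernel with \<open>\<alpha> = 1\<close>
  produces the weights \<open>max 0 (x - m)\<close>, and their difference at \<open>x = N + 1\<close> and \<open>x = N\<close> is exactly
  the indicator of \<open>m \<le> N\<close>.
\<close>

section \<open>Multiplicative functions and Dirichlet convolution\<close>

lemma has_sum_Times:
  fixes f :: "'a \<Rightarrow> 'c :: {real_normed_field, banach}" and g :: "'b \<Rightarrow> 'c"
  assumes f: "(\<lambda>x. norm (f x)) summable_on A" and g: "(\<lambda>y. norm (g y)) summable_on B"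
  shows "(\<lambda>z. norm (f (fst z) * g (snd z))) summable_on A \<times> B"
    and "((\<lambda>z. f (fst z) * g (snd z)) has_sum (infsum f A * infsum g B)) (A \<times> B)"
proof -
  have fs: "f summable_on A" and gs: "g summable_on B"
    using f g abs_summable_summable by blast+
  have gf: "((\<lambda>y. norm (f x) * norm (g y)) has_sum (norm (f x) * (\<Sum>\<^sub>\<infinity>y\<in>B. norm (g y)))) B" for x
    by (intro has_sum_cmult_right has_sum_infsum g)
  show *: "(\<lambda>z. norm (f (fst z) * g (snd z))) summable_on A \<times> B"
  proof (rule summable_on_SigmaI)
    show "((\<lambda>y. norm (f (fst (x, y)) * g (snd (x, y)))) has_sum (norm (f x) * (\<Sum>\<^sub>\<infinity>y\<in>B. norm (g y)))) B" for x
      using gf[of x] by (simp add: norm_mult)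
    show "(\<lambda>x. norm (f x) * (\<Sum>\<^sub>\<infinity>y\<in>B. norm (g y))) summable_on A"
      by (intro summable_on_cmult_left f)
  qed auto
  show "((\<lambda>z. f (fst z) * g (snd z)) has_sum (infsum f A * infsum g B)) (A \<times> B)"
  proof (rule has_sum_SigmaI)
    show "((\<lambda>y. f (fst (x, y)) * g (snd (x, y))) has_sum (f x * infsum g B)) B" for x
      using has_sum_cmult_right[OF has_sum_infsum[OF gs], of "f x"] by simp
    show "((\<lambda>x. f x * infsum g B) has_sum (infsum f A * infsum g B)) A"
      by (intro has_sum_cmult_left has_sum_infsum fs)
    show "(\<lambda>z. f (fst z) * g (snd z)) summable_on A \<times> B"
      using abs_summable_summable[OF *] by simp
  qed
qed

text \<open>
  The multiplicative function with value \<open>u p a\<close> at the prime power \<open>p ^ a\<close>. The lemmas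
  assume \<open>u p 0 = 1\<close>, so that \<open>u p\<close> can be read as the coefficient sequence of a local power series.
\<close>
definition mult_fun :: "(nat \<Rightarrow> nat \<Rightarrow> real) \<Rightarrow> nat \<Rightarrow> real" where
  "mult_fun u n = (\<Prod>p\<in>prime_factors n. u p (multiplicity p n))"

lemma mult_fun_1 [simp]: "mult_fun u (Suc 0) = 1"
  by (simp add: mult_fun_def)

lemma mult_fun_prime_power_mult:
  assumes p: "prime p" and m: "m > 0" "\<not> p dvd m" and u: "u p 0 = 1"
  shows "mult_fun u (p ^ k * m) = u p k * mult_fun u m"
proof (cases "k = 0")
  case False
  have pf: "prime_factors (p ^ k * m) = insert p (prime_factors m)"
    using p m False
    by (auto simp: prime_factors_dvd prime_dvd_mult_iff prime_dvd_power_iff dest: primes_dvd_imp_eq)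
  have np: "p \<notin> prime_factors m" using m by auto
  have "multiplicity p (p ^ k * m) = k"
    using p m by (simp add: prime_elem_multiplicity_mult_distrib not_dvd_imp_multiplicity_0)
  moreover have "multiplicity q (p ^ k * m) = multiplicity q m" if "q \<in> prime_factors m" for q
  proof -
    have "q \<noteq> p" "prime q" using that np by auto
    thus ?thesis using p m
      by (simp add: prime_elem_multiplicity_mult_distrib multiplicity_distinct_prime_power)
  qed
  ultimately show ?thesis unfolding mult_fun_def pf using np by simp
qed (use u in auto)

lemma inj_on_prime_power_mult:
  fixes p :: nat
  assumes p: "prime p"
  shows "inj_on (\<lambda>(a, m). p ^ a * m) (UNIV \<times> {m. m > 0 \<and> \<not> p dvd m})"
proof (rule inj_onI, clarify)
  fix i j d e :: nat assume *: "d > 0" "\<not> p dvd d" "e > 0" "\<not> p dvd e" "p ^ i * d = p ^ j * e"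
  have "multiplicity p (p ^ i * d) = i" "multiplicity p (p ^ j * e) = j"
    using p *(1-4) by (simp_all add: prime_elem_multiplicity_mult_distrib not_dvd_imp_multiplicity_0)
  hence "i = j" unfolding *(5) by simp
  thus "i = j \<and> d = e" using * p by (auto dest: prime_gt_0_nat)
qed

lemma bij_betw_divisors_prime_power_mult:
  fixes p m :: nat
  assumes p: "prime p" and m: "m > 0" "\<not> p dvd m"
  shows "bij_betw (\<lambda>(i, d). p ^ i * d) ({..k} \<times> {d. d dvd m}) {d. d dvd p ^ k * m}"
  unfolding bij_betw_def
proof (intro conjI equalityI subsetI)
  show "inj_on (\<lambda>(i, d). p ^ i * d) ({..k} \<times> {d. d dvd m})"
    by (rule inj_on_subset[OF inj_on_prime_power_mult[OF p]])
       (use m in \<open>auto intro: Nat.gr0I dest: dvd_trans\<close>)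
next
  fix y assume "y \<in> (\<lambda>(i, d). p ^ i * d) ` ({..k} \<times> {d. d dvd m})"
  thus "y \<in> {d. d dvd p ^ k * m}" by (auto intro!: mult_dvd_mono le_imp_power_dvd)
next
  fix y assume "y \<in> {d. d dvd p ^ k * m}"
  then obtain a b where ab: "y = a * b" "a dvd p ^ k" "b dvd m"
    using division_decomp by blast
  then obtain i where "i \<le> k" "a = p ^ i" using divides_primepow_nat[OF p] by blast
  thus "y \<in> (\<lambda>(i, d). p ^ i * d) ` ({..k} \<times> {d. d dvd m})"
    using ab by (intro image_eqI[of _ _ "(i, b)"]) auto
qed

lemma nat_prime_power_cases [consumes 1, case_names one prime_power]:
  fixes n :: nat
  assumes "n > 0" "n = 1 \<Longrightarrow> P"
    "\<And>p k m. prime p \<Longrightarrow> k > 0 \<Longrightarrow> m > 0 \<Longrightarrow> \<not> p dvd m \<Longrightarrow> m < n \<Longrightarrow> n = p ^ k * m \<Longrightarrow> P"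
  shows P
proof (cases "n = 1")
  case False
  then obtain p where p: "prime p" "p dvd n" using prime_factor_nat by blast
  obtain m where m: "n = p ^ multiplicity p n * m" "\<not> p dvd m"
    by (rule multiplicity_decompose'[of n p]) (use assms(1) p in auto)
  have k: "multiplicity p n > 0" using p assms(1) by (simp add: prime_multiplicity_gt_zero_iff)
  have "m > 0" using m assms(1) by (cases m) auto
  moreover have "m < p ^ multiplicity p n * m"
    using \<open>m > 0\<close> one_less_power[OF prime_gt_1_nat[OF p(1)] k] by simp
  ultimately show ?thesis using assms(3)[OF p(1) k _ m(2) _ m(1)] m(1) by simp
qed (use assms in auto)

text \<open>
  Dirichlet convolution of multiplicative functions is multiplication of the local power series.
  Splitting off a full prime power from \<open>n\<close> factors the set of divisors, which drives the induction.
\<close>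
lemma dirichlet_convolution_mult_fun:
  assumes u: "\<And>p. u p 0 = 1" and v: "\<And>p. v p 0 = 1" and "n > 0"
  shows "(\<Sum>d | d dvd n. mult_fun u d * mult_fun v (n div d)) =
           mult_fun (\<lambda>p a. \<Sum>i\<le>a. u p i * v p (a - i)) n"
  using \<open>n > 0\<close>
proof (induction n rule: less_induct)
  case (less n)
  from less.prems show ?case
  proof (cases rule: nat_prime_power_cases)
    case one
    thus ?thesis by simp
  next
    case (prime_power p k m)
    define w where "w = (\<lambda>p a. \<Sum>i\<le>a. u p i * v p (a - i))"
    have p0: "p > 0" using prime_power(1) prime_gt_0_nat by blast
    have split: "mult_fun u (p ^ i * d) * mult_fun v (n div (p ^ i * d)) =
            (u p i * v p (k - i)) * (mult_fun u d * mult_fun v (m div d))" if "i \<le> k" "d dvd m" for i d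
    proof -
      obtain e where e: "m = d * e" using \<open>d dvd m\<close> by (elim dvdE)
      hence d: "d > 0" "\<not> p dvd d" "m div d > 0" "\<not> p dvd m div d"
        using prime_power(3,4) by auto
      have "n div (p ^ i * d) = p ^ (k - i) * (m div d)"
        using that p0 prime_power(6) \<open>d > 0\<close>
        by (metis (no_types, lifting) div_mult_div_if_dvd le_imp_power_dvd power_diff not_less_zero)
      thus ?thesis
        using d prime_power by (simp add: mult_fun_prime_power_mult u v)
    qed
    have "(\<Sum>d | d dvd n. mult_fun u d * mult_fun v (n div d)) =
            (\<Sum>(i, d)\<in>{..k} \<times> {d. d dvd m}. mult_fun u (p ^ i * d) * mult_fun v (n div (p ^ i * d)))"
      unfolding prime_power(6)
      by (subst sum.reindex_bij_betw[OF bij_betw_divisors_prime_power_mult[OF prime_power(1,3,4)], symmetric])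
         (simp add: case_prod_unfold)
    also have "\<dots> = (\<Sum>(i, d)\<in>{..k} \<times> {d. d dvd m}. (u p i * v p (k - i)) * (mult_fun u d * mult_fun v (m div d)))"
      by (intro sum.cong refl) (auto simp: split)
    also have "\<dots> = w p k * (\<Sum>d | d dvd m. mult_fun u d * mult_fun v (m div d))"
      by (simp add: w_def sum_product sum.cartesian_product)
    also have "\<dots> = w p k * mult_fun w m"
      using less.IH[of m] prime_power by (simp add: w_def)
    also have "\<dots> = mult_fun w n"
      unfolding prime_power(6) using prime_power(1,3,4)
      by (intro mult_fun_prime_power_mult[symmetric]) (auto simp: w_def u v)
    finally show ?thesis by (simp add: w_def)
  qed
qed

lemma moebius_mu_mult_fun:
  assumes "n > 0"
  shows "real_of_int (moebius_mu n) = mult_fun (\<lambda>p a. if a = 0 then 1 else if a = 1 then -1 else 0) n"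
proof (cases "squarefree n")
  case True
  hence "multiplicity p n = 1" if "p \<in> prime_factors n" for p
    using that assms squarefree_factorial_semiring'[of n] by auto
  thus ?thesis using True by (simp add: moebius_mu_def mult_fun_def)
next
  case False
  then obtain p where p: "p \<in> prime_factors n" "multiplicity p n \<noteq> 1"
    using assms squarefree_factorial_semiring'[of n] by auto
  hence "multiplicity p n > 0" by (auto simp: prime_factors_multiplicity)
  hence "\<exists>p\<in>prime_factors n. (if multiplicity p n = 0 then 1 else if multiplicity p n = 1 then -1 else 0 :: real) = 0"
    using p by (intro bexI[of _ p]) auto
  thus ?thesis using False unfolding moebius_mu_def mult_fun_def
    by (simp add: prod_zero_iff)
qed

lemma mult_fun_const_1: "mult_fun (\<lambda>p a. 1) n = 1"
  by (simp add: mult_fun_def)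

lemma mult_fun_delta:
  assumes "n > 0"
  shows "mult_fun (\<lambda>p a. if a = 0 then 1 else 0) n = (if n = 1 then 1 else 0)"
proof (cases "n = 1")
  case False
  then obtain p where "prime p" "p dvd n" using prime_factor_nat by blast
  hence "p \<in> prime_factors n" "multiplicity p n \<noteq> 0"
    using assms by (auto simp: prime_factors_dvd prime_multiplicity_gt_zero_iff)
  thus ?thesis using False unfolding mult_fun_def by (auto simp: prod_zero_iff)
qed auto

text \<open>
  The local power series of the Moebius function is \<open>1 - X\<close>, the inverse of that of the constant 1.
\<close>
lemma sum_moebius_mu_divisors:
  assumes "n > 0"
  shows "(\<Sum>d | d dvd n. real_of_int (moebius_mu d)) = (if n = 1 then 1 else 0)"
proof -
  define u where "u = (\<lambda>(p::nat) a::nat. if a = 0 then 1 else if a = 1 then -1 else 0 :: real)"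
  have "(\<Sum>d | d dvd n. real_of_int (moebius_mu d)) =
          (\<Sum>d | d dvd n. mult_fun u d * mult_fun (\<lambda>p a. 1) (n div d))"
    using assms unfolding u_def
    by (intro sum.cong refl) (auto simp: mult_fun_const_1 moebius_mu_mult_fun dvd_pos_nat)
  also have "\<dots> = mult_fun (\<lambda>p a. \<Sum>i\<le>a. u p i * 1) n"
    by (rule dirichlet_convolution_mult_fun) (use assms in \<open>auto simp: u_def\<close>)
  also have "(\<lambda>p a. \<Sum>i\<le>a. u p i * 1) = (\<lambda>p a. if a = 0 then 1 else 0)"
  proof (intro ext)
    fix p a :: nat
    have "(\<Sum>i\<le>a. u p i * 1) = (\<Sum>i\<in>{..a} \<inter> {0, 1}. u p i)"
      unfolding mult_1_right by (rule sum.mono_neutral_right) (auto simp: u_def)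
    also have "\<dots> = (if a = 0 then 1 else 0)"
    proof (cases "a = 0")
      case False
      hence "{..a} \<inter> {0, 1} = {0, 1}" by auto
      thus ?thesis using False by (simp add: u_def)
    qed (simp add: u_def)
    finally show "(\<Sum>i\<le>a. u p i * 1) = (if a = 0 then 1 else 0)" .
  qed
  finally show ?thesis using assms by (simp add: mult_fun_delta)
qed

lemma abs_moebius_mu_le: "\<bar>moebius_mu n\<bar> \<le> 1"
  by (simp add: moebius_mu_def power_abs)

text \<open>
  The indicator of the integers not divisible by the fourth power of a prime.
\<close>
definition free4 :: "nat \<Rightarrow> real" where
  "free4 = mult_fun (\<lambda>p a. if a < 4 then 1 else 0)"

text \<open>
  The \<open>d\<close> with \<open>d ^ 4 dvd n\<close> are the divisors of the largest \<open>B\<close> with \<open>B ^ 4 dvd n\<close>, so the sum is 1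
  or 0 according as \<open>B = 1\<close> or not.
\<close>
lemma sum_moebius_mu_fourth_powers:
  assumes n: "n > 0"
  shows "(\<Sum>d | d ^ 4 dvd n. real_of_int (moebius_mu d)) = free4 n"
proof -
  define B where "B = (\<Prod>p\<in>prime_factors n. p ^ (multiplicity p n div 4))"
  have B0: "B > 0" unfolding B_def by (intro prod_pos) (auto simp: prime_gt_0_nat in_prime_factors_imp_prime)
  have multB: "multiplicity p B = multiplicity p n div 4" if "prime p" for p
    unfolding B_def using that
    by (subst multiplicity_prod_prime_powers)
       (use n in \<open>auto simp: in_prime_factors_iff not_dvd_imp_multiplicity_0\<close>)
  have dvd_iff: "d ^ 4 dvd n \<longleftrightarrow> d dvd B" for d
  proof (cases "d = 0")
    case False
    have "d ^ 4 dvd n \<longleftrightarrow> (\<forall>p. prime p \<longrightarrow> 4 * multiplicity p d \<le> multiplicity p n)"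
      using False n by (subst prime_multiplicity_le_imp_dvd) (auto simp: prime_elem_multiplicity_power_distrib)
    also have "\<dots> \<longleftrightarrow> (\<forall>p. prime p \<longrightarrow> multiplicity p d \<le> multiplicity p B)"
      using multB by (auto simp: less_eq_div_iff_mult_less_eq mult.commute)
    also have "\<dots> \<longleftrightarrow> d dvd B"
      using False B0 by (subst prime_multiplicity_le_imp_dvd) auto
    finally show ?thesis .
  qed (use n B0 in auto)
  have "(\<Sum>d | d ^ 4 dvd n. real_of_int (moebius_mu d)) = (if B = 1 then 1 else 0)"
    using sum_moebius_mu_divisors[OF B0] by (simp add: dvd_iff)
  also have "B = 1 \<longleftrightarrow> (\<forall>p\<in>prime_factors n. multiplicity p n < 4)"
  proof
    assume "B = 1"
    hence "multiplicity p n div 4 = 0" if "p \<in> prime_factors n" for p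
      using multB[OF in_prime_factors_imp_prime[OF that]] by simp
    thus "\<forall>p\<in>prime_factors n. multiplicity p n < 4" by (simp add: div_eq_0_iff)
  qed (auto simp: B_def)
  also have "(if \<dots> then 1 else 0) = free4 n"
    unfolding free4_def mult_fun_def by (auto simp: prod_zero_iff)
  finally show ?thesis .
qed

section \<open>Euler products\<close>

lemma mult_fun_abs: "\<bar>mult_fun u n\<bar> = mult_fun (\<lambda>p a. \<bar>u p a\<bar>) n"
  by (simp add: mult_fun_def abs_prod)

definition smooth :: "nat set \<Rightarrow> nat set" where
  "smooth P = {n. n > 0 \<and> prime_factors n \<subseteq> P}"

lemma smooth_empty: "smooth {} = {1}"
  by (auto simp: smooth_def prime_factorization_empty_iff set_mset_eq_empty_iff)

lemma bij_betw_smooth_insert: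
  assumes p: "prime p" "p \<notin> P"
  shows "bij_betw (\<lambda>(a, m). p ^ a * m) (UNIV \<times> smooth P) (smooth (insert p P))"
  unfolding bij_betw_def
proof (intro conjI equalityI subsetI)
  show "inj_on (\<lambda>(a, m). p ^ a * m) (UNIV \<times> smooth P)"
    by (rule inj_on_subset[OF inj_on_prime_power_mult[OF p(1)]])
       (use p in \<open>auto simp: smooth_def in_prime_factors_iff\<close>)
next
  fix y assume "y \<in> (\<lambda>(a, m). p ^ a * m) ` (UNIV \<times> smooth P)"
  then obtain a m where x: "y = p ^ a * m" "m > 0" "prime_factors m \<subseteq> P" by (auto simp: smooth_def)
  have "prime_factors (p ^ a * m) \<subseteq> insert p (prime_factors m)"
  proof
    fix q assume "q \<in> prime_factors (p ^ a * m)"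
    hence q: "prime q" "q dvd p ^ a \<or> q dvd m" by (auto simp: in_prime_factors_iff prime_dvd_mult_iff)
    have "q = p" if "q dvd p ^ a"
      by (rule primes_dvd_imp_eq[OF q(1) p(1) prime_dvd_power[OF q(1) that]])
    thus "q \<in> insert p (prime_factors m)" using q x(2) by (auto simp: in_prime_factors_iff)
  qed
  thus "y \<in> smooth (insert p P)"
    using x p prime_gt_0_nat[OF p(1)] by (auto simp: smooth_def)
next
  fix y assume y: "y \<in> smooth (insert p P)"
  obtain m where m: "y = p ^ multiplicity p y * m" "\<not> p dvd m"
    by (rule multiplicity_decompose'[of y p]) (use y p in \<open>auto simp: smooth_def\<close>)
  have "m > 0" using m y by (cases m) (auto simp: smooth_def)
  moreover have "prime_factors m \<subseteq> prime_factors y - {p}"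
  proof
    fix q assume "q \<in> prime_factors m"
    moreover have "m dvd y" by (subst m(1)) simp
    ultimately show "q \<in> prime_factors y - {p}"
      using m(2) y by (auto simp: in_prime_factors_iff smooth_def intro: dvd_trans)
  qed
  ultimately have "m \<in> smooth P" using y by (auto simp: smooth_def)
  thus "y \<in> (\<lambda>(a, m). p ^ a * m) ` (UNIV \<times> smooth P)"
    using m by (intro image_eqI[of _ _ "(multiplicity p y, m)"]) auto
qed

text \<open>
  The Euler product over finitely many primes: unique factorization makes the integers built from
  \<open>insert p P\<close> a product of the powers of \<open>p\<close> and the integers built from \<open>P\<close>.
\<close>
lemma euler_product_smooth:
  assumes "finite P" "\<And>p. p \<in> P \<Longrightarrow> prime p" "\<And>p. u p 0 = 1"
    and "\<And>p. p \<in> P \<Longrightarrow> summable (\<lambda>a. \<bar>u p a\<bar>)"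
  shows "(\<lambda>n. \<bar>mult_fun u n\<bar>) summable_on smooth P \<and>
         (mult_fun u has_sum (\<Prod>p\<in>P. \<Sum>a. u p a)) (smooth P)"
  using assms
proof (induction P rule: finite_induct)
  case empty
  thus ?case by (simp add: smooth_empty has_sum_finiteI)
next
  case (insert p P)
  have IH: "(\<lambda>n. \<bar>mult_fun u n\<bar>) summable_on smooth P"
    "(mult_fun u has_sum (\<Prod>p\<in>P. \<Sum>a. u p a)) (smooth P)"
    using insert by auto
  have p: "prime p" "summable (\<lambda>a. \<bar>u p a\<bar>)" using insert.prems by auto
  have up: "(u p has_sum (\<Sum>a. u p a)) UNIV"
    using p(2) by (intro norm_summable_imp_has_sum) (auto intro: summable_sums summable_rabs_cancel)
  note bij = bij_betw_smooth_insert[OF p(1) insert.hyps(2)]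
  have eq: "mult_fun u (case z of (a, m) \<Rightarrow> p ^ a * m) = u p (fst z) * mult_fun u (snd z)"
    if "z \<in> UNIV \<times> smooth P" for z
  proof -
    have "snd z > 0" "\<not> p dvd snd z" using that insert.hyps(2) p(1)
      by (auto simp: smooth_def in_prime_factors_iff)
    thus ?thesis using mult_fun_prime_power_mult[OF p(1), of "snd z" u "fst z"] insert.prems
      by (simp add: case_prod_unfold)
  qed
  note prod = has_sum_Times[of "u p" UNIV "mult_fun u" "smooth P"]
  have un: "(\<lambda>a. norm (u p a)) summable_on UNIV"
    using p(2) by (simp add: summable_on_UNIV_nonneg_real_iff)
  have "(\<lambda>z. norm (u p (fst z) * mult_fun u (snd z))) summable_on UNIV \<times> smooth P"
    using un IH(1) by (intro prod(1)) auto
  also have "?this \<longleftrightarrow> (\<lambda>z. norm (mult_fun u (case z of (a, m) \<Rightarrow> p ^ a * m))) summable_on UNIV \<times> smooth P"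
    by (intro summable_on_cong) (simp only: eq)
  also have "\<dots> \<longleftrightarrow> (\<lambda>n. \<bar>mult_fun u n\<bar>) summable_on smooth (insert p P)"
    using summable_on_reindex_bij_betw[OF bij, of "\<lambda>n. \<bar>mult_fun u n\<bar>"] by simp
  finally have 1: "(\<lambda>n. \<bar>mult_fun u n\<bar>) summable_on smooth (insert p P)" .
  have "((\<lambda>z. u p (fst z) * mult_fun u (snd z)) has_sum
           (infsum (u p) UNIV * infsum (mult_fun u) (smooth P))) (UNIV \<times> smooth P)"
    using un IH(1) by (intro prod(2)) auto
  also have "?this \<longleftrightarrow> ((\<lambda>z. mult_fun u (case z of (a, m) \<Rightarrow> p ^ a * m)) has_sum
           (infsum (u p) UNIV * infsum (mult_fun u) (smooth P))) (UNIV \<times> smooth P)"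
    by (intro has_sum_cong) (simp only: eq)
  also have "\<dots> \<longleftrightarrow> (mult_fun u has_sum (infsum (u p) UNIV * infsum (mult_fun u) (smooth P))) (smooth (insert p P))"
    by (rule has_sum_reindex_bij_betw[OF bij])
  also have "infsum (u p) UNIV = (\<Sum>a. u p a)" using up by (rule infsumI)
  also have "infsum (mult_fun u) (smooth P) = (\<Prod>p\<in>P. \<Sum>a. u p a)" using IH(2) by (rule infsumI)
  finally show ?case using 1 insert.hyps by simp
qed

text \<open>
  The finite Euler products of the absolute values stay below \<open>exp\<close> of the sum in \<open>t\<close>, which bounds all
  finite partial sums of the series.
\<close>
lemma euler_product:
  assumes u: "\<And>p. u p 0 = 1" and up: "\<And>p. prime p \<Longrightarrow> summable (\<lambda>a. \<bar>u p a\<bar>)"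
    and t: "summable (\<lambda>p. if prime p then \<Sum>a. \<bar>u p (Suc a)\<bar> else 0)"
  shows "(\<lambda>n. \<bar>mult_fun u n\<bar>) summable_on {0<..}"
    and "(\<lambda>N. \<Prod>p\<le>N. if prime p then \<Sum>a. u p a else 1) \<longlonglongrightarrow> infsum (mult_fun u) {0<..}"
proof -
  define T where "T = (\<lambda>p. if prime p then \<Sum>a. \<bar>u p (Suc a)\<bar> else 0)"
  define P where "P = (\<lambda>N::nat. {p. prime p \<and> p \<le> N})"
  have finP: "finite (P N)" for N unfolding P_def by (rule finite_subset[of _ "{..N}"]) auto
  have T0: "T p \<ge> 0" for p unfolding T_def
    using up[of p] summable_Suc_iff[of "\<lambda>a. \<bar>u p a\<bar>"] by (auto intro!: suminf_nonneg)
  have euler: "(\<lambda>n. \<bar>mult_fun u n\<bar>) summable_on smooth (P N) \<and>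
         (mult_fun u has_sum (\<Prod>p\<in>P N. \<Sum>a. u p a)) (smooth (P N))" for N
    by (rule euler_product_smooth) (use finP u up in \<open>auto simp: P_def\<close>)
  have "(mult_fun (\<lambda>p a. \<bar>u p a\<bar>) has_sum (\<Prod>p\<in>P N. \<Sum>a. \<bar>u p a\<bar>)) (smooth (P N))" for N
    by (rule euler_product_smooth[THEN conjunct2]) (use finP u up in \<open>auto simp: P_def\<close>)
  hence euler_abs: "((\<lambda>n. \<bar>mult_fun u n\<bar>) has_sum (\<Prod>p\<in>P N. \<Sum>a. \<bar>u p a\<bar>)) (smooth (P N))" for N
    by (simp add: mult_fun_abs)
  have bound: "(\<Prod>p\<in>P N. \<Sum>a. \<bar>u p a\<bar>) \<le> exp (suminf T)" for N
  proof -
    have "(\<Prod>p\<in>P N. \<Sum>a. \<bar>u p a\<bar>) \<le> (\<Prod>p\<in>P N. exp (T p))"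
    proof (rule prod_mono)
      fix p assume "p \<in> P N"
      hence p: "prime p" by (simp add: P_def)
      have "(\<Sum>a. \<bar>u p a\<bar>) = 1 + T p"
        using suminf_split_head[OF up[OF p]] p u by (simp add: T_def)
      thus "0 \<le> (\<Sum>a. \<bar>u p a\<bar>) \<and> (\<Sum>a. \<bar>u p a\<bar>) \<le> exp (T p)"
        using up[OF p] T0[of p] exp_ge_add_one_self[of "T p"] by auto
    qed
    also have "\<dots> = exp (sum T (P N))" using finP by (simp add: exp_sum)
    also have "sum T (P N) \<le> suminf T"
      using t T0 finP by (intro sum_le_suminf) (auto simp: T_def[abs_def])
    finally show ?thesis by simp
  qed
  have sub: "F \<subseteq> smooth (P N)" if "F \<subseteq> {0<..}" "\<And>n. n \<in> F \<Longrightarrow> n \<le> N" for F N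
  proof
    fix n assume n: "n \<in> F"
    have "p \<in> P N" if "p \<in> prime_factors n" for p
      using that \<open>\<And>n. n \<in> F \<Longrightarrow> n \<le> N\<close>[OF n] by (auto simp: P_def in_prime_factors_iff dest: dvd_imp_le)
    thus "n \<in> smooth (P N)" using n \<open>F \<subseteq> {0<..}\<close> by (auto simp: smooth_def)
  qed
  show summ: "(\<lambda>n. \<bar>mult_fun u n\<bar>) summable_on {0<..}"
  proof (rule nonneg_bdd_above_summable_on)
    show "bdd_above (sum (\<lambda>n. \<bar>mult_fun u n\<bar>) ` {F. F \<subseteq> {0<..} \<and> finite F})"
    proof (rule bdd_aboveI2)
      fix F :: "nat set" assume F: "F \<in> {F. F \<subseteq> {0<..} \<and> finite F}"
      define N where "N = Max (insert 0 F)"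
      have "F \<subseteq> smooth (P N)" by (rule sub) (use F in \<open>auto simp: N_def\<close>)
      hence "(\<Sum>n\<in>F. \<bar>mult_fun u n\<bar>) \<le> infsum (\<lambda>n. \<bar>mult_fun u n\<bar>) (smooth (P N))"
        using F euler[of N] by (intro finite_sum_le_infsum) auto
      also have "\<dots> = (\<Prod>p\<in>P N. \<Sum>a. \<bar>u p a\<bar>)" using euler_abs by (rule infsumI)
      also have "\<dots> \<le> exp (suminf T)" by (rule bound)
      finally show "(\<Sum>n\<in>F. \<bar>mult_fun u n\<bar>) \<le> exp (suminf T)" .
    qed
  qed auto
  define S where "S = infsum (mult_fun u) {0<..}"
  have S: "(mult_fun u has_sum S) {0<..}"
    unfolding S_def by (rule has_sum_infsum, rule abs_summable_summable) (use summ in simp)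
  have prod_eq: "(\<Prod>p\<le>N. if prime p then \<Sum>a. u p a else 1) = (\<Prod>p\<in>P N. \<Sum>a. u p a)" for N
    by (rule prod.mono_neutral_cong_right) (auto simp: P_def)
  show "(\<lambda>N. \<Prod>p\<le>N. if prime p then \<Sum>a. u p a else 1) \<longlonglongrightarrow> infsum (mult_fun u) {0<..}"
    unfolding prod_eq S_def[symmetric]
  proof (rule metric_LIMSEQ_I)
    fix e :: real assume e: "e > 0"
    have "\<forall>\<^sub>F F in finite_subsets_at_top {0<..}. dist (sum (mult_fun u) F) S < e / 2"
      using S e unfolding has_sum_def tendsto_iff by (meson half_gt_zero)
    then obtain X where X: "finite X" "X \<subseteq> {0<..}"
      "\<forall>F. finite F \<and> X \<subseteq> F \<and> F \<subseteq> {0<..} \<longrightarrow> dist (sum (mult_fun u) F) S < e / 2"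
      unfolding eventually_finite_subsets_at_top by (elim exE conjE) (rule that)
    show "\<exists>M. \<forall>N\<ge>M. dist (\<Prod>p\<in>P N. \<Sum>a. u p a) S < e"
    proof (intro exI allI impI)
      fix N assume N: "N \<ge> Max (insert 0 X)"
      have XN: "X \<subseteq> smooth (P N)" by (rule sub) (use X(1,2) N in auto)
      have "dist (\<Prod>p\<in>P N. \<Sum>a. u p a) S \<le> e / 2"
      proof (rule tendsto_upperbound)
        show "((\<lambda>F. dist (sum (mult_fun u) F) S) \<longlongrightarrow> dist (\<Prod>p\<in>P N. \<Sum>a. u p a) S)
                (finite_subsets_at_top (smooth (P N)))"
          using euler[of N] unfolding has_sum_def by (intro tendsto_intros) auto
        show "\<forall>\<^sub>F F in finite_subsets_at_top (smooth (P N)). dist (sum (mult_fun u) F) S \<le> e / 2"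
          unfolding eventually_finite_subsets_at_top
        proof (intro exI[of _ X] conjI allI impI X(1) XN)
          fix F assume F: "finite F \<and> X \<subseteq> F \<and> F \<subseteq> smooth (P N)"
          hence "F \<subseteq> {0<..}" by (auto simp: smooth_def)
          hence "dist (sum (mult_fun u) F) S < e / 2" using X(3) F by blast
          thus "dist (sum (mult_fun u) F) S \<le> e / 2" by linarith
        qed
      qed auto
      thus "dist (\<Prod>p\<in>P N. \<Sum>a. u p a) S < e" using e by linarith
    qed
  qed
qed

lemma mult_fun_mult: "mult_fun (\<lambda>p a. u p a * v p a) n = mult_fun u n * mult_fun v n"
  by (simp add: mult_fun_def prod.distrib)

lemma mult_fun_powr:
  assumes "n > 0"
  shows "mult_fun (\<lambda>p a. (real p powr s) ^ a) n = real n powr s"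
  using assms
proof (induction n rule: less_induct)
  case (less n)
  from less.prems show ?case
  proof (cases rule: nat_prime_power_cases)
    case (prime_power p k m)
    have "mult_fun (\<lambda>p a. (real p powr s) ^ a) n = (real p powr s) ^ k * real m powr s"
      using prime_power less.IH[of m] by (simp add: mult_fun_prime_power_mult)
    also have "\<dots> = real n powr s"
    proof -
      have "(real p powr s) ^ k = (real p ^ k) powr s"
        using prime_gt_0_nat[OF prime_power(1)]
        by (simp add: powr_powr mult.commute flip: powr_realpow)
      thus ?thesis by (simp add: prime_power(6) powr_mult)
    qed
    finally show ?thesis .
  qed simp
qed

section \<open>The cofactor of the exponentially squarefree integers\<close>

text \<open>
  The value of \<open>|exp_moebius|\<close> at a prime power, as a function of the exponent. The exponent 0 is
  counted as admissible because \<open>mult_fun\<close> convolutions need the value 1 there.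
\<close>
definition sqf_exp :: "nat \<Rightarrow> real" where
  "sqf_exp a = (if a = 0 \<or> squarefree a then 1 else 0)"

definition sqf_exp_diff :: "nat \<Rightarrow> real" where
  "sqf_exp_diff a = sqf_exp a - (if a = 0 then 0 else sqf_exp (a - 1))"

text \<open>
  The coefficients of \<open>(1 - X) * E(X) / (1 - X ^ 4)\<close> where \<open>E\<close> is the generating series of
  \<open>sqf_exp\<close>: dividing by \<open>1 - X ^ 4\<close> is the recursion with step 4. The factor
  \<open>(1 - X ^ 4) / (1 - X) = 1 + X + X\<^sup>2 + X\<^sup>3\<close> removed from \<open>E\<close> is the local series of \<open>free4\<close>.
\<close>
fun cofactor_coeff :: "nat \<Rightarrow> real" where
  "cofactor_coeff a = sqf_exp_diff a + (if a \<ge> 4 then cofactor_coeff (a - 4) else 0)"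

declare cofactor_coeff.simps [simp del]

lemma squarefree_small:
  "squarefree (1::nat)" "squarefree (2::nat)" "squarefree (3::nat)" "\<not> squarefree (4::nat)"
proof -
  show "squarefree (2::nat)" "squarefree (3::nat)"
    by (rule squarefree_prime; simp)+
  have "(2::nat)\<^sup>2 dvd 4" "\<not> (2::nat) dvd 1" by simp_all
  thus "\<not> squarefree (4::nat)" unfolding squarefree_def by blast
qed auto

lemma sqf_exp_small: "sqf_exp 0 = 1" "sqf_exp (Suc 0) = 1" "sqf_exp 1 = 1" "sqf_exp 2 = 1" "sqf_exp 3 = 1" "sqf_exp 4 = 0"
  using squarefree_small by (auto simp: sqf_exp_def)

text \<open>
  The vanishing of the coefficients 1 to 4 is what makes the exponent 1/5 possible: the series of
  \<open>cofactor\<close> behaves like a sum over fifth powers.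
\<close>
lemma cofactor_coeff_small:
  "cofactor_coeff 0 = 1" "cofactor_coeff 1 = 0" "cofactor_coeff 2 = 0" "cofactor_coeff 3 = 0" "cofactor_coeff 4 = 0"
  by (simp_all add: cofactor_coeff.simps sqf_exp_diff_def sqf_exp_small)

lemma sqf_exp_nonneg: "sqf_exp a \<ge> 0" and sqf_exp_le_1: "sqf_exp a \<le> 1"
  by (auto simp: sqf_exp_def)

lemma abs_cofactor_coeff_le: "\<bar>cofactor_coeff a\<bar> \<le> real a + 1"
proof (induction a rule: less_induct)
  case (less a)
  have "\<bar>sqf_exp_diff a\<bar> \<le> 1"
    using sqf_exp_nonneg[of a] sqf_exp_le_1[of a] sqf_exp_nonneg[of "a - 1"] sqf_exp_le_1[of "a - 1"]
    by (auto simp: sqf_exp_diff_def)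
  moreover have "\<bar>cofactor_coeff (a - 4)\<bar> \<le> real a - 3" if "a \<ge> 4"
    using less.IH[of "a - 4"] that by (simp add: of_nat_diff)
  ultimately show ?case by (subst cofactor_coeff.simps) auto
qed

text \<open>
  The sum of four consecutive coefficients is a coefficient of
  \<open>(1 + X + X\<^sup>2 + X\<^sup>3) * (1 - X) * E(X) / (1 - X ^ 4) = E(X)\<close>.
\<close>
lemma cofactor_coeff_window:
  "cofactor_coeff (a + 3) + cofactor_coeff (a + 2) + cofactor_coeff (a + 1) + cofactor_coeff a = sqf_exp (a + 3)"
proof (induction a)
  case 0
  show ?case using cofactor_coeff_small sqf_exp_small by (simp add: eval_nat_numeral)
next
  case (Suc a)
  have "cofactor_coeff (a + 4) = sqf_exp (a + 4) - sqf_exp (a + 3) + cofactor_coeff a"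
    by (subst cofactor_coeff.simps) (simp add: sqf_exp_diff_def eval_nat_numeral)
  thus ?case using Suc by (simp add: eval_nat_numeral)
qed

lemma cofactor_coeff_convolution:
  "(\<Sum>i\<le>a. (if i < 4 then 1 else 0) * cofactor_coeff (a - i)) = sqf_exp a"
proof -
  have "(\<Sum>i\<le>a. (if i < 4 then 1 else 0) * cofactor_coeff (a - i)) = (\<Sum>i | i \<le> a \<and> i < 4. cofactor_coeff (a - i))"
    by (rule sum.mono_neutral_cong_right) auto
  also have "\<dots> = sqf_exp a"
  proof (cases "a \<ge> 3")
    case True
    then obtain b where b: "a = b + 3" by (metis add.commute le_Suc_ex)
    have "{i. i \<le> a \<and> i < 4} = {0, 1, 2, 3}" using True by auto
    thus ?thesis using cofactor_coeff_window[of b] by (simp add: b eval_nat_numeral)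
  next
    case False
    hence "a = 0 \<or> a = 1 \<or> a = 2" by linarith
    moreover have "{i. i \<le> (0::nat) \<and> i < 4} = {0}" "{i. i \<le> (1::nat) \<and> i < 4} = {0, 1}"
      "{i. i \<le> (2::nat) \<and> i < 4} = {0, 1, 2}" by auto
    ultimately show ?thesis using cofactor_coeff_small by (elim disjE) (simp_all add: sqf_exp_small)
  qed
  finally show ?thesis .
qed

definition cofactor :: "nat \<Rightarrow> real" where
  "cofactor = mult_fun (\<lambda>p. cofactor_coeff)"

lemma abs_exp_moebius_convolution:
  assumes "n > 0"
  shows "real_of_int \<bar>exp_moebius n\<bar> = (\<Sum>d | d dvd n. free4 d * cofactor (n div d))"
proof -
  have "real_of_int \<bar>exp_moebius n\<bar> = mult_fun (\<lambda>p. sqf_exp) n"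
    unfolding exp_moebius_def mult_fun_def abs_prod of_int_prod
    by (intro prod.cong refl) (auto simp: moebius_mu_def sqf_exp_def power_abs prime_factors_multiplicity)
  also have "(\<lambda>p::nat. sqf_exp) = (\<lambda>p a. \<Sum>i\<le>a. (if i < 4 then 1 else 0) * cofactor_coeff (a - i))"
    by (simp only: cofactor_coeff_convolution)
  also have "mult_fun \<dots> n = (\<Sum>d | d dvd n. free4 d * cofactor (n div d))"
    unfolding free4_def cofactor_def
    by (rule dirichlet_convolution_mult_fun[symmetric]) (use assms cofactor_coeff_small in auto)
  finally show ?thesis .
qed

lemma cofactor_coeff_tail_bound:
  fixes X r :: real
  assumes X: "0 \<le> X" "X \<le> r" and r: "r < 1"
  shows "summable (\<lambda>a. \<bar>cofactor_coeff a * X ^ a\<bar>)"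
    and "(\<Sum>a. \<bar>cofactor_coeff (Suc a) * X ^ Suc a\<bar>) \<le> 6 / (1 - r)\<^sup>2 * X ^ 5"
proof -
  have geo: "(\<lambda>n. real (Suc n) * r ^ n) sums (1 / (1 - r)\<^sup>2)"
    using geometric_deriv_sums[of r] X r by simp
  have le: "\<bar>cofactor_coeff (b + 5) * X ^ (b + 5)\<bar> \<le> 6 * X ^ 5 * (real (Suc b) * r ^ b)" for b
  proof -
    have "\<bar>cofactor_coeff (b + 5) * X ^ (b + 5)\<bar> \<le> (real (b + 5) + 1) * X ^ (b + 5)"
      using X abs_cofactor_coeff_le[of "b + 5"] by (auto simp: abs_mult intro: mult_right_mono)
    also have "\<dots> \<le> (6 * real (Suc b)) * (r ^ b * X ^ 5)"
      unfolding power_add using X by (intro mult_mono power_mono mult_right_mono) auto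
    finally show ?thesis by (simp add: algebra_simps)
  qed
  have s5: "summable (\<lambda>b. \<bar>cofactor_coeff (b + 5) * X ^ (b + 5)\<bar>)"
    by (rule summable_comparison_test'[OF summable_mult[OF sums_summable[OF geo], of "6 * X ^ 5"]])
       (use le in auto)
  thus s: "summable (\<lambda>a. \<bar>cofactor_coeff a * X ^ a\<bar>)"
    using summable_iff_shift[of "\<lambda>a. \<bar>cofactor_coeff a * X ^ a\<bar>" 5] by simp
  have s1: "summable (\<lambda>a. \<bar>cofactor_coeff (Suc a) * X ^ Suc a\<bar>)"
    using s summable_Suc_iff[of "\<lambda>a. \<bar>cofactor_coeff a * X ^ a\<bar>"] by simp
  have "(\<Sum>a. \<bar>cofactor_coeff (Suc a) * X ^ Suc a\<bar>) =
          (\<Sum>b. \<bar>cofactor_coeff (b + 5) * X ^ (b + 5)\<bar>) + (\<Sum>a<4. \<bar>cofactor_coeff (Suc a) * X ^ Suc a\<bar>)"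
    using suminf_split_initial_segment[OF s1, of 4] by (simp add: eval_nat_numeral)
  also have "(\<Sum>a<4. \<bar>cofactor_coeff (Suc a) * X ^ Suc a\<bar>) = 0"
    using cofactor_coeff_small by (simp add: eval_nat_numeral)
  also have "(\<Sum>b. \<bar>cofactor_coeff (b + 5) * X ^ (b + 5)\<bar>) \<le> (\<Sum>b. 6 * X ^ 5 * (real (Suc b) * r ^ b))"
    by (intro suminf_le le s5 summable_mult sums_summable[OF geo])
  also have "\<dots> = 6 * X ^ 5 * (1 / (1 - r)\<^sup>2)"
    by (rule sums_unique[OF sums_mult[OF geo], symmetric])
  finally show "(\<Sum>a. \<bar>cofactor_coeff (Suc a) * X ^ Suc a\<bar>) \<le> 6 / (1 - r)\<^sup>2 * X ^ 5" by simp
qed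

lemma cofactor_euler_product:
  fixes \<sigma> :: real
  assumes \<sigma>: "\<sigma> > 1 / 5"
  shows "(\<lambda>n. \<bar>cofactor n * real n powr (-\<sigma>)\<bar>) summable_on {0<..}"
    and "(\<lambda>N. \<Prod>p\<le>N. if prime p then \<Sum>a. cofactor_coeff a * (real p powr (-\<sigma>)) ^ a else 1) \<longlonglongrightarrow>
           infsum (\<lambda>n. cofactor n * real n powr (-\<sigma>)) {0<..}"
proof -
  define u where "u = (\<lambda>p a. cofactor_coeff a * (real p powr (-\<sigma>)) ^ a)"
  have eq: "mult_fun u n = cofactor n * real n powr (-\<sigma>)" if "n \<in> {0<..}" for n
    unfolding u_def cofactor_def mult_fun_mult using that by (subst mult_fun_powr) auto
  define r :: real where "r = 2 powr (-\<sigma>)"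
  have r: "r < 1" using \<sigma> powr_less_mono[of "-\<sigma>" 0 2] by (simp add: r_def)
  have X: "0 \<le> real p powr (-\<sigma>)" "real p powr (-\<sigma>) \<le> r" if "prime p" for p
    using prime_ge_2_nat[OF that] \<sigma> unfolding r_def by (auto intro!: powr_mono2')
  have u0: "u p 0 = 1" for p by (simp add: u_def cofactor_coeff_small)
  have us: "summable (\<lambda>a. \<bar>u p a\<bar>)" if "prime p" for p
    unfolding u_def by (rule cofactor_coeff_tail_bound(1)[OF X[OF that] r])
  have t: "summable (\<lambda>p. if prime p then \<Sum>a. \<bar>u p (Suc a)\<bar> else 0)"
  proof (rule summable_comparison_test')
    show "summable (\<lambda>p. 6 / (1 - r)\<^sup>2 * real p powr (- (5 * \<sigma>)))"
      using \<sigma> by (intro summable_mult) (simp add: summable_real_powr_iff)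
    fix p :: nat
    show "norm (if prime p then \<Sum>a. \<bar>u p (Suc a)\<bar> else 0) \<le> 6 / (1 - r)\<^sup>2 * real p powr (- (5 * \<sigma>))"
    proof (cases "prime p")
      case True
      have "(\<Sum>a. \<bar>u p (Suc a)\<bar>) \<le> 6 / (1 - r)\<^sup>2 * (real p powr (-\<sigma>)) ^ 5"
        unfolding u_def by (rule cofactor_coeff_tail_bound(2)[OF X[OF True] r])
      also have "(real p powr (-\<sigma>)) ^ 5 = real p powr (- (5 * \<sigma>))"
        using prime_gt_0_nat[OF True] by (simp add: powr_power)
      moreover have "(\<Sum>a. \<bar>u p (Suc a)\<bar>) \<ge> 0"
        using us[OF True] summable_Suc_iff[of "\<lambda>a. \<bar>u p a\<bar>"] by (intro suminf_nonneg) auto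
      ultimately show ?thesis using True by simp
    qed auto
  qed
  have "(\<lambda>n. \<bar>mult_fun u n\<bar>) summable_on {0<..}"
    by (rule euler_product(1)[OF u0 us t])
  thus "(\<lambda>n. \<bar>cofactor n * real n powr (-\<sigma>)\<bar>) summable_on {0<..}"
    by (rule summable_on_cong[THEN iffD1, rotated]) (simp add: eq)
  have "(\<lambda>N. \<Prod>p\<le>N. if prime p then \<Sum>a. u p a else 1) \<longlonglongrightarrow> infsum (mult_fun u) {0<..}"
    by (rule euler_product(2)[OF u0 us t])
  also have "infsum (mult_fun u) {0<..} = infsum (\<lambda>n. cofactor n * real n powr (-\<sigma>)) {0<..}"
    by (intro infsum_cong eq)
  finally show "(\<lambda>N. \<Prod>p\<le>N. if prime p then \<Sum>a. cofactor_coeff a * (real p powr (-\<sigma>)) ^ a else 1) \<longlonglongrightarrow>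
           infsum (\<lambda>n. cofactor n * real n powr (-\<sigma>)) {0<..}" unfolding u_def .
qed

lemma moebius_euler_product:
  fixes \<sigma> :: real
  assumes \<sigma>: "\<sigma> > 1"
  shows "(\<lambda>n. \<bar>moebius_mu n * real n powr (-\<sigma>)\<bar>) summable_on {0<..}"
    and "(\<lambda>N. \<Prod>p\<le>N. if prime p then 1 - real p powr (-\<sigma>) else 1) \<longlonglongrightarrow>
           infsum (\<lambda>n. moebius_mu n * real n powr (-\<sigma>)) {0<..}"
proof -
  define m where "m = (\<lambda>a::nat. if a = 0 then 1 else if a = 1 then -1 else 0 :: real)"
  define u where "u = (\<lambda>p a. m a * (real p powr (-\<sigma>)) ^ a)"
  have eq: "mult_fun u n = moebius_mu n * real n powr (-\<sigma>)" if "n \<in> {0<..}" for n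
    unfolding u_def mult_fun_mult m_def using that by (simp add: mult_fun_powr moebius_mu_mult_fun)
  have u0: "u p 0 = 1" for p by (simp add: u_def m_def)
  have sums: "u p sums (\<Sum>a\<in>{0,1}. u p a)" "(\<lambda>a. \<bar>u p a\<bar>) sums (\<Sum>a\<in>{0,1}. \<bar>u p a\<bar>)"
    "(\<lambda>a. \<bar>u p (Suc a)\<bar>) sums (\<Sum>a\<in>{0}. \<bar>u p (Suc a)\<bar>)" for p
    by (rule sums_finite; auto simp: u_def m_def)+
  have t: "summable (\<lambda>p. if prime p then \<Sum>a. \<bar>u p (Suc a)\<bar> else 0)"
  proof (rule summable_comparison_test')
    show "summable (\<lambda>p. real p powr (- \<sigma>))"
      using \<sigma> by (simp add: summable_real_powr_iff)
    fix p :: nat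
    have "(\<Sum>a. \<bar>u p (Suc a)\<bar>) = real p powr (-\<sigma>)"
      using sums_unique[OF sums(3)[of p]] by (simp add: u_def m_def)
    thus "norm (if prime p then \<Sum>a. \<bar>u p (Suc a)\<bar> else 0) \<le> real p powr (-\<sigma>)" by simp
  qed
  have "(\<lambda>n. \<bar>mult_fun u n\<bar>) summable_on {0<..}"
    by (rule euler_product(1)[OF u0 sums_summable[OF sums(2)] t])
  thus "(\<lambda>n. \<bar>moebius_mu n * real n powr (-\<sigma>)\<bar>) summable_on {0<..}"
    by (rule summable_on_cong[THEN iffD1, rotated]) (simp add: eq)
  have "(\<lambda>N. \<Prod>p\<le>N. if prime p then \<Sum>a. u p a else 1) \<longlonglongrightarrow> infsum (mult_fun u) {0<..}"
    by (rule euler_product(2)[OF u0 sums_summable[OF sums(2)] t])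
  also have "infsum (mult_fun u) {0<..} = infsum (\<lambda>n. moebius_mu n * real n powr (-\<sigma>)) {0<..}"
    by (intro infsum_cong eq)
  also have "(\<lambda>p. \<Sum>a. u p a) = (\<lambda>p. 1 - real p powr (-\<sigma>))"
    using sums_unique[OF sums(1)] by (intro ext) (simp add: u_def m_def)
  finally show "(\<lambda>N. \<Prod>p\<le>N. if prime p then 1 - real p powr (-\<sigma>) else 1) \<longlonglongrightarrow>
           infsum (\<lambda>n. moebius_mu n * real n powr (-\<sigma>)) {0<..}" by (simp add: u_def m_def)
qed

lemma euler_factor_eq:
  assumes p: "prime p"
  shows "euler_factor p = (1 - real p powr (-4)) * (\<Sum>a. cofactor_coeff a * (real p powr (-1)) ^ a)"
proof -
  define X where "X = 1 / real p"
  have p2: "p \<ge> 2" using p by (rule prime_ge_2_nat)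
  have X: "0 \<le> X" "X \<le> 1 / 2" using p2 by (auto simp: X_def field_simps)
  have X4: "real p powr (-4) = X ^ 4" and X1: "real p powr (-1) = X"
    using p2 by (simp_all add: X_def powr_minus powr_numeral field_simps)
  have s: "summable (\<lambda>a. cofactor_coeff a * X ^ a)"
    by (rule summable_rabs_cancel[OF cofactor_coeff_tail_bound(1)[OF X]]) simp
  define H where "H = (\<Sum>a. cofactor_coeff a * X ^ a)"
  have 1: "(\<lambda>a. cofactor_coeff a * X ^ a) sums H" unfolding H_def using s by (rule summable_sums)
  have 2: "(\<lambda>a. if a \<ge> 4 then cofactor_coeff (a - 4) * X ^ a else 0) sums (X ^ 4 * H)"
  proof -
    have "(\<lambda>a. X ^ 4 * (cofactor_coeff a * X ^ a)) sums (X ^ 4 * H)" by (intro sums_mult 1)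
    hence "(\<lambda>a. (\<lambda>a. if a \<ge> 4 then cofactor_coeff (a - 4) * X ^ a else 0) (a + 4)) sums (X ^ 4 * H)"
      by (simp add: power_add mult_ac)
    thus ?thesis by (subst (asm) sums_iff_shift) simp
  qed
  have "(\<lambda>a. cofactor_coeff a * X ^ a - (if a \<ge> 4 then cofactor_coeff (a - 4) * X ^ a else 0)) sums (H - X ^ 4 * H)"
    by (intro sums_diff 1 2)
  also have "(\<lambda>a. cofactor_coeff a * X ^ a - (if a \<ge> 4 then cofactor_coeff (a - 4) * X ^ a else 0)) = (\<lambda>a. sqf_exp_diff a * X ^ a)"
    by (intro ext, subst cofactor_coeff.simps) (simp add: algebra_simps)
  finally have 3: "(\<lambda>a. sqf_exp_diff a * X ^ a) sums (H - X ^ 4 * H)" .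
  have 4: "(\<lambda>k. sqf_exp_diff (k + 4) * X ^ (k + 4)) sums (H - X ^ 4 * H - 1)"
  proof -
    have "sqf_exp_diff 0 = 1" "sqf_exp_diff 1 = 0" "sqf_exp_diff 2 = 0" "sqf_exp_diff 3 = 0"
      using sqf_exp_small by (simp_all add: sqf_exp_diff_def eval_nat_numeral)
    hence "(\<Sum>a<4. sqf_exp_diff a * X ^ a) = 1" by (simp add: eval_nat_numeral)
    thus ?thesis using 3 by (subst sums_iff_shift) simp
  qed
  define f where "f = (\<lambda>a. real_of_int ((moebius_mu a)\<^sup>2 - (moebius_mu (a - 1))\<^sup>2) / real p ^ a)"
  have "(f has_sum infsum f {4..}) {4..}"
    unfolding f_def by (rule has_sum_infsum[OF euler_factor_summable[OF p2]])
  moreover have "bij_betw (\<lambda>k. k + 4) UNIV {4::nat..}"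
    by (rule bij_betw_byWitness[of _ "\<lambda>k. k - 4"]) auto
  ultimately have "((\<lambda>k. f (k + 4)) has_sum infsum f {4..}) UNIV"
    using has_sum_reindex_bij_betw by blast
  hence "(\<lambda>k. f (k + 4)) sums infsum f {4..}"
    by (rule has_sum_imp_sums)
  moreover have "f (k + 4) = sqf_exp_diff (k + 4) * X ^ (k + 4)" for k
    by (simp add: f_def moebius_mu_square sqf_exp_diff_def sqf_exp_def X_def power_divide)
  ultimately have "infsum f {4..} = H - X ^ 4 * H - 1" using 4 sums_unique2 by simp
  thus ?thesis unfolding euler_factor_def f_def[symmetric] X4 X1 H_def[symmetric]
    by (simp add: algebra_simps)
qed

text \<open>
  At \<open>X = 1 / p\<close> the local factors \<open>1 - X ^ 4\<close> of the Moebius series and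
  \<open>(1 - X) * E(X) / (1 - X ^ 4)\<close> of \<open>cofactor\<close> multiply to \<open>(1 - X) * E(X)\<close>, whose coefficients are
  the differences in \<open>euler_factor\<close>.
\<close>
lemma euler_constant:
  "(\<Prod>p. if prime p then euler_factor p else 1) =
     infsum (\<lambda>d. moebius_mu d * real d powr (-4)) {0<..} * infsum (\<lambda>n. cofactor n * real n powr (-1)) {0<..}"
proof -
  have "(\<lambda>N. \<Prod>p\<le>N. if prime p then euler_factor p else 1) \<longlonglongrightarrow> (\<Prod>p. if prime p then euler_factor p else 1)"
    by (rule convergent_prod_LIMSEQ[OF euler_product_convergent])
  moreover have "(\<Prod>p\<le>N. if prime p then euler_factor p else 1) =
     (\<Prod>p\<le>N. if prime p then 1 - real p powr (-4) else 1) *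
     (\<Prod>p\<le>N. if prime p then \<Sum>a. cofactor_coeff a * (real p powr (-1)) ^ a else 1)" for N
    unfolding prod.distrib[symmetric] by (intro prod.cong) (auto simp: euler_factor_eq)
  moreover have "(\<lambda>N. (\<Prod>p\<le>N. if prime p then 1 - real p powr (-4) else 1) *
     (\<Prod>p\<le>N. if prime p then \<Sum>a. cofactor_coeff a * (real p powr (-1)) ^ a else 1)) \<longlonglongrightarrow>
     infsum (\<lambda>d. moebius_mu d * real d powr (-4)) {0<..} * infsum (\<lambda>n. cofactor n * real n powr (-1)) {0<..}"
    by (intro tendsto_mult moebius_euler_product cofactor_euler_product) auto
  ultimately show ?thesis using LIMSEQ_unique by auto
qed

section \<open>Shifting a vertical line of integration\<close>

text \<open>
  The comparison function for all integrals over vertical lines below.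
\<close>
lemma integrable_majorant:
  fixes e :: real
  assumes "e < -1"
  shows "integrable lborel (\<lambda>t::real. (1 + \<bar>t\<bar>) powr e)"
proof -
  define g where "g = (\<lambda>t::real. indicator {1..} t *\<^sub>R (t powr e))"
  have "((\<lambda>x. x powr e) has_integral - (1 powr (e + 1)) / (e + 1)) {1..}"
    by (rule has_integral_powr_to_inf) (use assms in auto)
  hence "set_integrable lebesgue {1..} (\<lambda>x. x powr e)"
    by (intro nonnegative_absolutely_integrable_1) (auto simp: integrable_on_def)
  hence "integrable lebesgue g"
    unfolding set_integrable_def g_def .
  moreover have "g \<in> borel_measurable lborel" unfolding g_def by measurable
  ultimately have g: "integrable lborel g"
    using integrable_completion by blast
  have g': "integrable lborel (\<lambda>t. g (-t))"
    using lborel_integrable_real_affine[OF g, of "-1" 0] by simp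
  have i: "integrable lborel (\<lambda>t::real. indicator {-1..1} t *\<^sub>R (1::real))"
    by (rule borel_integrable_compact) auto
  show ?thesis
  proof (rule Bochner_Integration.integrable_bound)
    show "integrable lborel (\<lambda>t. indicator {-1..1} t *\<^sub>R (1::real) + g t + g (-t))"
      by (intro Bochner_Integration.integrable_add g g' i)
    show "AE t in lborel. norm ((1 + \<bar>t\<bar>) powr e) \<le> norm (indicator {-1..1} t *\<^sub>R (1::real) + g t + g (-t))"
    proof (rule AE_I2)
      fix t :: real
      show "norm ((1 + \<bar>t\<bar>) powr e) \<le> norm (indicator {-1..1} t *\<^sub>R (1::real) + g t + g (-t))"
      proof (cases "\<bar>t\<bar> \<le> 1")
        case True
        have "(1 + \<bar>t\<bar>) powr e \<le> 1 powr e" using assms by (intro powr_mono2') auto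
        also have "\<dots> \<le> indicator {-1..1} t *\<^sub>R (1::real) + g t + g (-t)"
          using True by (auto simp: g_def indicator_def)
        finally show ?thesis by simp
      next
        case False
        have "(1 + \<bar>t\<bar>) powr e \<le> \<bar>t\<bar> powr e" using False assms by (intro powr_mono2') auto
        also have "\<dots> \<le> indicator {-1..1} t *\<^sub>R (1::real) + g t + g (-t)"
          using False by (auto simp: g_def indicator_def)
        finally show ?thesis by simp
      qed
    qed
  qed simp
qed

lemma integrable_of_decay:
  fixes f :: "real \<Rightarrow> complex"
  assumes cont: "continuous_on UNIV f" and e: "e < -1"
    and bound: "\<And>t. \<bar>t\<bar> \<ge> T \<Longrightarrow> norm (f t) \<le> C * (1 + \<bar>t\<bar>) powr e"
  shows "integrable lborel f"
proof -
  have "compact (f ` {-T..T})"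
    by (intro compact_continuous_image continuous_on_subset[OF cont]) auto
  then obtain B where B: "\<And>t. t \<in> {-T..T} \<Longrightarrow> norm (f t) \<le> B" "B > 0"
    using compact_imp_bounded bounded_pos by (metis imageI)
  define j where "j = (1 + \<bar>T\<bar>) powr e"
  have j: "j > 0" by (simp add: j_def)
  have "f \<in> borel_measurable lborel"
    using borel_measurable_continuous_onI[OF cont] by simp
  show ?thesis
  proof (rule Bochner_Integration.integrable_bound)
    show "integrable lborel (\<lambda>t. max C (B / j) * (1 + \<bar>t\<bar>) powr e)"
      by (intro Bochner_Integration.integrable_mult_right integrable_majorant e)
    show "AE t in lborel. norm (f t) \<le> norm (max C (B / j) * (1 + \<bar>t\<bar>) powr e)"
    proof (rule AE_I2)
      fix t :: real
      have M: "max C (B / j) > 0" using j B(2) by (simp add: less_max_iff_disj)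
      have "norm (f t) \<le> max C (B / j) * (1 + \<bar>t\<bar>) powr e"
      proof (cases "\<bar>t\<bar> \<ge> T")
        case True
        have "C * (1 + \<bar>t\<bar>) powr e \<le> max C (B / j) * (1 + \<bar>t\<bar>) powr e"
          by (intro mult_right_mono) auto
        thus ?thesis using bound[OF True] by linarith
      next
        case False
        hence "norm (f t) \<le> B" by (intro B(1)) auto
        also have "B = B / j * (1 + \<bar>T\<bar>) powr e" using j by (simp add: j_def)
        also have "\<dots> \<le> B / j * (1 + \<bar>t\<bar>) powr e"
          using False j B(2) e by (intro mult_left_mono powr_mono2') auto
        also have "\<dots> \<le> max C (B / j) * (1 + \<bar>t\<bar>) powr e"
          by (intro mult_right_mono) auto
        finally show ?thesis .
      qed
      thus "norm (f t) \<le> norm (max C (B / j) * (1 + \<bar>t\<bar>) powr e)"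
        using M by simp
    qed
  qed fact
qed

lemma tendsto_symmetric_integral:
  fixes f :: "real \<Rightarrow> complex"
  assumes cont: "continuous_on UNIV f" and int: "integrable lborel f"
  shows "(\<lambda>n. integral {- real n..real n} f) \<longlonglongrightarrow> (\<integral>t. f t \<partial>lborel)"
proof -
  have "(\<lambda>n. \<integral>t. indicator {- real n..real n} t *\<^sub>R f t \<partial>lborel) \<longlonglongrightarrow> (\<integral>t. f t \<partial>lborel)"
  proof (rule integral_dominated_convergence)
    show "integrable lborel (\<lambda>t. norm (f t))" using int by simp
    show "AE t in lborel. (\<lambda>n. indicator {- real n..real n} t *\<^sub>R f t) \<longlonglongrightarrow> f t"
    proof (rule AE_I2)
      fix t
      have "\<forall>\<^sub>F n in sequentially. \<bar>t\<bar> \<le> real n"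
        using filterlim_real_sequentially unfolding filterlim_at_top by blast
      hence "\<forall>\<^sub>F n in sequentially. indicator {- real n..real n} t *\<^sub>R f t = f t"
        by eventually_elim (auto simp: indicator_def)
      thus "(\<lambda>n. indicator {- real n..real n} t *\<^sub>R f t) \<longlonglongrightarrow> f t"
        by (rule tendsto_eventually)
    qed
    show "AE t in lborel. norm (indicator {- real n..real n} t *\<^sub>R f t) \<le> norm (f t)" for n
      by (auto simp: indicator_def)
  qed (use int in auto)
  moreover have "(\<integral>t. indicator {- real n..real n} t *\<^sub>R f t \<partial>lborel) = integral {- real n..real n} f" for n
  proof -
    have "set_integrable lborel {- real n..real n} f"
      unfolding set_integrable_def
      by (intro borel_integrable_compact continuous_on_subset[OF cont]) auto
    from set_borel_integral_eq_integral(2)[OF this] show ?thesis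
      by (simp add: set_lebesgue_integral_def)
  qed
  ultimately show ?thesis by simp
qed

lemma continuous_on_vertical_line:
  assumes "continuous_on {s. Re s = c} F"
  shows "continuous_on UNIV (\<lambda>t. F (Complex c t))"
proof -
  have "continuous_on UNIV (\<lambda>t. Complex c t)"
    unfolding Complex_eq by (intro continuous_intros)
  from continuous_on_compose2[OF assms this] show ?thesis by (simp add: image_subset_iff)
qed

text \<open>
  Cauchy's formula on the rectangle between the two lines, cut off at height \<open>n\<close>. The horizontal
  sides have fixed length, so their contribution tends to 0 with the integrand. Writing the integrand
  as \<open>h s / (s - p)\<close> makes the residue simply \<open>h p\<close>.
\<close>
lemma contour_shift:
  fixes h :: "complex \<Rightarrow> complex"
  assumes holo: "h holomorphic_on S" and strip: "{s. a \<le> Re s \<and> Re s \<le> b} \<subseteq> S"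
    and p: "a < Re p" "Re p < b" and e: "e < -1"
    and bound: "\<And>s. a \<le> Re s \<Longrightarrow> Re s \<le> b \<Longrightarrow> \<bar>Im s\<bar> \<ge> T \<Longrightarrow>
                  norm (h s / (s - p)) \<le> C * (1 + \<bar>Im s\<bar>) powr e"
  shows "integrable lborel (\<lambda>t. h (Complex a t) / (Complex a t - p))"
    and "integrable lborel (\<lambda>t. h (Complex b t) / (Complex b t - p))"
    and "(\<integral>t. h (Complex b t) / (Complex b t - p) \<partial>lborel) =
           (\<integral>t. h (Complex a t) / (Complex a t - p) \<partial>lborel) + 2 * pi * h p"
proof -
  define F where "F = (\<lambda>s. h s / (s - p))"
  have conth: "continuous_on {s. a \<le> Re s \<and> Re s \<le> b} h"
    using holomorphic_on_imp_continuous_on[OF holo] strip continuous_on_subset by blast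
  have contF: "continuous_on ({s. a \<le> Re s \<and> Re s \<le> b} - {p}) F"
    unfolding F_def by (intro continuous_intros continuous_on_subset[OF conth]) auto
  have ab: "a < b" using p by linarith
  have cont: "continuous_on UNIV (\<lambda>t. F (Complex c t))" if "c = a \<or> c = b" for c
    by (intro continuous_on_vertical_line continuous_on_subset[OF contF]) (use that p ab in auto)
  have int: "integrable lborel (\<lambda>t. F (Complex c t))" if "c = a \<or> c = b" for c
  proof (rule integrable_of_decay[OF cont[OF that] e])
    show "norm (F (Complex c t)) \<le> C * (1 + \<bar>t\<bar>) powr e" if "\<bar>t\<bar> \<ge> T" for t
      using bound[of "Complex c t"] that \<open>c = a \<or> c = b\<close> ab unfolding F_def by auto
  qed
  show "integrable lborel (\<lambda>t. h (Complex a t) / (Complex a t - p))"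
    "integrable lborel (\<lambda>t. h (Complex b t) / (Complex b t - p))"
    using int[of a] int[of b] by (simp_all add: F_def)
  define I where "I = (\<lambda>c n. integral {- real n..real n} (\<lambda>t. F (Complex c t)))"
  define H where "H = (\<lambda>y. contour_integral (linepath (Complex a y) (Complex b y)) F)"
  have lim: "(\<lambda>n. I c n) \<longlonglongrightarrow> (\<integral>t. F (Complex c t) \<partial>lborel)" if "c = a \<or> c = b" for c
    unfolding I_def by (rule tendsto_symmetric_integral[OF cont[OF that] int[OF that]])
  have Hint: "F contour_integrable_on (linepath (Complex a y) (Complex b y))" if "y \<noteq> Im p" for y
  proof (rule contour_integrable_continuous_linepath, rule continuous_on_subset[OF contF])
    have "Re z \<in> {a..b} \<and> Im z = y" if "z \<in> closed_segment (Complex a y) (Complex b y)" for z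
      using that ab closed_segment_same_Im[of "Complex a y" "Complex b y"]
      by (auto simp: closed_segment_eq_real_ivl split: if_splits)
    thus "closed_segment (Complex a y) (Complex b y) \<subseteq> {s. a \<le> Re s \<and> Re s \<le> b} - {p}"
      using that by auto
  qed
  have Hb: "norm (H y) \<le> \<bar>C\<bar> * (1 + \<bar>y\<bar>) powr e * (b - a)" if "\<bar>y\<bar> \<ge> T" "y \<noteq> Im p" for y
  proof -
    have "norm (H y) \<le> \<bar>C\<bar> * (1 + \<bar>y\<bar>) powr e * norm (Complex b y - Complex a y)"
      unfolding H_def
    proof (rule contour_integral_bound_linepath[OF Hint])
      fix z assume z: "z \<in> closed_segment (Complex a y) (Complex b y)"
      have "Re z \<in> {a..b} \<and> Im z = y"
        using z ab closed_segment_same_Im[of "Complex a y" "Complex b y"]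
        by (auto simp: closed_segment_eq_real_ivl split: if_splits)
      hence "norm (F z) \<le> C * (1 + \<bar>y\<bar>) powr e" using bound[of z] that by (auto simp: F_def)
      also have "\<dots> \<le> \<bar>C\<bar> * (1 + \<bar>y\<bar>) powr e" by (intro mult_right_mono) auto
      finally show "norm (F z) \<le> \<bar>C\<bar> * (1 + \<bar>y\<bar>) powr e" .
    qed (use that in auto)
    thus ?thesis using ab by (simp add: complex_diff complex_norm)
  qed
  have rect: "I b n = I a n + 2 * pi * h p + \<i> * (H (- real n) - H (real n))"
    if n: "real n > \<bar>Im p\<bar>" for n
  proof -
    define a1 where "a1 = Complex a (- real n)"
    define a2 where "a2 = Complex b (- real n)"
    define a3 where "a3 = Complex b (real n)"
    define a4 where "a4 = Complex a (real n)"
    have n0: "n > 0" using n by (cases n) auto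
    have pbox: "p \<in> box a1 a3" using p n by (auto simp: in_box_complex_iff a1_def a3_def)
    have "((\<lambda>w. h w / (w - p)) has_contour_integral
              (2*pi * \<i> * winding_number (rectpath a1 a3) p * h p)) (rectpath a1 a3)"
    proof (rule Cauchy_integral_formula_convex_simple)
      show "convex (cbox a1 a3)" by simp
      show "h holomorphic_on cbox a1 a3"
        by (rule holomorphic_on_subset[OF holo]) (use strip in \<open>auto simp: in_cbox_complex_iff a1_def a3_def\<close>)
      show "p \<in> interior (cbox a1 a3)" using pbox by simp
      have "Re a1 \<le> Re a3" "Im a1 \<le> Im a3" using ab by (auto simp: a1_def a3_def)
      from path_image_rectpath_cbox_minus_box[OF this]
      show "path_image (rectpath a1 a3) \<subseteq> cbox a1 a3 - {p}" using pbox by auto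
    qed auto
    hence 1: "(F has_contour_integral (2*pi * \<i> * h p)) (rectpath a1 a3)"
      using winding_number_rectpath[OF pbox] by (simp add: F_def)
    have bot: "(F has_contour_integral H (- real n)) (linepath a1 a2)"
      unfolding H_def a1_def a2_def by (intro has_contour_integral_integral Hint) (use n in auto)
    have "(F has_contour_integral H (real n)) (linepath a4 a3)"
      unfolding H_def a3_def a4_def by (intro has_contour_integral_integral Hint) (use n in auto)
    from has_contour_integral_reversepath[OF _ this]
    have top: "(F has_contour_integral (- H (real n))) (linepath a3 a4)" by simp
    have vert: "(F has_contour_integral (\<i> * I c n)) (linepath (Complex c (- real n)) (Complex c (real n)))"
      if "c = a \<or> c = b" for c
    proof -
      have "((\<lambda>t. F (Complex c t)) has_integral I c n) {- real n..real n}"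
        unfolding I_def
        by (intro integrable_integral integrable_continuous_interval continuous_on_subset[OF cont[OF that]]) auto
      thus ?thesis
        by (subst has_contour_integral_linepath_same_Re_iff[of _ c _ "- real n" "real n"]) (use n0 in auto)
    qed
    have right: "(F has_contour_integral (\<i> * I b n)) (linepath a2 a3)"
      unfolding a2_def a3_def by (rule vert) simp
    have "(F has_contour_integral (\<i> * I a n)) (linepath a1 a4)"
      unfolding a1_def a4_def by (rule vert) simp
    from has_contour_integral_reversepath[OF _ this]
    have left: "(F has_contour_integral (- (\<i> * I a n))) (linepath a4 a1)" by simp
    have "(F has_contour_integral (H (- real n) + (\<i> * I b n + (- H (real n) + - (\<i> * I a n)))))
            (linepath a1 a2 +++ linepath a2 a3 +++ linepath a3 a4 +++ linepath a4 a1)"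
      by (intro has_contour_integral_join bot right top left) auto
    also have "(linepath a1 a2 +++ linepath a2 a3 +++ linepath a3 a4 +++ linepath a4 a1) = rectpath a1 a3"
      by (simp add: rectpath_def a1_def a2_def a3_def a4_def Let_def)
    finally have "2*pi * \<i> * h p = H (- real n) + (\<i> * I b n + (- H (real n) + - (\<i> * I a n)))"
      using has_contour_integral_unique[OF 1] by simp
    hence "\<i> * I b n = \<i> * (I a n + 2 * pi * h p + \<i> * (H (- real n) - H (real n)))"
      by (simp add: algebra_simps)
    thus ?thesis by (metis complex_i_not_zero mult_left_cancel)
  qed
  have ev: "\<forall>\<^sub>F n in sequentially. real n > c" for c
    using filterlim_real_sequentially unfolding filterlim_at_top_dense by blast
  have H0: "(\<lambda>n. H (sg * real n)) \<longlonglongrightarrow> 0" if sg: "\<bar>sg\<bar> = 1" for sg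
  proof (rule Lim_null_comparison)
    show "\<forall>\<^sub>F n in sequentially. norm (H (sg * real n)) \<le> \<bar>C\<bar> * (1 + real n) powr e * (b - a)"
      using ev[of T] ev[of "\<bar>Im p\<bar>"]
    proof eventually_elim
      case (elim n)
      have "\<bar>sg * real n\<bar> = real n" using sg by (simp add: abs_mult)
      thus ?case using Hb[of "sg * real n"] elim by auto
    qed
    have "filterlim (\<lambda>n. 1 + real n) at_top sequentially"
      by (intro filterlim_tendsto_add_at_top[OF tendsto_const] filterlim_real_sequentially)
    hence "(\<lambda>n. (1 + real n) powr e) \<longlonglongrightarrow> 0"
      by (intro tendsto_neg_powr) (use e in auto)
    from tendsto_mult[OF tendsto_mult[OF tendsto_const this] tendsto_const]
    show "(\<lambda>n. \<bar>C\<bar> * (1 + real n) powr e * (b - a)) \<longlonglongrightarrow> 0" by simp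
  qed
  have "(\<lambda>n. I a n + 2 * pi * h p + \<i> * (H (- real n) - H (real n))) \<longlonglongrightarrow>
          (\<integral>t. F (Complex a t) \<partial>lborel) + 2 * pi * h p + \<i> * (0 - 0)"
    using H0[of "-1"] H0[of 1] by (intro tendsto_intros lim) auto
  moreover have "(\<lambda>n. I a n + 2 * pi * h p + \<i> * (H (- real n) - H (real n))) \<longlonglongrightarrow>
          (\<integral>t. F (Complex b t) \<partial>lborel)"
    by (rule Lim_transform_eventually[OF lim[of b]])
       (use ev[of "\<bar>Im p\<bar>"] in \<open>auto elim!: eventually_mono simp: rect\<close>)
  ultimately have "(\<integral>t. F (Complex b t) \<partial>lborel) = (\<integral>t. F (Complex a t) \<partial>lborel) + 2 * pi * h p + \<i> * (0 - 0)"
    using LIMSEQ_unique by blast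
  thus "(\<integral>t. h (Complex b t) / (Complex b t - p) \<partial>lborel) =
           (\<integral>t. h (Complex a t) / (Complex a t - p) \<partial>lborel) + 2 * pi * h p"
    by (simp add: F_def)
qed

text \<open>
  Without a pole: an artificial one in the middle of the strip, with residue 0.
\<close>
lemma contour_shift_holomorphic:
  fixes F :: "complex \<Rightarrow> complex"
  assumes holo: "F holomorphic_on S" and strip: "{s. a \<le> Re s \<and> Re s \<le> b} \<subseteq> S"
    and ab: "a < b" and e: "e < -1"
    and bound: "\<And>s. a \<le> Re s \<Longrightarrow> Re s \<le> b \<Longrightarrow> \<bar>Im s\<bar> \<ge> T \<Longrightarrow>
                  norm (F s) \<le> C * (1 + \<bar>Im s\<bar>) powr e"
  shows "(\<integral>t. F (Complex b t) \<partial>lborel) = (\<integral>t. F (Complex a t) \<partial>lborel)"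
proof -
  define p where "p = complex_of_real ((a + b) / 2)"
  define h where "h = (\<lambda>s. F s * (s - p))"
  have p: "a < Re p" "Re p < b" using ab by (auto simp: p_def)
  have eq: "h s / (s - p) = F s" if "s \<noteq> p" for s using that by (simp add: h_def)
  have "(\<integral>t. h (Complex b t) / (Complex b t - p) \<partial>lborel) =
           (\<integral>t. h (Complex a t) / (Complex a t - p) \<partial>lborel) + 2 * pi * h p"
  proof (rule contour_shift(3)[where T = "max T 1" and C = C and e = e])
    show "h holomorphic_on S" unfolding h_def by (intro holomorphic_intros holo)
    show "norm (h s / (s - p)) \<le> C * (1 + \<bar>Im s\<bar>) powr e"
      if "a \<le> Re s" "Re s \<le> b" "\<bar>Im s\<bar> \<ge> max T 1" for s
    proof -
      have "Im p = 0" unfolding p_def by (rule Im_complex_of_real)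
      hence "s \<noteq> p" using that(3) by auto
      thus ?thesis using bound[of s] that by (simp add: eq)
    qed
  qed (use assms p in auto)
  moreover have "h (Complex c t) / (Complex c t - p) = F (Complex c t)" if "c = a \<or> c = b" for c t
    by (rule eq) (use that p in auto)
  ultimately show ?thesis by (simp add: h_def)
qed

section \<open>Perron formula with an absolutely convergent kernel\<close>

lemma norm_vertical_ge:
  assumes "\<bar>Re s\<bar> \<ge> m" "m \<ge> 1"
  shows "norm s \<ge> m" "norm s \<ge> (1 + \<bar>Im s\<bar>) / 2"
proof -
  show 1: "norm s \<ge> m" using abs_Re_le_cmod[of s] assms(1) by (rule order.trans[rotated])
  have "1 + \<bar>Im s\<bar> \<le> norm s + norm s"
    using abs_Im_le_cmod[of s] 1 assms(2) by (intro add_mono) (auto intro: order.trans)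
  thus "norm s \<ge> (1 + \<bar>Im s\<bar>) / 2" by simp
qed

text \<open>
  Half a power of \<open>norm s\<close> is given up for decay in \<open>m\<close>; the rest stays integrable along the line.
\<close>
lemma riesz_kernel_bound:
  assumes "\<bar>Re s\<bar> \<ge> m" "\<bar>Re s + \<alpha>\<bar> \<ge> m" "m \<ge> 1"
  shows "norm (1 / (s * (s + of_real \<alpha>))) \<le> 4 * m powr (-1/2) * (1 + \<bar>Im s\<bar>) powr (-3/2)"
proof -
  define r where "r = (1 + \<bar>Im s\<bar>) / 2"
  have r: "r > 0" by (simp add: r_def)
  have "m powr (1/2) * r powr (3/2) \<le> norm s * norm (s + of_real \<alpha>)"
  proof -
    have 1: "m powr (1/2) * r powr (1/2) \<le> norm s powr (1/2) * norm s powr (1/2)"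
      using norm_vertical_ge[OF assms(1,3)] assms(3) r by (intro mult_mono powr_mono2) (auto simp: r_def)
    have "norm s powr (1/2) * norm s powr (1/2) = norm s" by (simp flip: powr_add)
    moreover have 2: "r \<le> norm (s + of_real \<alpha>)"
      using norm_vertical_ge(2)[of m "s + of_real \<alpha>"] assms by (simp add: r_def)
    ultimately have "(m powr (1/2) * r powr (1/2)) * r \<le> norm s * norm (s + of_real \<alpha>)"
      using 1 r by (intro mult_mono) auto
    moreover have "r powr (3/2) = r powr (1/2) * r"
      using r powr_add[of r "1/2" 1] by simp
    ultimately show ?thesis by (simp add: mult_ac)
  qed
  moreover have "m powr (1/2) * r powr (3/2) > 0" using r assms by auto
  ultimately have "1 / (norm s * norm (s + of_real \<alpha>)) \<le> 1 / (m powr (1/2) * r powr (3/2))"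
    by (intro divide_left_mono mult_pos_pos) (auto simp: mult_less_0_iff intro: less_le_trans)
  also have "\<dots> = m powr (-1/2) * r powr (-3/2)" by (simp add: powr_minus field_simps)
  also have "r powr (-3/2) = (1 + \<bar>Im s\<bar>) powr (-3/2) * 2 powr (3/2)"
    unfolding r_def by (subst powr_divide) (auto simp: powr_minus field_simps)
  also have "m powr (-1/2) * ((1 + \<bar>Im s\<bar>) powr (-3/2) * 2 powr (3/2)) \<le>
               m powr (-1/2) * ((1 + \<bar>Im s\<bar>) powr (-3/2) * 2 powr 2)"
    by (intro mult_left_mono powr_mono) auto
  finally show ?thesis by (simp add: norm_divide norm_mult mult_ac)
qed

lemma riesz_kernel_decay:
  assumes "\<bar>Im s\<bar> \<ge> 1"
  shows "norm (1 / (s * (s + of_real \<alpha>))) \<le> 4 * (1 + \<bar>Im s\<bar>) powr -2"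
proof -
  define r where "r = (1 + \<bar>Im s\<bar>) / 2"
  have r: "r > 0" by (simp add: r_def)
  have "r \<le> norm s" "r \<le> norm (s + of_real \<alpha>)"
    using abs_Im_le_cmod[of s] abs_Im_le_cmod[of "s + of_real \<alpha>"] assms by (auto simp: r_def)
  hence "1 / (norm s * norm (s + of_real \<alpha>)) \<le> 1 / (r * r)"
    using r by (intro divide_left_mono mult_mono mult_pos_pos) auto
  also have "\<dots> = 4 * (1 + \<bar>Im s\<bar>) powr -2"
    unfolding r_def by (simp add: powr_minus powr_numeral power2_eq_square field_simps)
  finally show ?thesis by (simp add: norm_divide norm_mult)
qed

lemma riesz_kernel_decay_strip:
  fixes x :: real
  assumes "x > 0" "a \<le> Re s" "Re s \<le> b" "\<bar>Im s\<bar> \<ge> 1"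
  shows "norm (of_real x powr s / (s * (s + of_real \<alpha>))) \<le> (4 * (x powr a + x powr b)) * (1 + \<bar>Im s\<bar>) powr -2"
proof -
  have "x powr Re s \<le> x powr a + x powr b"
  proof (cases "x \<ge> 1")
    case True
    hence "x powr Re s \<le> x powr b" using assms by (intro powr_mono) auto
    thus ?thesis by (simp add: add_increasing)
  next
    case False
    hence "x powr Re s \<le> x powr a" using assms by (intro powr_mono') auto
    thus ?thesis by (simp add: add_increasing2)
  qed
  hence "x powr Re s * norm (1 / (s * (s + of_real \<alpha>))) \<le> (x powr a + x powr b) * (4 * (1 + \<bar>Im s\<bar>) powr -2)"
    by (intro mult_mono riesz_kernel_decay assms) auto
  thus ?thesis using assms by (simp add: norm_divide norm_mult norm_powr_real_powr algebra_simps)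
qed

text \<open>
  Pushing the line away to the side on which \<open>x powr s\<close> stays bounded leaves nothing.
\<close>
lemma tendsto_kernel_far_line:
  fixes x \<alpha> :: real and c :: "nat \<Rightarrow> real"
  assumes x: "x > 0" and le1: "\<And>n. x powr c n \<le> 1"
    and c: "\<And>n. \<bar>c n\<bar> \<ge> real (Suc n)" "\<And>n. \<bar>c n + \<alpha>\<bar> \<ge> real (Suc n)"
  shows "(\<lambda>n. \<integral>t. of_real x powr (Complex (c n) t) / (Complex (c n) t * (Complex (c n) t + of_real \<alpha>)) \<partial>lborel)
           \<longlonglongrightarrow> 0"
  (is "(\<lambda>n. \<integral>t. ?F n t \<partial>lborel) \<longlonglongrightarrow> 0")
proof (rule Lim_null_comparison)
  define J :: real where "J = (\<integral>t. (1 + \<bar>t\<bar>) powr (-3/2) \<partial>lborel)"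
  have i: "integrable lborel (\<lambda>t::real. (1 + \<bar>t\<bar>) powr (-3/2))" by (rule integrable_majorant) simp
  show "\<forall>\<^sub>F n in sequentially. norm (\<integral>t. ?F n t \<partial>lborel) \<le> (4 * real (Suc n) powr (-1/2)) * J"
  proof (rule always_eventually, rule allI)
    fix n
    have "norm (\<integral>t. ?F n t \<partial>lborel)
            \<le> (\<integral>t. (4 * real (Suc n) powr (-1/2)) * (1 + \<bar>t\<bar>) powr (-3/2) \<partial>lborel)"
    proof (rule Bochner_Integration.integral_norm_bound_integral)
      show "complex_integrable lborel (?F n)"
      proof (rule integrable_of_decay[where e = "-2" and T = 1])
        have nz: "Complex (c n) t \<noteq> 0" "Complex (c n) t + of_real \<alpha> \<noteq> 0" for t
          using c[of n] by (auto simp: complex_eq_iff)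
        have "continuous_on UNIV (\<lambda>t. Complex (c n) t)"
          unfolding Complex_eq by (intro continuous_intros)
        thus "continuous_on UNIV (?F n)"
          using x nz by (intro continuous_intros) auto
        show "norm (?F n t)
                \<le> (4 * (x powr c n + x powr c n)) * (1 + \<bar>t\<bar>) powr -2" if "\<bar>t\<bar> \<ge> 1" for t
          using riesz_kernel_decay_strip[of x "c n" "Complex (c n) t" "c n" \<alpha>] x that by simp
      qed simp
      show "integrable lborel (\<lambda>t. (4 * real (Suc n) powr (-1/2)) * (1 + \<bar>t\<bar>) powr (-3/2))"
        by (intro Bochner_Integration.integrable_mult_right i)
      fix t
      have "norm (?F n t) =
              x powr c n * norm (1 / (Complex (c n) t * (Complex (c n) t + of_real \<alpha>)))"
        using x by (simp add: norm_divide norm_mult norm_powr_real_powr)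
      also have "\<dots> \<le> 1 * (4 * real (Suc n) powr (-1/2) * (1 + \<bar>t\<bar>) powr (-3/2))"
        using riesz_kernel_bound[of "real (Suc n)" "Complex (c n) t" \<alpha>] c[of n] le1[of n]
        by (intro mult_mono) auto
      finally show "norm (?F n t)
         \<le> 4 * real (Suc n) powr (-1/2) * (1 + \<bar>t\<bar>) powr (-3/2)" by simp
    qed
    also have "\<dots> = (4 * real (Suc n) powr (-1/2)) * J" by (simp add: J_def)
    finally show "norm (\<integral>t. ?F n t \<partial>lborel)
            \<le> (4 * real (Suc n) powr (-1/2)) * J" .
  qed
  have "(\<lambda>n. real (Suc n) powr (-1/2)) \<longlonglongrightarrow> 0"
    by (intro tendsto_neg_powr filterlim_compose[OF filterlim_real_sequentially filterlim_Suc]) auto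
  from tendsto_mult[OF tendsto_mult[OF tendsto_const this] tendsto_const]
  show "(\<lambda>n. (4 * real (Suc n) powr (-1/2)) * J) \<longlonglongrightarrow> 0" by simp
qed

text \<open>
  For \<open>x \<ge> 1\<close> the line is pushed to the left, across the poles 0 and \<open>- \<alpha>\<close>, whose residues give
  \<open>(1 - x powr (- \<alpha>)) / \<alpha>\<close>; for \<open>x < 1\<close> it is pushed to the right, across no pole.
\<close>
lemma riesz_kernel_integral:
  fixes x \<alpha> c :: real
  assumes x: "x > 0" and \<alpha>: "\<alpha> > 0" and c: "c > 0"
  defines "F \<equiv> (\<lambda>s. of_real x powr s / (s * (s + of_real \<alpha>)))"
  shows "integrable lborel (\<lambda>t. F (Complex c t))"
    and "(\<integral>t. F (Complex c t) \<partial>lborel) = of_real (2 * pi / \<alpha> * max 0 (1 - x powr (-\<alpha>)))"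
proof -
  define h1 :: "complex \<Rightarrow> complex" where "h1 = (\<lambda>s. of_real x powr s / (s + of_real \<alpha>))"
  define h2 :: "complex \<Rightarrow> complex" where "h2 = (\<lambda>s. of_real x powr s / s)"
  have F1: "F s = h1 s / (s - 0)" for s by (simp add: F_def h1_def mult_ac)
  have F2: "F s = h2 s / (s - (- of_real \<alpha>))" for s by (simp add: F_def h2_def mult_ac)
  have F1': "h1 s / s = F s" and F2': "h2 s / (s + of_real \<alpha>) = F s" for s
    using F1[of s] F2[of s] by simp_all
  have holo1: "h1 holomorphic_on {s. Re s > -\<alpha>}"
    unfolding h1_def using x by (intro holomorphic_intros) (auto simp: complex_eq_iff)
  have holo2: "h2 holomorphic_on {s. Re s < 0}"
    unfolding h2_def using x by (intro holomorphic_intros) auto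
  have decay: "norm (F s) \<le> (4 * (x powr a + x powr b)) * (1 + \<bar>Im s\<bar>) powr -2"
    if "a \<le> Re s" "Re s \<le> b" "\<bar>Im s\<bar> \<ge> 1" for a b s
    unfolding F_def by (rule riesz_kernel_decay_strip) (use x that in auto)
  define C1 where "C1 = 4 * (x powr (-\<alpha>/2) + x powr c)"
  have "integrable lborel (\<lambda>t. h1 (Complex c t) / (Complex c t - 0)) \<and>
        (\<integral>t. h1 (Complex c t) / (Complex c t - 0) \<partial>lborel) =
          (\<integral>t. h1 (Complex (-\<alpha>/2) t) / (Complex (-\<alpha>/2) t - 0) \<partial>lborel) + 2 * pi * h1 0"
    by (intro conjI; rule contour_shift[OF holo1, where a = "-\<alpha>/2" and C = C1 and e = "-2" and T = 1])
       (use \<alpha> c decay in \<open>auto simp: F1' C1_def\<close>)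
  hence step1: "integrable lborel (\<lambda>t. F (Complex c t))"
    "(\<integral>t. F (Complex c t) \<partial>lborel) = (\<integral>t. F (Complex (-\<alpha>/2) t) \<partial>lborel) + 2 * pi / \<alpha>"
    using x \<alpha> by (simp_all add: F1 h1_def)
  show "integrable lborel (\<lambda>t. F (Complex c t))" by (rule step1)
  show "(\<integral>t. F (Complex c t) \<partial>lborel) = of_real (2 * pi / \<alpha> * max 0 (1 - x powr (-\<alpha>)))"
  proof (cases "x \<ge> 1")
    case True
    define d where "d = (\<lambda>n. - \<alpha> - real (Suc n))"
    have "(\<integral>t. F (Complex (-\<alpha>/2) t) \<partial>lborel) = (\<integral>t. F (Complex (d n) t) \<partial>lborel) - 2 * pi / \<alpha> * x powr (-\<alpha>)" for n
    proof -
      define C2 where "C2 = 4 * (x powr (d n) + x powr (-\<alpha>/2))"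
      have "(\<integral>t. h2 (Complex (-\<alpha>/2) t) / (Complex (-\<alpha>/2) t - (- of_real \<alpha>)) \<partial>lborel) =
          (\<integral>t. h2 (Complex (d n) t) / (Complex (d n) t - (- of_real \<alpha>)) \<partial>lborel) + 2 * pi * h2 (- of_real \<alpha>)"
        by (rule contour_shift[OF holo2, where C = C2 and e = "-2" and T = 1])
          (use \<alpha> decay in \<open>auto simp: F2' C2_def d_def\<close>)
      moreover have "2 * pi * h2 (- of_real \<alpha>) = - of_real (2 * pi / \<alpha> * x powr (-\<alpha>))"
        using x powr_of_real[of x "-\<alpha>"] by (simp add: h2_def)
      ultimately show ?thesis by (simp add: F2')
    qed
    hence shift: "(\<integral>t. F (Complex c t) \<partial>lborel) =
             (\<integral>t. F (Complex (d n) t) \<partial>lborel) + of_real (2 * pi / \<alpha> * (1 - x powr (-\<alpha>)))" for n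
      using \<alpha> by (simp add: step1(2) algebra_simps diff_divide_distrib)
    have "(\<lambda>n. (\<integral>t. F (Complex (d n) t) \<partial>lborel)) =
             (\<lambda>n. (\<integral>t. F (Complex c t) \<partial>lborel) - of_real (2 * pi / \<alpha> * (1 - x powr (-\<alpha>))))"
      using shift by (intro ext) (metis add_diff_cancel_right')
    moreover have "(\<lambda>n. (\<integral>t. F (Complex (d n) t) \<partial>lborel)) \<longlonglongrightarrow> 0"
      unfolding F_def
      by (rule tendsto_kernel_far_line) (use True \<alpha> in \<open>auto simp: d_def intro: order.trans[OF powr_mono, of _ 0]\<close>)
    ultimately have "(\<integral>t. F (Complex c t) \<partial>lborel) - of_real (2 * pi / \<alpha> * (1 - x powr (-\<alpha>))) = 0"
      using LIMSEQ_unique tendsto_const by metis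
    moreover have "x powr (-\<alpha>) \<le> 1" using True \<alpha> powr_mono[of "-\<alpha>" 0 x] by auto
    ultimately show ?thesis by simp
  next
    case False
    define d where "d = (\<lambda>n. c + real (Suc n))"
    have "(\<integral>t. F (Complex (d n) t) \<partial>lborel) = (\<integral>t. F (Complex c t) \<partial>lborel)" for n
    proof (rule contour_shift_holomorphic[where S = "{s. Re s > 0}" and T = 1 and e = "-2" and C = "4 * (x powr c + x powr d n)"])
      show "F holomorphic_on {s. Re s > 0}"
      proof -
        have "s \<noteq> 0" "s + of_real \<alpha> \<noteq> 0" if "Re s > 0" for s
          using that \<alpha> by (auto simp: complex_eq_iff)
        thus ?thesis unfolding F_def using x by (intro holomorphic_intros) auto
      qed
    qed (use c decay in \<open>auto simp: d_def\<close>)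
    moreover have "(\<lambda>n. (\<integral>t. F (Complex (d n) t) \<partial>lborel)) \<longlonglongrightarrow> 0"
      unfolding F_def
    proof (rule tendsto_kernel_far_line)
      show "x powr (d n) \<le> 1" for n
        using False x c powr_mono'[of 0 "d n" x] by (auto simp: d_def)
    qed (use x \<alpha> c in \<open>auto simp: d_def\<close>)
    ultimately have "(\<integral>t. F (Complex c t) \<partial>lborel) = 0"
      using LIMSEQ_unique tendsto_const by (metis (no_types, lifting) ext)
    moreover have "x powr (-\<alpha>) \<ge> 1" using False \<alpha> x powr_mono'[of "-\<alpha>" 0 x] by auto
    ultimately show ?thesis by simp
  qed
qed

text \<open>
  The frequencies \<open>l k\<close> are arbitrary so that a double series, enumerated in any order, can be
  treated without collecting the pairs with equal \<open>n * d ^ 4\<close> first.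
\<close>
lemma perron_riesz:
  fixes a :: "nat \<Rightarrow> complex" and l :: "nat \<Rightarrow> real" and x \<alpha> c :: real
  assumes x: "x > 0" and \<alpha>: "\<alpha> > 0" and c: "c > 0" and l: "\<And>k. l k > 0"
    and summ: "summable (\<lambda>k. norm (a k) * l k powr (-c))"
    and D: "\<And>t. (\<lambda>k. a k * of_real (l k) powr (- Complex c t)) sums D t"
  shows "(\<lambda>k. a k * of_real (max 0 (1 - (l k / x) powr \<alpha>))) sums
           (\<alpha> / (2 * pi) * (\<integral>t. D t * (of_real x powr Complex c t / (Complex c t * (Complex c t + of_real \<alpha>))) \<partial>lborel))"
proof -
  define K where "K = (\<lambda>s. 1 / (s * (s + complex_of_real \<alpha>)))"
  define f where "f = (\<lambda>k t. a k * (of_real (x / l k) powr (Complex c t) / (Complex c t * (Complex c t + of_real \<alpha>))))"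
  note ker = riesz_kernel_integral[OF _ \<alpha> c]
  have xl: "x / l k > 0" for k using x l[of k] by simp
  have f_int: "integrable lborel (f k)" for k
    unfolding f_def by (intro Bochner_Integration.integrable_mult_right ker(1) xl)
  have f_val: "(\<integral>t. f k t \<partial>lborel) = 2 * pi / \<alpha> * (a k * of_real (max 0 (1 - (l k / x) powr \<alpha>)))" for k
  proof -
    have "(x / l k) powr (-\<alpha>) = (l k / x) powr \<alpha>"
      using x l[of k] by (simp add: powr_minus powr_divide)
    thus ?thesis unfolding f_def integral_mult_right_zero ker(2)[OF xl]
      by (simp add: mult_ac)
  qed
  have f_eq: "f k t = a k * of_real (l k) powr (- Complex c t) *
                (of_real x powr Complex c t / (Complex c t * (Complex c t + of_real \<alpha>)))" for k t
  proof -
    have "complex_of_real (x / l k) powr Complex c t = of_real (l k) powr (- Complex c t) * of_real x powr Complex c t"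
    proof -
      have "complex_of_real (inverse (l k)) powr Complex c t = of_real (l k) powr (- Complex c t)"
        using l[of k] by (simp add: powr_def Ln_of_real ln_inverse del: of_real_inverse)
      moreover have "complex_of_real (x * inverse (l k)) powr Complex c t =
                       of_real x powr Complex c t * complex_of_real (inverse (l k)) powr Complex c t"
        using x l[of k] unfolding of_real_mult by (intro powr_times_real) auto
      ultimately show ?thesis by (simp only: divide_inverse mult.commute)
    qed
    thus ?thesis by (simp only: f_def) (simp add: mult_ac)
  qed
  have f_norm: "norm (f k t) = norm (a k) * l k powr (-c) * (x powr c * norm (K (Complex c t)))" for k t
    unfolding f_eq K_def using x l[of k]
    by (simp add: norm_mult norm_divide norm_powr_real_powr)
  have K_int: "integrable lborel (\<lambda>t. norm (K (Complex c t)))"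
    using integrable_norm[OF ker(1)[of 1]] by (simp add: K_def norm_divide norm_mult)
  have "(\<lambda>k. \<integral>t. f k t \<partial>lborel) sums (\<integral>t. (\<Sum>k. f k t) \<partial>lborel)"
  proof (rule sums_integral[OF f_int])
    show "AE t in lborel. summable (\<lambda>k. norm (f k t))"
      unfolding f_norm by (intro AE_I2 summable_mult2 summ)
    show "summable (\<lambda>k. \<integral>t. norm (f k t) \<partial>lborel)"
      unfolding f_norm integral_mult_right_zero by (intro summable_mult2 summ)
  qed
  moreover have "(\<Sum>k. f k t) = D t * (of_real x powr Complex c t / (Complex c t * (Complex c t + of_real \<alpha>)))" for t
    unfolding f_eq using sums_mult2[OF D[of t]] by (rule sums_unique[symmetric])
  ultimately have "(\<lambda>k. 2 * pi / \<alpha> * (a k * of_real (max 0 (1 - (l k / x) powr \<alpha>)))) sums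
     (\<integral>t. D t * (of_real x powr Complex c t / (Complex c t * (Complex c t + of_real \<alpha>))) \<partial>lborel)"
    by (simp only: f_val)
  from sums_mult[OF this, of "\<alpha> / (2 * pi)"] show ?thesis using \<alpha> by (simp add: field_simps)
qed

section \<open>The zeta function and its reciprocal\<close>

lemma zeta_holomorphic: "zeta holomorphic_on - {1}"
  using is_zeta_zeta by (simp add: is_zeta_def)

lemma zeta_sums:
  assumes "Re s > 1"
  shows "(\<lambda>n. of_nat (Suc n) powr (-s)) sums zeta s"
  using is_zeta_zeta assms by (simp add: is_zeta_def powr_minus field_simps)

lemma norm_nat_powr: "norm (of_nat (Suc n) powr s :: complex) = real (Suc n) powr Re s"
  using norm_powr_real_powr[of "of_nat (Suc n)" s] by simp

lemma summable_Suc_powr: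
  assumes "\<sigma> > 1"
  shows "summable (\<lambda>n. real (Suc n) powr (-\<sigma>))"
  using assms summable_Suc_iff[of "\<lambda>n. real n powr (-\<sigma>)"] by (simp add: summable_real_powr_iff)

lemma powr_diff_bound:
  fixes u v :: real and a :: complex
  assumes "0 < u" "u \<le> v" and B: "\<And>w. u \<le> w \<Longrightarrow> w \<le> v \<Longrightarrow> w powr (Re a - 1) \<le> B"
  shows "norm (of_real v powr a - of_real u powr a) \<le> norm a * B * (v - u)"
proof -
  have "norm (of_real v powr a - of_real u powr a) \<le> norm a * B * norm (complex_of_real v - of_real u)"
  proof (rule field_differentiable_bound[where S = "closed_segment (of_real u) (of_real v)"
          and f' = "\<lambda>z. a * z powr (a - 1)"])
    fix z assume "z \<in> closed_segment (complex_of_real u) (of_real v)"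
    then obtain w where w: "z = of_real w" "u \<le> w" "w \<le> v"
      using assms by (auto simp: closed_segment_of_real closed_segment_eq_real_ivl)
    have "((\<lambda>z. z powr a) has_field_derivative a * z powr (a - 1)) (at z)"
      using w assms(1) by (intro has_field_derivative_powr) auto
    thus "((\<lambda>z. z powr a) has_field_derivative a * z powr (a - 1))
            (at z within closed_segment (complex_of_real u) (of_real v))"
      by (rule has_field_derivative_at_within)
    have "norm (z powr (a - 1)) = w powr (Re a - 1)"
      using w assms(1) by (simp add: norm_powr_real_powr)
    thus "norm (a * z powr (a - 1)) \<le> norm a * B"
      unfolding norm_mult using B[OF w(2,3)] by (intro mult_left_mono) auto
  qed auto
  also have "norm (complex_of_real v - of_real u) = v - u"
    using assms by (simp flip: of_real_diff)
  finally show ?thesis .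
qed

text \<open>
  The remainder is the increment over \<open>[n + 1, n + 2]\<close> of a function whose derivative is
  \<open>(s - 1) * ((n + 2) powr (- s) - u powr (- s))\<close>, again a small increment. In contrast to
  \<open>zeta_rem_bound\<close>, the dependence on \<open>s\<close> is explicit.
\<close>
lemma zeta_rem_1_bound:
  assumes "Re s > 0"
  shows "norm (zeta_rem 1 n s) \<le> norm s * norm (s - 1) * real (Suc n) powr (- Re s - 1)"
proof -
  define M where "M = real (Suc n)"
  have M: "M > 0" by (simp add: M_def)
  define c where "c = complex_of_real (M + 1) powr (-s)"
  define \<psi> where "\<psi> = (\<lambda>z. z powr (1 - s) + (s - 1) * z * c)"
  define B where "B = norm (s - 1) * (norm s * M powr (- Re s - 1))"
  have "norm (\<psi> (of_real M) - \<psi> (of_real (M + 1))) \<le> B * norm (complex_of_real M - of_real (M + 1))"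
  proof (rule field_differentiable_bound[where S = "closed_segment (of_real M) (of_real (M + 1))"
          and f' = "\<lambda>z. (s - 1) * (c - z powr (-s))"])
    fix z assume "z \<in> closed_segment (complex_of_real M) (of_real (M + 1))"
    then obtain w where w: "z = of_real w" "M \<le> w" "w \<le> M + 1"
      unfolding closed_segment_of_real by (auto simp: closed_segment_eq_real_ivl)
    have "(\<psi> has_field_derivative ((1 - s) * z powr (1 - s - 1) + (s - 1) * c)) (at z)"
      unfolding \<psi>_def using w M by (auto intro!: derivative_eq_intros has_field_derivative_powr)
    also have "(1 - s) * z powr (1 - s - 1) + (s - 1) * c = (s - 1) * (c - z powr (-s))"
      by (simp add: algebra_simps)
    finally show "(\<psi> has_field_derivative (s - 1) * (c - z powr (-s)))
            (at z within closed_segment (complex_of_real M) (of_real (M + 1)))"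
      by (rule has_field_derivative_at_within)
    have "norm (c - z powr (-s)) \<le> norm (-s) * M powr (- Re s - 1) * (M + 1 - w)"
      unfolding c_def w(1)
      by (rule powr_diff_bound) (use w M assms in \<open>auto intro!: powr_mono2'\<close>)
    also have "\<dots> \<le> norm (-s) * M powr (- Re s - 1) * 1"
      using w by (intro mult_left_mono) auto
    finally show "norm ((s - 1) * (c - z powr (-s))) \<le> B"
      unfolding norm_mult B_def by (intro mult_left_mono) auto
  qed auto
  also have "norm (complex_of_real M - of_real (M + 1)) = 1"
    by (simp flip: of_real_diff)
  also have "\<psi> (of_real M) - \<psi> (of_real (M + 1)) = zeta_rem 1 n s"
    by (simp add: \<psi>_def zeta_rem_def c_def M_def algebra_simps)
  finally show ?thesis by (simp add: B_def M_def mult_ac)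
qed

text \<open>
  The entire function \<open>(s - 1) * zeta s\<close>; the value of \<open>zeta\<close> itself at 1 is arbitrary.
\<close>
definition zeta_reg :: "complex \<Rightarrow> complex" where
  "zeta_reg s = (if s = 1 then 1 else (s - 1) * zeta s)"

text \<open>
  Summing the first order remainders telescopes to \<open>1 - (s - 1) * (zeta s - 1)\<close>, first for
  \<open>Re s > 1\<close> and then by analytic continuation. At 1 all remainders vanish, which gives the value 1.
\<close>
lemma zeta_reg_series:
  obtains G where "G holomorphic_on {s. Re s > 0}"
    "\<And>s. Re s > 0 \<Longrightarrow> (\<lambda>n. zeta_rem 1 n s) sums G s"
    "\<And>s. Re s > 0 \<Longrightarrow> zeta_reg s = s - G s"
proof -
  obtain G where G: "G holomorphic_on {s. Re s > 0}"
       "\<And>s. Re s > 0 \<Longrightarrow> (\<lambda>n. zeta_rem 1 n s) sums G s"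
    using zeta_rem_series[of 1] by auto
  have eq1: "(s - 1) * zeta s = s - G s" if s: "Re s > 1" for s
  proof -
    have "(\<lambda>n. of_nat (n + 2) powr (-s)) sums (zeta s - 1)"
    proof -
      have "(\<lambda>n. of_nat (Suc (Suc n)) powr (-s)) sums (zeta s - 1)"
        using zeta_sums[OF s] sums_Suc_iff[of "\<lambda>n. of_nat (Suc n) powr (-s)" "zeta s - 1"] by simp
      thus ?thesis by (simp only: add_2_eq_Suc')
    qed
    hence "(\<lambda>n. (of_nat (n + 1) powr (1 - s) - of_nat (n + 2) powr (1 - s))
              - (s - 1) * of_nat (n + 2) powr (-s)) sums (1 - (s - 1) * (zeta s - 1))"
      by (intro sums_diff telescope_powr sums_mult s)
    also have "(\<lambda>n. (of_nat (n + 1) powr (1 - s) - of_nat (n + 2) powr (1 - s))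
              - (s - 1) * of_nat (n + 2) powr (-s)) = (\<lambda>n. zeta_rem 1 n s)"
      by (simp add: zeta_rem_def)
    finally have "G s = 1 - (s - 1) * (zeta s - 1)"
      using G(2)[of s] s sums_unique2 by fastforce
    thus ?thesis by (simp add: algebra_simps)
  qed
  have eq: "zeta_reg s = s - G s" if s: "Re s > 0" for s
  proof (cases "s = 1")
    case True
    have "zeta_rem 1 n 1 = 0" for n
    proof -
      have "complex_of_nat (n + 1) \<noteq> 0" "complex_of_nat (n + 2) \<noteq> 0"
        by (simp_all only: of_nat_eq_0_iff)
      thus ?thesis by (simp add: zeta_rem_def)
    qed
    hence "G 1 = 0" using G(2)[of 1] by (auto simp: sums_iff)
    thus ?thesis using True by (simp add: zeta_reg_def)
  next
    case False
    have "(s - 1) * zeta s = s - G s"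
    proof (rule analytic_continuation_open[of "{s. Re s > 1}" "{s. Re s > 0} - {1}" "\<lambda>s. (s - 1) * zeta s" "\<lambda>s. s - G s"])
      show "{s. Re s > 1} \<noteq> {}" by (auto intro: exI[of _ 2])
      show "connected ({s. Re s > 0} - {1::complex})"
        by (intro connected_open_delete open_Re_gt connected_Re_gt) auto
      show "(\<lambda>s. (s - 1) * zeta s) holomorphic_on {s. Re s > 0} - {1}"
        by (intro holomorphic_intros holomorphic_on_subset[OF zeta_holomorphic]) auto
      show "(\<lambda>s. s - G s) holomorphic_on {s. Re s > 0} - {1}"
        by (intro holomorphic_intros holomorphic_on_subset[OF G(1)]) auto
    qed (use s False eq1 in \<open>auto simp: open_Re_gt open_delete\<close>)
    thus ?thesis using False by (simp add: zeta_reg_def)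
  qed
  show thesis by (rule that[OF G eq])
qed

lemma zeta_reg_holomorphic: "zeta_reg holomorphic_on {s. Re s > 0}"
proof -
  obtain G where G: "G holomorphic_on {s. Re s > 0}" "\<And>s. Re s > 0 \<Longrightarrow> zeta_reg s = s - G s"
    using zeta_reg_series by metis
  have "(\<lambda>s. s - G s) holomorphic_on {s. Re s > 0}" by (intro holomorphic_intros G)
  thus ?thesis by (rule holomorphic_transform) (use G in auto)
qed

lemma zeta_reg_bound:
  obtains K where "K \<ge> 0" "\<And>s. Re s \<ge> 1 / 2 \<Longrightarrow> norm (zeta_reg s) \<le> norm s + K * (norm s * norm (s - 1))"
proof -
  obtain G where G: "\<And>s. Re s > 0 \<Longrightarrow> (\<lambda>n. zeta_rem 1 n s) sums G s"
    "\<And>s. Re s > 0 \<Longrightarrow> zeta_reg s = s - G s" using zeta_reg_series by metis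
  define g where "g = (\<lambda>n. real (Suc n) powr (-3/2))"
  have g: "summable g"
    using summable_Suc_powr[of "3/2"] by (simp add: g_def)
  show thesis
  proof (rule that[of "suminf g"])
    show "suminf g \<ge> 0" by (intro suminf_nonneg g) (simp add: g_def)
    fix s :: complex assume s: "Re s \<ge> 1 / 2"
    have "norm (suminf (\<lambda>n. zeta_rem 1 n s)) \<le> suminf (\<lambda>n. norm s * norm (s - 1) * g n)"
    proof (rule norm_suminf_le)
      fix n
      have "norm (zeta_rem 1 n s) \<le> norm s * norm (s - 1) * real (Suc n) powr (- Re s - 1)"
        using s by (intro zeta_rem_1_bound) auto
      also have "\<dots> \<le> norm s * norm (s - 1) * g n"
        unfolding g_def using s by (intro mult_left_mono powr_mono) auto
      finally show "norm (zeta_rem 1 n s) \<le> norm s * norm (s - 1) * g n" .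
    qed (intro summable_mult g)
    also have "\<dots> = suminf g * (norm s * norm (s - 1))"
      using g by (simp add: suminf_mult)
    also have "suminf (\<lambda>n. zeta_rem 1 n s) = G s"
      using G(1)[of s] s by (simp add: sums_iff)
    finally show "norm (zeta_reg s) \<le> norm s + suminf g * (norm s * norm (s - 1))"
      using G(2)[of s] s norm_triangle_ineq4[of s "G s"] by simp
  qed
qed

lemma zeta_polynomial_growth:
  obtains A where "A \<ge> 1" "\<And>s. Re s \<ge> 1 / 2 \<Longrightarrow> Re s \<le> 4 \<Longrightarrow> \<bar>Im s\<bar> \<ge> 1 / 2 \<Longrightarrow> norm (zeta s) \<le> A * (1 + \<bar>Im s\<bar>)"
proof -
  obtain K where K: "K \<ge> 0" "\<And>s. Re s \<ge> 1 / 2 \<Longrightarrow> norm (zeta_reg s) \<le> norm s + K * (norm s * norm (s - 1))"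
    using zeta_reg_bound by metis
  show thesis
  proof (rule that[of "8 + 4 * K"])
    fix s assume s: "Re s \<ge> 1 / 2" "Re s \<le> 4" "\<bar>Im s\<bar> \<ge> 1 / 2"
    have ns: "norm s \<le> 4 * (1 + \<bar>Im s\<bar>)" using cmod_le[of s] s by auto
    have n1: "norm (s - 1) \<ge> 1 / 2" using abs_Im_le_cmod[of "s - 1"] s by simp
    have "s \<noteq> 1" using s by auto
    hence "norm (s - 1) * norm (zeta s) \<le> norm s + K * (norm s * norm (s - 1))"
      using K(2)[OF s(1)] by (simp add: zeta_reg_def norm_mult)
    moreover have "1 * norm s \<le> (2 * norm (s - 1)) * norm s" using n1 by (intro mult_right_mono) auto
    ultimately have "norm (s - 1) * norm (zeta s) \<le> norm (s - 1) * ((2 + K) * norm s)"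
      by (simp add: algebra_simps)
    hence "norm (zeta s) \<le> (2 + K) * norm s"
      using n1 by (subst (asm) mult_le_cancel_left_pos) auto
    also have "\<dots> \<le> (2 + K) * (4 * (1 + \<bar>Im s\<bar>))" using ns K by (intro mult_left_mono) auto
    finally show "norm (zeta s) \<le> (8 + 4 * K) * (1 + \<bar>Im s\<bar>)" by (simp add: algebra_simps)
  qed (use K in auto)
qed

text \<open>
  The reciprocal of zeta, with its removable singularity at 1 removed.
\<close>
definition zeta_inv :: "complex \<Rightarrow> complex" where
  "zeta_inv s = (s - 1) / zeta_reg s"

lemma zeta_inv_eq: "s \<noteq> 1 \<Longrightarrow> zeta_inv s = 1 / zeta s"
  by (simp add: zeta_inv_def zeta_reg_def)

lemma norm_moebius_mu_le: "norm (of_int (moebius_mu n) :: complex) \<le> 1"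
  using abs_moebius_mu_le[of n] by (simp only: norm_of_int of_int_le_1_iff flip: of_int_abs)

lemma moebius_series_abs_summable:
  assumes "Re s > 1"
  shows "summable (\<lambda>n. norm (of_int (moebius_mu (Suc n)) * of_nat (Suc n) powr (-s) :: complex))"
proof (rule summable_comparison_test')
  show "summable (\<lambda>n. real (Suc n) powr (- Re s))"
    by (rule summable_Suc_powr[OF assms])
  show "norm (norm (of_int (moebius_mu (Suc n)) * of_nat (Suc n) powr (-s) :: complex)) \<le> real (Suc n) powr (- Re s)" for n
  proof -
    have "norm (of_int (moebius_mu (Suc n)) * of_nat (Suc n) powr (-s) :: complex) \<le> 1 * real (Suc n) powr (- Re s)"
      unfolding norm_mult norm_nat_powr uminus_complex.sel
      by (intro mult_right_mono norm_moebius_mu_le) auto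
    thus ?thesis by simp
  qed
qed

text \<open>
  Multiply both absolutely convergent series and collect the pairs \<open>(k, d)\<close> by their product.
\<close>
lemma zeta_times_moebius_series:
  assumes s: "Re s > 1"
  shows "zeta s * (\<Sum>n. of_int (moebius_mu (Suc n)) * of_nat (Suc n) powr (-s)) = 1"
proof -
  define a where "a = (\<lambda>n. of_nat (Suc n) powr (-s) :: complex)"
  define b where "b = (\<lambda>n. of_int (moebius_mu (Suc n)) * of_nat (Suc n) powr (-s) :: complex)"
  have a: "summable (\<lambda>n. norm (a n))"
    unfolding a_def norm_nat_powr uminus_complex.sel by (rule summable_Suc_powr[OF s])
  have b: "summable (\<lambda>n. norm (b n))" unfolding b_def by (rule moebius_series_abs_summable[OF s])
  have ia: "infsum a UNIV = zeta s"
    using norm_summable_imp_has_sum[OF a] zeta_sums[OF s] by (intro infsumI) (simp add: a_def)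
  have ib: "infsum b UNIV = (\<Sum>n. b n)"
    using norm_summable_imp_has_sum[OF b] summable_norm_cancel[OF b] by (intro infsumI) (simp add: summable_sums)
  have "((\<lambda>z. a (fst z) * b (snd z)) has_sum (infsum a UNIV * infsum b UNIV)) (UNIV \<times> UNIV)"
    using a b by (intro has_sum_Times) (simp_all add: summable_on_UNIV_nonneg_real_iff)
  also have "?this \<longleftrightarrow> ((\<lambda>(n, d). of_int (moebius_mu d) * of_nat n powr (-s)) has_sum (infsum a UNIV * infsum b UNIV))
                 (SIGMA n:{0<..}. {d. d dvd n})"
  proof (rule has_sum_reindex_bij_witness[where i = "\<lambda>(n, d). (n div d - 1, d - 1)" and j = "\<lambda>(k, d). (Suc k * Suc d, Suc d)"])
    fix z :: "nat \<times> nat"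
    obtain k d where z: "z = (k, d)" by fastforce
    show "(case z of (k, d) \<Rightarrow> (Suc k * Suc d, Suc d)) \<in> (SIGMA n:{0<..}. {d. d dvd n})"
      by (simp add: z del: mult_Suc mult_Suc_right)
    show "(case case z of (k, d) \<Rightarrow> (Suc k * Suc d, Suc d) of (n, d) \<Rightarrow> (n div d - 1, d - 1)) = z"
      by (simp add: z del: mult_Suc mult_Suc_right)
    have "complex_of_nat (Suc k * Suc d) powr (-s) = of_nat (Suc k) powr (-s) * of_nat (Suc d) powr (-s)"
      using powr_times_real[of "of_nat (Suc k)" "of_nat (Suc d)" "-s"] unfolding of_nat_mult by simp
    thus "(case case z of (k, d) \<Rightarrow> (Suc k * Suc d, Suc d) of (n, d) \<Rightarrow> of_int (moebius_mu d) * of_nat n powr (-s)) = a (fst z) * b (snd z)"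
      by (simp add: z a_def b_def del: mult_Suc mult_Suc_right of_nat_Suc of_nat_mult)
  next
    fix z :: "nat \<times> nat" assume "z \<in> (SIGMA n:{0<..}. {d. d dvd n})"
    then obtain n d where z: "z = (n, d)" "n > 0" "d dvd n" by auto
    then obtain k where k: "n = d * k" "d > 0" "k > 0" by (auto elim!: dvdE)
    show "(case case z of (n, d) \<Rightarrow> (n div d - 1, d - 1) of (k, d) \<Rightarrow> (Suc k * Suc d, Suc d)) = z"
      using k z by (simp add: mult.commute del: mult_Suc mult_Suc_right)
  qed auto
  finally have "((\<lambda>n. \<Sum>d | d dvd n. of_int (moebius_mu d) * of_nat n powr (-s)) has_sum (infsum a UNIV * infsum b UNIV)) {0<..}"
    by (rule has_sum_Sigma') (auto intro!: has_sum_finite)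
  also have "?this \<longleftrightarrow> ((\<lambda>n::nat. if n = 1 then 1 else 0) has_sum (infsum a UNIV * infsum b UNIV)) {0<..}"
  proof (rule has_sum_cong)
    fix n :: nat assume n: "n \<in> {0<..}"
    have "(\<Sum>d | d dvd n. complex_of_int (moebius_mu d)) = of_real (\<Sum>d | d dvd n. real_of_int (moebius_mu d))" by simp
    also have "\<dots> = (if n = 1 then 1 else 0)" using sum_moebius_mu_divisors[of n] n by simp
    finally show "(\<Sum>d | d dvd n. of_int (moebius_mu d) * of_nat n powr (-s)) = (if n = 1 then 1 else 0 :: complex)"
      by (simp add: sum_distrib_right[symmetric])
  qed
  also have "\<dots> \<longleftrightarrow> ((\<lambda>n. 1) has_sum (infsum a UNIV * infsum b UNIV)) {1::nat}"
    by (rule has_sum_cong_neutral) auto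
  finally have "infsum a UNIV * infsum b UNIV = 1"
    using has_sum_finite[of "{1::nat}" "\<lambda>n. 1 :: complex"] has_sum_unique by fastforce
  thus ?thesis using ia ib by (simp add: b_def)
qed

lemma zeta_inv_sums:
  assumes s: "Re s > 1"
  shows "(\<lambda>n. of_int (moebius_mu (Suc n)) * of_nat (Suc n) powr (-s)) sums zeta_inv s"
proof -
  have "zeta_inv s = (\<Sum>n. of_int (moebius_mu (Suc n)) * of_nat (Suc n) powr (-s))"
  proof -
    have "s \<noteq> 1" using s by auto
    thus ?thesis using zeta_times_moebius_series[OF s]
      by (metis zeta_inv_eq nonzero_mult_div_cancel_left mult_zero_left zero_neq_one)
  qed
  thus ?thesis using summable_norm_cancel[OF moebius_series_abs_summable[OF s]] by (simp add: summable_sums)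
qed

lemma zeta_bounded_right:
  obtains B where "B \<ge> 1" "\<And>s. Re s \<ge> 3 / 2 \<Longrightarrow> norm (zeta s) \<le> B" "\<And>s. Re s \<ge> 3 / 2 \<Longrightarrow> norm (zeta_inv s) \<le> B"
proof -
  define g where "g = (\<lambda>n. real (Suc n) powr (-3/2))"
  have g: "summable g"
    using summable_Suc_powr[of "3/2"] by (simp add: g_def)
  have le: "norm (a * of_nat (Suc n) powr (-s) :: complex) \<le> g n" if "Re s \<ge> 3/2" "norm a \<le> 1" for s a n
  proof -
    have "norm (of_nat (Suc n) powr (-s) :: complex) \<le> g n"
      unfolding norm_nat_powr g_def using that by (intro powr_mono) auto
    thus ?thesis unfolding norm_mult using that by (meson mult_left_le_one_le norm_ge_zero order.trans)
  qed
  have "norm (zeta s) \<le> suminf g" if "Re s \<ge> 3/2" for s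
    using norm_suminf_le[OF le[OF that, of 1] g] zeta_sums[of s] that by (simp add: sums_iff)
  moreover have "norm (zeta_inv s) \<le> suminf g" if "Re s \<ge> 3/2" for s
  proof -
    have "norm (\<Sum>n. of_int (moebius_mu (Suc n)) * of_nat (Suc n) powr (-s) :: complex) \<le> suminf g"
      by (rule norm_suminf_le[OF le[OF that norm_moebius_mu_le] g])
    thus ?thesis using zeta_inv_sums[of s] that by (simp add: sums_iff)
  qed
  ultimately show thesis by (intro that[of "max 1 (suminf g)"]) (auto simp: le_max_iff_disj)
qed

section \<open>Growth of zeta under the Riemann hypothesis\<close>

text \<open>
  The quotient \<open>g / (2 * M - g)\<close> maps the disc into the unit disc and fixes 0, so the Schwarz lemma
  applies.
\<close>
lemma borel_caratheodory:
  fixes g :: "complex \<Rightarrow> complex"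
  assumes holo: "g holomorphic_on ball 0 R" and g0: "g 0 = 0"
    and Re: "\<And>z. z \<in> ball 0 R \<Longrightarrow> Re (g z) < M"
    and z: "norm z \<le> r" "r < R" and r: "r > 0"
  shows "norm (g z) \<le> 2 * M * r / (R - r)"
proof -
  have R: "R > 0" using z r by linarith
  have M: "M > 0" using Re[of 0] g0 R by simp
  define w where "w = (\<lambda>z. g z / (2 * M - g z))"
  have nz: "2 * M - g z \<noteq> 0" if "z \<in> ball 0 R" for z
  proof
    assume "2 * M - g z = 0"
    hence "Re (g z) = 2 * M" by (simp add: complex_eq_iff)
    thus False using Re[OF that] M by simp
  qed
  have w1: "norm (w z) < 1" if "z \<in> ball 0 R" for z
  proof -
    have "norm (g z) ^ 2 < norm (2 * M - g z) ^ 2"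
    proof -
      have "norm (2 * M - g z) ^ 2 - norm (g z) ^ 2 = 4 * M * (M - Re (g z))"
        unfolding cmod_power2 by (simp add: power2_eq_square algebra_simps)
      also have "\<dots> > 0" using M Re[OF that] by simp
      finally show ?thesis by simp
    qed
    hence "norm (g z) < norm (2 * M - g z)" by (rule power2_less_imp_less) simp
    thus ?thesis using nz[OF that] by (simp add: w_def norm_divide)
  qed
  define f where "f = (\<lambda>z. w (of_real R * z))"
  have mem: "of_real R * z \<in> ball 0 R" if "norm z < 1" for z :: complex
    using that R by (simp add: norm_mult)
  have zR: "norm (z / of_real R) < 1" using z R by (simp add: norm_divide)
  have "norm (f (z / of_real R)) \<le> norm (z / of_real R)"
  proof (rule Schwarz_Lemma(1))
    have "w holomorphic_on ball 0 R" unfolding w_def by (intro holomorphic_intros holo nz)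
    thus "f holomorphic_on ball 0 1"
      unfolding f_def using mem
      by (intro holomorphic_on_compose_gen[of "\<lambda>z. of_real R * z" _ w, unfolded o_def] holomorphic_intros) auto
    show "f 0 = 0" by (simp add: f_def w_def g0)
    show "norm (f z) < 1" if "norm z < 1" for z unfolding f_def by (intro w1 mem that)
  qed (rule zR)
  hence wz: "norm (w z) \<le> r / R" using R z by (simp add: f_def norm_divide field_simps)
  have z': "z \<in> ball 0 R" using z by simp
  have "g z = 2 * M * w z / (1 + w z)"
  proof -
    have "1 + w z = 2 * M / (2 * M - g z)" using nz[OF z'] by (simp add: w_def field_simps)
    thus ?thesis using nz[OF z'] M by (simp add: w_def)
  qed
  hence "norm (g z) = 2 * M * norm (w z) / norm (1 + w z)"
    using M by (simp add: norm_divide norm_mult)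
  also have "\<dots> \<le> 2 * M * (r / R) / (1 - r / R)"
  proof (intro frac_le mult_left_mono wz)
    show "1 - r / R > 0" using z R by simp
    have "norm (1 + w z) \<ge> 1 - norm (w z)" using norm_triangle_ineq2[of 1 "- w z"] by simp
    thus "1 - r / R \<le> norm (1 + w z)" using wz by linarith
  qed (use M r R in auto)
  also have "\<dots> = 2 * M * r / (R - r)" using R z by (simp add: field_simps)
  finally show ?thesis .
qed

text \<open>
  A substitute for Hadamard's three circles theorem: the first \<open>N\<close> Taylor coefficients are bounded by
  Cauchy's inequality on the small circle and the others on the large circle. The large bound \<open>M\<close>
  enters with the factor \<open>(r / R\<^sub>1) ^ N\<close>, which is as small as desired when \<open>N\<close> is large.
\<close>
lemma taylor_two_radii:
  fixes F :: "complex \<Rightarrow> complex"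
  assumes holo: "F holomorphic_on ball 0 R" and rad: "0 < r\<^sub>0" "0 \<le> r" "r\<^sub>0 < R" "r < R\<^sub>1" "R\<^sub>1 < R"
    and m: "\<And>z. norm z = r\<^sub>0 \<Longrightarrow> norm (F z) \<le> m" and M: "\<And>z. norm z = R\<^sub>1 \<Longrightarrow> norm (F z) \<le> M"
    and z: "norm z \<le> r"
  shows "norm (F z) \<le> m * (\<Sum>n<N. (r / r\<^sub>0) ^ n) + M * ((r / R\<^sub>1) ^ N / (1 - r / R\<^sub>1))"
proof -
  define a where "a = (\<lambda>n. (deriv ^^ n) F 0 / fact n)"
  have coeff: "norm (a n) \<le> B / \<rho> ^ n" if "0 < \<rho>" "\<rho> < R" "\<And>z. norm z = \<rho> \<Longrightarrow> norm (F z) \<le> B" for \<rho> B n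
  proof -
    have "norm ((deriv ^^ n) F 0) \<le> fact n * B / \<rho> ^ n"
    proof (rule Cauchy_inequality)
      show "F holomorphic_on ball 0 \<rho>" using that by (intro holomorphic_on_subset[OF holo]) auto
      show "continuous_on (cball 0 \<rho>) F"
        using that by (intro holomorphic_on_imp_continuous_on holomorphic_on_subset[OF holo]) auto
    qed (use that in auto)
    thus ?thesis by (simp add: a_def norm_divide field_simps)
  qed
  have sums: "(\<lambda>n. a n * z ^ n) sums F z"
    using holomorphic_power_series[OF holo, of z] z rad by (simp add: a_def)
  define q where "q = r / R\<^sub>1"
  have q: "0 \<le> q" "q < 1" using rad by (auto simp: q_def)
  have R1: "R\<^sub>1 > 0" using rad by linarith
  have M0: "M \<ge> 0" using order.trans[OF norm_ge_zero M[of "of_real R\<^sub>1"]] R1 by simp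
  have m0: "m \<ge> 0" using order.trans[OF norm_ge_zero m[of "of_real r\<^sub>0"]] rad by simp
  have term_le: "norm (a n * z ^ n) \<le> B * (r / \<rho>) ^ n"
    if "0 < \<rho>" "\<rho> < R" "\<And>z. norm z = \<rho> \<Longrightarrow> norm (F z) \<le> B" "B \<ge> 0" for \<rho> B n
  proof -
    have "norm (a n * z ^ n) \<le> B / \<rho> ^ n * r ^ n"
      unfolding norm_mult norm_power using that z rad by (intro mult_mono coeff power_mono) auto
    thus ?thesis by (simp add: power_divide)
  qed
  have geo: "(\<lambda>n. M * (q ^ N * q ^ n)) sums (M * (q ^ N * (1 / (1 - q))))"
    using q by (intro sums_mult geometric_sums) auto
  have "F z = (\<Sum>n. a (n + N) * z ^ (n + N)) + (\<Sum>n<N. a n * z ^ n)"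
    using suminf_split_initial_segment[OF sums_summable[OF sums], of N] sums by (simp add: sums_iff)
  also have "norm \<dots> \<le> norm (\<Sum>n. a (n + N) * z ^ (n + N)) + norm (\<Sum>n<N. a n * z ^ n)"
    by (rule norm_triangle_ineq)
  also have "norm (\<Sum>n. a (n + N) * z ^ (n + N)) \<le> (\<Sum>n. M * (q ^ N * q ^ n))"
  proof (rule norm_suminf_le)
    show "norm (a (n + N) * z ^ (n + N)) \<le> M * (q ^ N * q ^ n)" for n
      using term_le[of R\<^sub>1 M "n + N"] R1 rad M M0 by (simp add: q_def power_add mult_ac)
  qed (rule sums_summable[OF geo])
  also have "(\<Sum>n. M * (q ^ N * q ^ n)) = M * (q ^ N * (1 / (1 - q)))" using geo by (simp add: sums_iff)
  also have "norm (\<Sum>n<N. a n * z ^ n) \<le> (\<Sum>n<N. m * (r / r\<^sub>0) ^ n)"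
    by (rule sum_norm_le) (use term_le[of r\<^sub>0 m] rad m m0 in auto)
  finally show ?thesis by (simp add: q_def sum_distrib_left)
qed

lemma RH_zeta_nonzero:
  assumes RH: "riemann_hypothesis" and s: "Re s > 1 / 2" "s \<noteq> 1"
  shows "zeta s \<noteq> 0"
proof
  assume "zeta s = 0"
  moreover have "\<not> (\<exists>k::nat. k \<ge> 1 \<and> s = - (2 * of_nat k))" using s by auto
  ultimately have "Re s = 1 / 2" using RH s unfolding riemann_hypothesis_def by blast
  thus False using s by simp
qed

lemma RH_zeta_reg_nonzero:
  assumes "riemann_hypothesis" "Re s > 1 / 2"
  shows "zeta_reg s \<noteq> 0"
  using RH_zeta_nonzero[OF assms] by (auto simp: zeta_reg_def)

lemma RH_zeta_inv_holomorphic: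
  assumes "riemann_hypothesis"
  shows "zeta_inv holomorphic_on {s. Re s > 1 / 2}"
  unfolding zeta_inv_def using RH_zeta_reg_nonzero[OF assms]
  by (intro holomorphic_intros holomorphic_on_subset[OF zeta_reg_holomorphic]) auto

text \<open>
  \<open>borel_caratheodory\<close> and \<open>taylor_two_radii\<close> are applied to a logarithm of zeta on the disc of
  radius 3/2 about \<open>2 + i t\<close>, which lies in \<open>Re s > 1 / 2\<close>. On it the real part is at most
  \<open>ln (1 + \<bar>t\<bar>) + O(1)\<close> by the polynomial growth of zeta, and near the centre it is \<open>O(1)\<close>; the choice
  of \<open>N\<close> turns the first bound into \<open>\<epsilon> * ln (1 + \<bar>t\<bar>)\<close> at the cost of a larger constant.
\<close>
lemma RH_log_zeta_bound:
  assumes RH: "riemann_hypothesis" and \<delta>: "0 < \<delta>" "\<delta> < 1" and \<epsilon>: "\<epsilon> > 0"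
  obtains K where "\<And>s. Re s \<ge> 1 / 2 + \<delta> \<Longrightarrow> Re s \<le> 2 \<Longrightarrow> \<bar>Im s\<bar> \<ge> 2 \<Longrightarrow>
                     \<bar>ln (norm (zeta s))\<bar> \<le> K + \<epsilon> * ln (1 + \<bar>Im s\<bar>)"
proof -
  obtain A where A: "A \<ge> 1" "\<And>s. Re s \<ge> 1 / 2 \<Longrightarrow> Re s \<le> 4 \<Longrightarrow> \<bar>Im s\<bar> \<ge> 1 / 2 \<Longrightarrow> norm (zeta s) \<le> A * (1 + \<bar>Im s\<bar>)"
    using zeta_polynomial_growth by metis
  obtain B where B: "B \<ge> 1" "\<And>s. Re s \<ge> 3 / 2 \<Longrightarrow> norm (zeta s) \<le> B" "\<And>s. Re s \<ge> 3 / 2 \<Longrightarrow> norm (zeta_inv s) \<le> B"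
    using zeta_bounded_right by metis
  define r where "r = 3/2 - \<delta>"
  define R1 where "R1 = 3/2 - \<delta>/2"
  define q where "q = r / R1"
  have rR: "0 < r" "r < R1" "R1 < 3/2" using \<delta> by (auto simp: r_def R1_def)
  have q: "0 < q" "q < 1" using rR by (auto simp: q_def)
  \<comment> \<open>The factor \<open>6 / \<delta>\<close> is what Borel-Caratheodory costs between the radii \<open>R1\<close> and 3/2.\<close>
  have "(\<lambda>N. 6 / \<delta> * (q ^ N / (1 - q))) \<longlonglongrightarrow> 6 / \<delta> * (0 / (1 - q))"
    by (intro tendsto_intros LIMSEQ_power_zero) (use q in auto)
  hence "\<forall>\<^sub>F N in sequentially. 6 / \<delta> * (q ^ N / (1 - q)) < \<epsilon>"
    using \<epsilon> by (intro order_tendstoD(2)) auto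
  then obtain N where N: "6 / \<delta> * (q ^ N / (1 - q)) < \<epsilon>"
    by (auto simp: eventually_sequentially)
  define m where "m = 2 * (2 * ln B + 1)"
  define L0 where "L0 = ln (3 * A) + ln B + 1"
  define K where "K = m * (\<Sum>n<N. (r / (1/4)) ^ n) + \<epsilon> * L0 + ln B"
  show thesis
  proof (rule that[of K])
    fix s assume s: "Re s \<ge> 1 / 2 + \<delta>" "Re s \<le> 2" "\<bar>Im s\<bar> \<ge> 2"
    define t where "t = Im s"
    define c where "c = Complex 2 t"
    have t: "\<bar>t\<bar> \<ge> 2" using s by (simp add: t_def)
    have ballD: "Re z > 1/2" "Re z < 4" "\<bar>Im z\<bar> > 1/2" "\<bar>Im z\<bar> \<le> \<bar>t\<bar> + 3/2" "z \<noteq> 1" if "z \<in> ball c (3/2)" for z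
    proof -
      have d: "norm (z - c) < 3/2" using that by (simp add: dist_norm norm_minus_commute)
      have "\<bar>Re z - 2\<bar> < 3/2" "\<bar>Im z - t\<bar> < 3/2"
        using le_less_trans[OF abs_Re_le_cmod d] le_less_trans[OF abs_Im_le_cmod d] by (simp_all add: c_def)
      thus "Re z > 1/2" "Re z < 4" "\<bar>Im z\<bar> > 1/2" "\<bar>Im z\<bar> \<le> \<bar>t\<bar> + 3/2" using t by linarith+
      thus "z \<noteq> 1" by auto
    qed
    have nz: "zeta z \<noteq> 0" if "z \<in> ball c (3/2)" for z
      using ballD[OF that] by (intro RH_zeta_nonzero[OF RH]) auto
    have holz: "zeta holomorphic_on ball c (3/2)"
      by (rule holomorphic_on_subset[OF zeta_holomorphic]) (use ballD(5) in auto)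
    \<comment> \<open>Only differences of values of the logarithm are used, so any branch will do.\<close>
    obtain g where g: "g holomorphic_on ball c (3/2)" "\<And>z. z \<in> ball c (3/2) \<Longrightarrow> zeta z = exp (g z)"
      using contractible_imp_holomorphic_log[OF holz convex_imp_contractible nz] by auto
    define F where "F = (\<lambda>z. g (c + z) - g c)"
    have Reg: "Re (g z) = ln (norm (zeta z))" if "z \<in> ball c (3/2)" for z
      using g(2)[OF that] by simp
    have mem: "c + z \<in> ball c (3/2)" if "norm z < 3/2" for z using that by (simp add: dist_norm)
    have ReF: "Re (F z) = ln (norm (zeta (c + z))) - ln (norm (zeta c))" if "norm z < 3/2" for z
      using Reg[OF mem[OF that]] Reg[of c] by (simp add: F_def)
    have Fholo: "F holomorphic_on ball 0 \<rho>" if "\<rho> \<le> 3/2" for \<rho>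
      unfolding F_def using mem that
      by (intro holomorphic_intros holomorphic_on_compose_gen[OF _ g(1), of "\<lambda>z. c + z", unfolded o_def]) auto
    have F0: "F 0 = 0" by (simp add: F_def)
    have cB: "\<bar>ln (norm (zeta c))\<bar> \<le> ln B"
    proof -
      have c: "c \<in> ball c (3/2)" by simp
      have "norm (zeta c) \<le> B" by (rule B(2)) (simp add: c_def)
      hence "ln (norm (zeta c)) \<le> ln B" using nz[OF c] B(1) by simp
      moreover have "norm (1 / zeta c) \<le> B"
        using B(3)[of c] ballD(5)[OF c] by (simp add: zeta_inv_eq c_def)
      hence "1 \<le> B * norm (zeta c)" using nz[OF c] by (simp add: norm_divide field_simps)
      hence "ln 1 \<le> ln (B * norm (zeta c))" by (intro ln_mono) auto
      hence "- ln (norm (zeta c)) \<le> ln B" using nz[OF c] B(1) by (simp add: ln_mult)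
      ultimately show ?thesis by linarith
    qed
    define L where "L = L0 + ln (1 + \<bar>t\<bar>)"
    have small: "norm (F z) \<le> m" if "norm z = 1/4" for z
    proof -
      have "norm (F z) \<le> 2 * (2 * ln B + 1) * (1/4) / (1/2 - 1/4)"
      proof (rule borel_caratheodory[OF Fholo F0])
        fix z assume "z \<in> ball (0::complex) (1/2)"
        hence z: "norm z < 1/2" by simp
        hence zb: "c + z \<in> ball c (3/2)" by (intro mem) auto
        have "Re (c + z) \<ge> 3/2" using abs_Re_le_cmod[of z] z by (simp add: c_def)
        hence "ln (norm (zeta (c + z))) \<le> ln B" using B(1,2) nz[OF zb] by (intro ln_mono) auto
        thus "Re (F z) < 2 * ln B + 1" using ReF[of z] z cB by simp
      qed (use that in auto)
      thus ?thesis by (simp add: m_def)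
    qed
    have big: "norm (F z) \<le> 6 / \<delta> * L" if "norm z = R1" for z
    proof -
      have ReL: "Re (F z) < L" if "norm z < 3/2" for z
      proof -
        have zb: "c + z \<in> ball c (3/2)" by (rule mem[OF that])
        have "norm (zeta (c + z)) \<le> A * (1 + \<bar>Im (c + z)\<bar>)"
          using ballD[OF zb] by (intro A(2)) auto
        also have "\<dots> \<le> A * (3 * (1 + \<bar>t\<bar>))" using ballD(4)[OF zb] A(1) by (intro mult_left_mono) auto
        finally have "ln (norm (zeta (c + z))) \<le> ln (3 * A * (1 + \<bar>t\<bar>))"
          using nz[OF zb] by (intro ln_mono) (auto simp: mult_ac)
        also have "\<dots> = ln (3 * A) + ln (1 + \<bar>t\<bar>)" using A(1) by (subst ln_mult) auto
        finally show ?thesis using ReF[OF that] cB by (simp add: L_def L0_def)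
      qed
      have L0: "L > 0" using ReL[of 0] F0 by simp
      have "norm (F z) \<le> 2 * L * R1 / (3/2 - R1)"
        by (rule borel_caratheodory[OF Fholo F0]) (use ReL rR that in auto)
      also have "\<dots> = 4 * L * R1 / \<delta>" by (simp add: R1_def field_simps)
      also have "\<dots> \<le> 4 * L * (3/2) / \<delta>" using L0 rR \<delta> by (intro divide_right_mono mult_left_mono) auto
      finally show ?thesis by simp
    qed
    have L0: "L \<ge> 0" unfolding L_def L0_def using A(1) B(1) t by auto
    have sc: "s - c = of_real (Re s - 2)" by (simp add: c_def t_def complex_eq_iff)
    have nsc: "norm (s - c) \<le> r" unfolding sc norm_of_real using s \<delta> by (simp add: r_def)
    have "norm (F (s - c)) \<le> m * (\<Sum>n<N. (r / (1/4)) ^ n) + (6 / \<delta> * L) * ((r / R1) ^ N / (1 - r / R1))"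
      by (rule taylor_two_radii[where R = "3/2"]) (use Fholo small big rR nsc in auto)
    also have "(6 / \<delta> * L) * ((r / R1) ^ N / (1 - r / R1)) = L * (6 / \<delta> * (q ^ N / (1 - q)))"
      by (simp add: q_def)
    also have "\<dots> \<le> L * \<epsilon>" using N L0 by (intro mult_left_mono) auto
    finally have "\<bar>Re (F (s - c))\<bar> \<le> m * (\<Sum>n<N. (r / (1/4)) ^ n) + L * \<epsilon>"
      using abs_Re_le_cmod[of "F (s - c)"] by linarith
    moreover have "Re (F (s - c)) = ln (norm (zeta s)) - ln (norm (zeta c))"
      using ReF[of "s - c"] nsc rR by simp
    ultimately have "\<bar>ln (norm (zeta s))\<bar> \<le> m * (\<Sum>n<N. (r / (1/4)) ^ n) + L * \<epsilon> + ln B" using cB by linarith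
    thus "\<bar>ln (norm (zeta s))\<bar> \<le> K + \<epsilon> * ln (1 + \<bar>Im s\<bar>)"
      by (simp add: K_def L_def t_def algebra_simps)
  qed
qed

text \<open>
  Exponentiating the bound for the absolute value of \<open>ln (norm (zeta s))\<close> bounds zeta and its
  reciprocal at the same time.
\<close>
lemma RH_zeta_bounds:
  assumes RH: "riemann_hypothesis" and \<delta>: "0 < \<delta>" "\<delta> < 1" and \<epsilon>: "\<epsilon> > 0"
  obtains C where "C \<ge> 0"
    "\<And>s. Re s \<ge> 1 / 2 + \<delta> \<Longrightarrow> \<bar>Im s\<bar> \<ge> 2 \<Longrightarrow> norm (zeta s) \<le> C * (1 + \<bar>Im s\<bar>) powr \<epsilon>"
    "\<And>s. Re s \<ge> 1 / 2 + \<delta> \<Longrightarrow> \<bar>Im s\<bar> \<ge> 2 \<Longrightarrow> norm (zeta_inv s) \<le> C * (1 + \<bar>Im s\<bar>) powr \<epsilon>"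
proof -
  obtain K where K: "\<And>s. Re s \<ge> 1 / 2 + \<delta> \<Longrightarrow> Re s \<le> 2 \<Longrightarrow> \<bar>Im s\<bar> \<ge> 2 \<Longrightarrow>
                     \<bar>ln (norm (zeta s))\<bar> \<le> K + \<epsilon> * ln (1 + \<bar>Im s\<bar>)"
    using RH_log_zeta_bound[OF assms] by metis
  obtain B where B: "B \<ge> 1" "\<And>s. Re s \<ge> 3 / 2 \<Longrightarrow> norm (zeta s) \<le> B" "\<And>s. Re s \<ge> 3 / 2 \<Longrightarrow> norm (zeta_inv s) \<le> B"
    using zeta_bounded_right by metis
  define C where "C = B + exp K"
  have "norm (zeta s) \<le> C * (1 + \<bar>Im s\<bar>) powr \<epsilon> \<and> norm (zeta_inv s) \<le> C * (1 + \<bar>Im s\<bar>) powr \<epsilon>"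
    if s: "Re s \<ge> 1 / 2 + \<delta>" "\<bar>Im s\<bar> \<ge> 2" for s
  proof (cases "Re s \<le> 2")
    case True
    have s1: "s \<noteq> 1" using s by auto
    have nz: "norm (zeta s) > 0" using RH_zeta_nonzero[OF RH _ s1] s \<delta> by simp
    have eq: "exp (K + \<epsilon> * ln (1 + \<bar>Im s\<bar>)) = exp K * (1 + \<bar>Im s\<bar>) powr \<epsilon>"
      by (simp add: exp_add powr_def)
    have le: "exp K * (1 + \<bar>Im s\<bar>) powr \<epsilon> \<le> C * (1 + \<bar>Im s\<bar>) powr \<epsilon>"
      unfolding C_def using B(1) by (intro mult_right_mono) auto
    have "exp (ln (norm (zeta s))) \<le> exp (K + \<epsilon> * ln (1 + \<bar>Im s\<bar>))"
      "exp (- ln (norm (zeta s))) \<le> exp (K + \<epsilon> * ln (1 + \<bar>Im s\<bar>))"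
      using K[OF s(1) True s(2)] by auto
    hence "norm (zeta s) \<le> exp K * (1 + \<bar>Im s\<bar>) powr \<epsilon>" "norm (zeta_inv s) \<le> exp K * (1 + \<bar>Im s\<bar>) powr \<epsilon>"
      using nz s1 unfolding eq by (auto simp: zeta_inv_eq norm_divide exp_minus field_simps)
    thus ?thesis using le by linarith
  next
    case False
    have "B * 1 \<le> C * (1 + \<bar>Im s\<bar>) powr \<epsilon>"
      unfolding C_def using B(1) \<epsilon> by (intro mult_mono ge_one_powr_ge_zero) auto
    thus ?thesis using B(2,3)[of s] False by simp
  qed
  thus thesis using that[of C] B(1) by (auto simp: C_def)
qed

lemma RH_zeta_inv_bound:
  assumes RH: "riemann_hypothesis" and \<delta>: "0 < \<delta>" "\<delta> < 1" and \<epsilon>: "\<epsilon> > 0"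
  obtains C where "C \<ge> 0" "\<And>s. Re s \<ge> 1 / 2 + \<delta> \<Longrightarrow> norm (zeta_inv s) \<le> C * (1 + \<bar>Im s\<bar>) powr \<epsilon>"
proof -
  obtain C where C: "C \<ge> 0" "\<And>s. Re s \<ge> 1 / 2 + \<delta> \<Longrightarrow> \<bar>Im s\<bar> \<ge> 2 \<Longrightarrow> norm (zeta_inv s) \<le> C * (1 + \<bar>Im s\<bar>) powr \<epsilon>"
    using RH_zeta_bounds[OF assms] by metis
  obtain B where B: "B \<ge> 1" "\<And>s. Re s \<ge> 3 / 2 \<Longrightarrow> norm (zeta_inv s) \<le> B"
    using zeta_bounded_right by metis
  have "compact (zeta_inv ` cbox (Complex (1/2 + \<delta>) (-2)) (Complex 2 2))"
    by (intro compact_continuous_image holomorphic_on_imp_continuous_on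
          holomorphic_on_subset[OF RH_zeta_inv_holomorphic[OF RH]]) (use \<delta> in \<open>auto simp: in_cbox_complex_iff\<close>)
  then obtain D where D: "D > 0" "\<And>s. s \<in> cbox (Complex (1/2 + \<delta>) (-2)) (Complex 2 2) \<Longrightarrow> norm (zeta_inv s) \<le> D"
    using compact_imp_bounded bounded_pos by (metis imageI)
  show thesis
  proof (rule that[of "B + C + D"])
    fix s assume s: "Re s \<ge> 1 / 2 + \<delta>"
    define X where "X = (1 + \<bar>Im s\<bar>) powr \<epsilon>"
    have X: "X \<ge> 1" unfolding X_def using \<epsilon> by (intro ge_one_powr_ge_zero) auto
    have BX: "B * 1 \<le> B * X" "D * 1 \<le> D * X" using X B(1) D(1) by (intro mult_left_mono; simp)+
    have CX: "0 \<le> C * X" using X C(1) by simp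
    consider "\<bar>Im s\<bar> \<ge> 2" | "Re s \<ge> 3/2" | "\<bar>Im s\<bar> \<le> 2" "Re s \<le> 2" by linarith
    hence "norm (zeta_inv s) \<le> C * X \<or> norm (zeta_inv s) \<le> B \<or> norm (zeta_inv s) \<le> D"
    proof cases
      case 3
      thus ?thesis using s by (auto simp: in_cbox_complex_iff intro!: D(2))
    qed (use C(2)[OF s] B(2) in \<open>auto simp: X_def\<close>)
    thus "norm (zeta_inv s) \<le> (B + C + D) * (1 + \<bar>Im s\<bar>) powr \<epsilon>"
      unfolding X_def[symmetric] distrib_right using BX CX B(1) D(1) by linarith
  qed (use B(1) C(1) D(1) in auto)
qed

lemma RH_zeta_line_bound:
  assumes RH: "riemann_hypothesis" and \<delta>: "0 < \<delta>" "\<delta> < 1 / 2" and \<epsilon>: "\<epsilon> > 0"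
  obtains C where "C \<ge> 0" "\<And>t. norm (zeta (Complex (1 / 2 + \<delta>) t)) \<le> C * (1 + \<bar>t\<bar>) powr \<epsilon>"
proof -
  obtain C where C: "C \<ge> 0" "\<And>s. Re s \<ge> 1 / 2 + \<delta> \<Longrightarrow> \<bar>Im s\<bar> \<ge> 2 \<Longrightarrow> norm (zeta s) \<le> C * (1 + \<bar>Im s\<bar>) powr \<epsilon>"
  proof -
    have "\<delta> < 1" using \<delta> by simp
    from RH_zeta_bounds[OF RH \<delta>(1) this \<epsilon>] show ?thesis using that by metis
  qed
  have "compact (zeta ` cbox (Complex (1/2 + \<delta>) (-2)) (Complex (1/2 + \<delta>) 2))"
    by (intro compact_continuous_image holomorphic_on_imp_continuous_on
          holomorphic_on_subset[OF zeta_holomorphic]) (use \<delta> in \<open>auto simp: in_cbox_complex_iff\<close>)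
  then obtain D where D: "D > 0" "\<And>s. s \<in> cbox (Complex (1/2 + \<delta>) (-2)) (Complex (1/2 + \<delta>) 2) \<Longrightarrow> norm (zeta s) \<le> D"
    using compact_imp_bounded bounded_pos by (metis imageI)
  show thesis
  proof (rule that[of "C + D"])
    fix t :: real
    define X where "X = (1 + \<bar>t\<bar>) powr \<epsilon>"
    have X: "X \<ge> 1" unfolding X_def using \<epsilon> by (intro ge_one_powr_ge_zero) auto
    have BX: "D * 1 \<le> D * X" using X D(1) by (intro mult_left_mono) auto
    have CX: "0 \<le> C * X" using X C(1) by simp
    have "norm (zeta (Complex (1 / 2 + \<delta>) t)) \<le> C * X \<or> norm (zeta (Complex (1 / 2 + \<delta>) t)) \<le> D"
    proof (cases "\<bar>t\<bar> \<ge> 2")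
      case True
      thus ?thesis using C(2)[of "Complex (1 / 2 + \<delta>) t"] by (simp add: X_def)
    next
      case False
      thus ?thesis by (auto simp: in_cbox_complex_iff intro!: D(2))
    qed
    thus "norm (zeta (Complex (1 / 2 + \<delta>) t)) \<le> (C + D) * (1 + \<bar>t\<bar>) powr \<epsilon>"
      unfolding X_def[symmetric] distrib_right using BX CX D(1) by linarith
  qed (use C(1) D(1) in auto)
qed

section \<open>A smooth tail of the Moebius series\<close>

text \<open>
  Why the square: the kernel \<open>1 / (v * (v + 2))\<close> that produces this weight has no pole
  other than 0 to the right of the line \<open>Re v = -3 / 2\<close>, whereas the weight \<open>1 - d / z\<close> would
  contribute a term of size \<open>1 / z\<close>.
\<close>
definition cutoff :: "real \<Rightarrow> nat \<Rightarrow> real" where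
  "cutoff z d = max 0 (1 - (real d / z)\<^sup>2)"

lemma cutoff_bounds: "0 \<le> cutoff z d" "cutoff z d \<le> 1"
  by (auto simp: cutoff_def)

lemma cutoff_eq_0:
  assumes "z > 0" "real d \<ge> z"
  shows "cutoff z d = 0"
  using assms by (simp add: cutoff_def)

definition moebius_head :: "real \<Rightarrow> complex \<Rightarrow> complex" where
  "moebius_head z s = (\<Sum>d\<in>{d. 1 \<le> d \<and> real d \<le> z}. of_int (moebius_mu d) * of_real (cutoff z d) * of_nat d powr (-s))"

text \<open>
  The Moebius series at \<open>s\<close> with the weight \<open>1 - cutoff z d\<close>, see \<open>moebius_tail_sums\<close>. As the
  difference of the reciprocal of zeta and a finite sum it is defined and holomorphic beyond the domain
  of convergence.
\<close>
definition moebius_tail :: "real \<Rightarrow> complex \<Rightarrow> complex" where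
  "moebius_tail z s = zeta_inv s - moebius_head z s"

lemma finite_nat_le: "finite {d::nat. 1 \<le> d \<and> real d \<le> z}"
  by (rule finite_subset[of _ "{..nat \<lceil>z\<rceil>}"]) (auto, linarith)

lemma moebius_head_sums:
  assumes "z > 0"
  shows "(\<lambda>n. of_int (moebius_mu (Suc n)) * of_real (cutoff z (Suc n)) * of_nat (Suc n) powr (-s)) sums moebius_head z s"
proof -
  define f where "f = (\<lambda>d. of_int (moebius_mu d) * of_real (cutoff z d) * of_nat d powr (-s))"
  have "(\<lambda>d. f d) sums (\<Sum>d\<in>{d. 1 \<le> d \<and> real d \<le> z}. f d)"
  proof (rule sums_finite[OF finite_nat_le])
    fix d assume d: "d \<notin> {d. 1 \<le> d \<and> real d \<le> z}"
    show "f d = 0"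
    proof (cases "d = 0")
      case True thus ?thesis by (simp add: f_def)
    next
      case False
      hence "cutoff z d = 0" using d assms by (intro cutoff_eq_0) auto
      thus ?thesis by (simp add: f_def)
    qed
  qed
  moreover have "f 0 = 0" by (simp add: f_def)
  ultimately have "(\<lambda>n. f (Suc n)) sums (\<Sum>d\<in>{d. 1 \<le> d \<and> real d \<le> z}. f d)"
    using sums_Suc_iff[of f] by simp
  thus ?thesis by (simp only: f_def moebius_head_def)
qed

lemma moebius_tail_sums:
  assumes "z > 0" "Re s > 1"
  shows "(\<lambda>n. of_int (moebius_mu (Suc n)) * of_real (1 - cutoff z (Suc n)) * of_nat (Suc n) powr (-s)) sums moebius_tail z s"
  using sums_diff[OF zeta_inv_sums[OF assms(2)] moebius_head_sums[OF assms(1), of s]]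
  by (simp add: moebius_tail_def algebra_simps)

lemma norm_tail_term:
  "norm (of_int (moebius_mu (Suc n)) * of_real (1 - cutoff z (Suc n)) * of_nat (Suc n) powr (-s) :: complex)
     \<le> real (Suc n) powr (- Re s)"
proof -
  have "norm (of_int (moebius_mu (Suc n)) * of_real (1 - cutoff z (Suc n)) * of_nat (Suc n) powr (-s) :: complex)
          \<le> 1 * 1 * real (Suc n) powr (- Re s)"
    unfolding norm_mult norm_nat_powr norm_of_real uminus_complex.sel
    using cutoff_bounds[of z "Suc n"]
    by (intro mult_mono norm_moebius_mu_le) auto
  thus ?thesis by simp
qed

lemma norm_moebius_tail_le:
  assumes "z > 0" "Re s \<ge> \<sigma>" "\<sigma> > 1"
  shows "norm (moebius_tail z s) \<le> (\<Sum>n. real (Suc n) powr (-\<sigma>))"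
proof -
  have "norm (\<Sum>n. of_int (moebius_mu (Suc n)) * of_real (1 - cutoff z (Suc n)) * of_nat (Suc n) powr (-s) :: complex)
          \<le> (\<Sum>n. real (Suc n) powr (-\<sigma>))"
    using assms by (intro norm_suminf_le summable_Suc_powr order.trans[OF norm_tail_term] powr_mono) auto
  thus ?thesis using moebius_tail_sums[OF assms(1), of s] assms by (simp add: sums_iff)
qed

lemma moebius_head_holomorphic: "moebius_head z holomorphic_on A"
  unfolding moebius_head_def by (intro holomorphic_intros) auto

lemma moebius_tail_holomorphic:
  assumes "riemann_hypothesis"
  shows "moebius_tail z holomorphic_on {s. Re s > 1 / 2}"
  unfolding moebius_tail_def
  by (intro holomorphic_intros RH_zeta_inv_holomorphic assms moebius_head_holomorphic)

lemma norm_vertical_ge_half: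
  assumes "\<bar>Re s\<bar> \<ge> 1 / 2"
  shows "norm s \<ge> (1 + \<bar>Im s\<bar>) / 4"
  using abs_Re_le_cmod[of s] abs_Im_le_cmod[of s] assms by argo

lemma riesz_kernel_bound_half:
  assumes "\<bar>Re s\<bar> \<ge> 1 / 2" "\<bar>Re s + \<alpha>\<bar> \<ge> 1 / 2"
  shows "norm (1 / (s * (s + of_real \<alpha>))) \<le> 16 * (1 + \<bar>Im s\<bar>) powr -2"
proof -
  define r where "r = (1 + \<bar>Im s\<bar>) / 4"
  have r: "r > 0" by (simp add: r_def)
  have "r \<le> norm s" "r \<le> norm (s + of_real \<alpha>)"
    using norm_vertical_ge_half[of s] norm_vertical_ge_half[of "s + of_real \<alpha>"] assms by (auto simp: r_def)
  hence "1 / (norm s * norm (s + of_real \<alpha>)) \<le> 1 / (r * r)"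
    using r by (intro divide_left_mono mult_mono mult_pos_pos) auto
  also have "\<dots> = 16 * (1 + \<bar>Im s\<bar>) powr -2"
    unfolding r_def by (simp add: powr_minus powr_numeral power2_eq_square field_simps)
  finally show ?thesis by (simp add: norm_divide norm_mult)
qed

lemma one_plus_abs_add_powr:
  assumes "\<epsilon> \<ge> 0"
  shows "(1 + \<bar>a + b\<bar>) powr \<epsilon> \<le> (1 + \<bar>a\<bar>) powr \<epsilon> * (1 + \<bar>b :: real\<bar>) powr \<epsilon>"
proof -
  have "1 + \<bar>a + b\<bar> \<le> (1 + \<bar>a\<bar>) * (1 + \<bar>b\<bar>)"
  proof -
    have "(1 + \<bar>a\<bar>) * (1 + \<bar>b\<bar>) = 1 + \<bar>a\<bar> + \<bar>b\<bar> + \<bar>a\<bar> * \<bar>b\<bar>" by (simp add: algebra_simps)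
    moreover have "0 \<le> \<bar>a\<bar> * \<bar>b\<bar>" by (intro mult_nonneg_nonneg) auto
    ultimately show ?thesis using abs_triangle_ineq[of a b] by linarith
  qed
  hence "(1 + \<bar>a + b\<bar>) powr \<epsilon> \<le> ((1 + \<bar>a\<bar>) * (1 + \<bar>b\<bar>)) powr \<epsilon>"
    using assms by (intro powr_mono2) auto
  thus ?thesis by (simp add: powr_mult)
qed

text \<open>
  Up to a constant factor, \<open>moebius_head z s\<close> is by Perron's formula an integral over \<open>Re v = 1\<close> of
  \<open>zeta_inv (s + v) * z powr v / (v * (v + 2))\<close>. The pole at \<open>v = 0\<close> accounts for \<open>zeta_inv s\<close>, hence
  the tail is a multiple of the integral over \<open>Re v = -3 / 2\<close>, where \<open>Re (s + v) = 1 / 2 + \<theta>\<close>.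
\<close>
lemma RH_moebius_tail_bound:
  assumes RH: "riemann_hypothesis" and \<theta>: "0 < \<theta>" "\<theta> < 1 / 2" and \<epsilon>: "0 < \<epsilon>" "\<epsilon> \<le> 1 / 2"
  obtains C where "C \<ge> 0" "\<And>z s. z > 0 \<Longrightarrow> Re s = 2 + \<theta> \<Longrightarrow>
    norm (moebius_tail z s) \<le> C * z powr (-3/2) * (1 + \<bar>Im s\<bar>) powr \<epsilon>"
proof -
  obtain C where C: "C \<ge> 0" "\<And>s. Re s \<ge> 1 / 2 + \<theta> \<Longrightarrow> norm (zeta_inv s) \<le> C * (1 + \<bar>Im s\<bar>) powr \<epsilon>"
  proof -
    have "\<theta> < 1" using \<theta> by simp
    from RH_zeta_inv_bound[OF RH \<theta>(1) this \<epsilon>(1)] show ?thesis using that by metis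
  qed
  define J :: real where "J = (\<integral>t. (1 + \<bar>t\<bar>) powr (-3/2) \<partial>lborel)"
  have J_int: "integrable lborel (\<lambda>t::real. (1 + \<bar>t\<bar>) powr (-3/2))" by (rule integrable_majorant) simp
  have J0: "J \<ge> 0" unfolding J_def by (intro integral_nonneg_AE) auto
  have split: "(1 + \<bar>t\<bar>) powr \<epsilon> * (1 + \<bar>t\<bar>) powr -2 \<le> (1 + \<bar>t\<bar>) powr (-3/2)" for t :: real
    unfolding powr_add[symmetric] using \<epsilon> by (intro powr_mono) auto
  show thesis
  proof (rule that[of "C * 16 * J"])
    fix z :: real and s :: complex assume z: "z > 0" and s: "Re s = 2 + \<theta>"
    define X where "X = (1 + \<bar>Im s\<bar>) powr \<epsilon>"
    define h where "h = (\<lambda>v. zeta_inv (s + v) * (of_real z powr v / (v + of_real 2)))"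
    define F where "F = (\<lambda>v. zeta_inv (s + v) * (of_real z powr v / (v * (v + of_real 2))))"
    have hF: "h v / (v - 0) = F v" for v by (simp add: h_def F_def)
    have zi: "norm (zeta_inv (s + v)) \<le> C * (X * (1 + \<bar>Im v\<bar>) powr \<epsilon>)" if "Re v \<ge> -3/2" for v
    proof -
      have "norm (zeta_inv (s + v)) \<le> C * (1 + \<bar>Im (s + v)\<bar>) powr \<epsilon>"
        using s that by (intro C) simp
      also have "\<dots> \<le> C * (X * (1 + \<bar>Im v\<bar>) powr \<epsilon>)"
        unfolding X_def using one_plus_abs_add_powr[of \<epsilon> "Im s" "Im v"] C(1) \<epsilon> by (intro mult_left_mono) auto
      finally show ?thesis .
    qed
    define B where "B = 4 * (z powr (-3/2) + z powr 1)"
    have shift: "(\<integral>t. h (Complex 1 t) / (Complex 1 t - 0) \<partial>lborel) =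
           (\<integral>t. h (Complex (-3/2) t) / (Complex (-3/2) t - 0) \<partial>lborel) + 2 * pi * h 0"
    proof (rule contour_shift(3)[where S = "{v. Re v > -3/2 - \<theta>}" and e = "-3/2" and T = 1 and C = "C * X * B"])
      have "(\<lambda>v. zeta_inv (s + v)) holomorphic_on {v. Re v > -3/2 - \<theta>}"
        by (rule holomorphic_on_compose_gen[OF _ RH_zeta_inv_holomorphic[OF RH], of "\<lambda>v. s + v", unfolded o_def])
           (use s in \<open>auto intro!: holomorphic_intros\<close>)
      moreover have "v + of_real 2 \<noteq> 0" if "Re v > -3/2 - \<theta>" for v
        using that \<theta> by (auto simp: complex_eq_iff)
      ultimately show "h holomorphic_on {v. Re v > -3/2 - \<theta>}"
        unfolding h_def using z by (intro holomorphic_intros) auto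
      fix v assume v: "-3/2 \<le> Re v" "Re v \<le> 1" "1 \<le> \<bar>Im v\<bar>"
      have "norm (F v) \<le> (C * (X * (1 + \<bar>Im v\<bar>) powr \<epsilon>)) * (B * (1 + \<bar>Im v\<bar>) powr -2)"
        unfolding F_def norm_mult B_def using C(1) z v zi[of v]
          riesz_kernel_decay_strip[of z "-3/2" v 1 2] unfolding norm_mult
        by (intro mult_mono) (auto simp: X_def)
      also have "\<dots> = (C * X * B) * ((1 + \<bar>Im v\<bar>) powr \<epsilon> * (1 + \<bar>Im v\<bar>) powr -2)" by (simp add: mult_ac)
      also have "\<dots> \<le> (C * X * B) * (1 + \<bar>Im v\<bar>) powr (-3/2)"
        using C(1) by (intro mult_left_mono split) (auto simp: X_def B_def)
      finally show "norm (h v / (v - 0)) \<le> C * X * B * (1 + \<bar>Im v\<bar>) powr (-3/2)" unfolding hF .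
    qed (use \<theta> in auto)
    define a where "a = (\<lambda>n. of_int (moebius_mu (Suc n)) * of_nat (Suc n) powr (-s) :: complex)"
    have perron: "(\<lambda>k. a k * of_real (max 0 (1 - (real (Suc k) / z) powr 2))) sums
        (2 / (2 * pi) * (\<integral>t. zeta_inv (s + Complex 1 t) * (of_real z powr Complex 1 t / (Complex 1 t * (Complex 1 t + of_real 2))) \<partial>lborel))"
    proof (rule perron_riesz)
      show "summable (\<lambda>k. norm (a k) * real (Suc k) powr - 1)"
      proof (rule summable_comparison_test')
        show "summable (\<lambda>k. real (Suc k) powr - (2 + \<theta>))" by (rule summable_Suc_powr) (use \<theta> in simp)
        fix k
        have "norm (a k) \<le> 1 * real (Suc k) powr - (2 + \<theta>)"
          unfolding a_def norm_mult norm_nat_powr uminus_complex.sel s by (intro mult_right_mono norm_moebius_mu_le) auto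
        moreover have "real (Suc k) powr - 1 \<le> 1" by (simp add: powr_minus field_simps)
        ultimately have "norm (a k) * real (Suc k) powr - 1 \<le> (1 * real (Suc k) powr - (2 + \<theta>)) * 1"
          by (intro mult_mono) auto
        thus "norm (norm (a k) * real (Suc k) powr - 1) \<le> real (Suc k) powr - (2 + \<theta>)" by simp
      qed
      fix t
      have "(\<lambda>n. of_int (moebius_mu (Suc n)) * of_nat (Suc n) powr (-(s + Complex 1 t))) sums zeta_inv (s + Complex 1 t)"
        using s \<theta> by (intro zeta_inv_sums) simp
      also have "(\<lambda>n. of_int (moebius_mu (Suc n)) * of_nat (Suc n) powr (-(s + Complex 1 t))) =
                   (\<lambda>k. a k * of_real (real (Suc k)) powr (- Complex 1 t) :: complex)"
        by (intro ext) (simp add: a_def powr_diff powr_minus field_simps del: of_nat_Suc)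
      finally show "(\<lambda>k. a k * of_real (real (Suc k)) powr (- Complex 1 t)) sums zeta_inv (s + Complex 1 t)" .
    qed (use z in auto)
    have "(\<lambda>k. a k * of_real (max 0 (1 - (real (Suc k) / z) powr 2))) sums moebius_head z s"
      using moebius_head_sums[OF z, of s] z by (simp add: a_def cutoff_def powr_numeral mult_ac)
    hence "moebius_head z s = 2 / (2 * pi) * (\<integral>t. F (Complex 1 t) \<partial>lborel)"
      using perron sums_unique2 unfolding F_def by blast
    also have "\<dots> = 2 / (2 * pi) * ((\<integral>t. F (Complex (-3/2) t) \<partial>lborel) + 2 * pi * h 0)"
      using shift unfolding hF by simp
    also have "\<dots> = 1 / pi * (\<integral>t. F (Complex (-3/2) t) \<partial>lborel) + zeta_inv s"
      using z by (simp add: h_def field_simps)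
    finally have "moebius_tail z s = - (1 / pi * (\<integral>t. F (Complex (-3/2) t) \<partial>lborel))"
      by (simp add: moebius_tail_def)
    hence "norm (moebius_tail z s) = 1 / pi * norm (\<integral>t. F (Complex (-3/2) t) \<partial>lborel)"
      by (simp add: norm_mult norm_divide)
    also have "\<dots> \<le> 1 * norm (\<integral>t. F (Complex (-3/2) t) \<partial>lborel)"
      using pi_ge_two by (intro mult_right_mono) (auto simp: field_simps)
    also have "norm (\<integral>t. F (Complex (-3/2) t) \<partial>lborel) \<le> (\<integral>t. (C * 16 * X * z powr (-3/2)) * (1 + \<bar>t\<bar>) powr (-3/2) \<partial>lborel)"
    proof (cases "integrable lborel (\<lambda>t. F (Complex (-3/2) t))")
      case True
      show ?thesis
      proof (rule Bochner_Integration.integral_norm_bound_integral[OF True])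
        show "integrable lborel (\<lambda>t. (C * 16 * X * z powr (-3/2)) * (1 + \<bar>t\<bar>) powr (-3/2))"
          by (intro Bochner_Integration.integrable_mult_right J_int)
        fix t
        define v where "v = Complex (-3/2) t"
        have v: "Re v = -3/2" "Im v = t" by (simp_all add: v_def)
        have "norm (of_real z powr v / (v * (v + of_real 2))) \<le> z powr (-3/2) * (16 * (1 + \<bar>t\<bar>) powr -2)"
        proof -
          have "norm (of_real z powr v / (v * (v + of_real 2))) = z powr (-3/2) * norm (1 / (v * (v + of_real 2)))"
            using z v by (simp add: norm_divide norm_mult norm_powr_real_powr)
          also have "\<dots> \<le> z powr (-3/2) * (16 * (1 + \<bar>t\<bar>) powr -2)"
            using riesz_kernel_bound_half[of v 2] v by (intro mult_left_mono) auto
          finally show ?thesis .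
        qed
        hence "norm (F v) \<le> (C * (X * (1 + \<bar>t\<bar>) powr \<epsilon>)) * (z powr (-3/2) * (16 * (1 + \<bar>t\<bar>) powr -2))"
          unfolding F_def norm_mult using zi[of v] v C(1) unfolding norm_mult by (intro mult_mono) (auto simp: X_def)
        also have "\<dots> = (C * 16 * X * z powr (-3/2)) * ((1 + \<bar>t\<bar>) powr \<epsilon> * (1 + \<bar>t\<bar>) powr -2)"
          by (simp add: mult_ac)
        also have "\<dots> \<le> (C * 16 * X * z powr (-3/2)) * (1 + \<bar>t\<bar>) powr (-3/2)"
          using C(1) by (intro mult_left_mono split) (auto simp: X_def)
        finally show "norm (F (Complex (-3/2) t)) \<le> (C * 16 * X * z powr (-3/2)) * (1 + \<bar>t\<bar>) powr (-3/2)"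
          by (simp only: v_def)
      qed
    next
      case False
      thus ?thesis using C(1) by (auto simp: not_integrable_integral_eq X_def intro!: integral_nonneg_AE mult_nonneg_nonneg)
    qed
    also have "\<dots> = (C * 16 * X * z powr (-3/2)) * J" by (simp add: J_def)
    finally show "norm (moebius_tail z s) \<le> C * 16 * J * z powr (-3/2) * (1 + \<bar>Im s\<bar>) powr \<epsilon>"
      by (simp add: X_def mult_ac)
  qed (use C(1) J0 in auto)
qed

section \<open>Smoothly weighted pairs\<close>

text \<open>
  \<open>perron_riesz\<close> is about sequences, so the pairs of positive integers are enumerated by one index.
\<close>
definition pair_n :: "nat \<Rightarrow> nat" where "pair_n k = Suc (fst (prod_decode k))"
definition pair_d :: "nat \<Rightarrow> nat" where "pair_d k = Suc (snd (prod_decode k))"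

definition tail_coeff :: "real \<Rightarrow> nat \<Rightarrow> real" where
  "tail_coeff z d = of_int (moebius_mu d) * (1 - cutoff z d)"

lemma of_real_pow4_powr:
  assumes "x > 0"
  shows "complex_of_real (x ^ 4) powr w = of_real x powr (4 * w)"
proof -
  have "Ln (complex_of_real (x ^ 4)) = of_real (ln (x ^ 4))"
    using assms by (intro Ln_of_real) simp
  also have "\<dots> = 4 * Ln (complex_of_real x)"
    using assms by (simp add: ln_realpow Ln_of_real)
  finally show ?thesis using assms by (simp add: powr_def mult_ac del: of_real_power)
qed

lemma has_sum_prod_decode:
  assumes "(f has_sum S) UNIV"
  shows "((\<lambda>k. f (prod_decode k)) has_sum S) UNIV"
  using has_sum_reindex_bij_betw[OF bij_prod_decode, of f S] assms by simp

lemma zeta_moebius_tail_pairs: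
  assumes z: "z > 0" and s: "Re s > 1"
  shows "summable (\<lambda>k. norm (complex_of_real (tail_coeff z (pair_d k))) * real (pair_n k * pair_d k ^ 4) powr (- Re s))"
    and "(\<lambda>k. of_real (tail_coeff z (pair_d k)) * of_real (real (pair_n k * pair_d k ^ 4)) powr (-s)) sums
           (zeta s * moebius_tail z (4 * s))"
proof -
  define f where "f = (\<lambda>n. of_nat (Suc n) powr (-s) :: complex)"
  define g where "g = (\<lambda>n. of_int (moebius_mu (Suc n)) * of_real (1 - cutoff z (Suc n)) * of_nat (Suc n) powr (-(4 * s)) :: complex)"
  have s4: "Re (4 * s) > 1" using s by simp
  have fn: "summable (\<lambda>n. norm (f n))"
    unfolding f_def norm_nat_powr uminus_complex.sel by (rule summable_Suc_powr[OF s])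
  have gn: "summable (\<lambda>n. norm (g n))"
  proof (rule summable_comparison_test'[OF summable_Suc_powr[OF s4]])
    show "norm (norm (g n)) \<le> real (Suc n) powr - Re (4 * s)" for n
      unfolding real_norm_def abs_norm_cancel g_def by (rule norm_tail_term)
  qed
  have fs: "f sums zeta s" unfolding f_def by (rule zeta_sums[OF s])
  have gs: "g sums moebius_tail z (4 * s)" unfolding g_def by (rule moebius_tail_sums[OF z s4])
  have "infsum f UNIV = zeta s" using norm_summable_imp_has_sum[OF fn fs] by (rule infsumI)
  moreover have "infsum g UNIV = moebius_tail z (4 * s)" using norm_summable_imp_has_sum[OF gn gs] by (rule infsumI)
  ultimately have hs: "((\<lambda>z. f (fst z) * g (snd z)) has_sum (zeta s * moebius_tail z (4 * s))) (UNIV \<times> UNIV)"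
    and sm: "(\<lambda>z. norm (f (fst z) * g (snd z))) summable_on UNIV \<times> UNIV"
    using has_sum_Times[of f UNIV g UNIV] fn gn by (simp_all add: summable_on_UNIV_nonneg_real_iff)
  have eq: "f (fst (prod_decode k)) * g (snd (prod_decode k)) =
          of_real (tail_coeff z (pair_d k)) * of_real (real (pair_n k * pair_d k ^ 4)) powr (-s)" for k
  proof -
    have "complex_of_real (real (pair_n k * pair_d k ^ 4)) powr (-s) =
            of_real (real (pair_n k)) powr (-s) * of_real (real (pair_d k) ^ 4) powr (-s)"
      unfolding of_nat_mult of_nat_power of_real_mult by (intro powr_times_real) auto
    also have "complex_of_real (real (pair_d k) ^ 4) powr (-s) = of_real (real (pair_d k)) powr (4 * (-s))"
      by (rule of_real_pow4_powr) (simp add: pair_d_def)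
    finally show ?thesis
      by (simp add: f_def g_def tail_coeff_def pair_n_def pair_d_def mult_ac del: of_nat_Suc)
  qed
  show "(\<lambda>k. of_real (tail_coeff z (pair_d k)) * of_real (real (pair_n k * pair_d k ^ 4)) powr (-s)) sums
           (zeta s * moebius_tail z (4 * s))"
    using has_sum_imp_sums[OF has_sum_prod_decode[OF hs[simplified]]] by (simp only: eq)
  obtain T where "((\<lambda>z. norm (f (fst z) * g (snd z))) has_sum T) UNIV"
    using sm by (auto simp: summable_on_def)
  from has_sum_imp_sums[OF has_sum_prod_decode[OF this]]
  have "(\<lambda>k. norm (of_real (tail_coeff z (pair_d k)) * of_real (real (pair_n k * pair_d k ^ 4)) powr (-s) :: complex)) sums T"
    by (simp only: eq)
  moreover have "norm (of_real (real (pair_n k * pair_d k ^ 4)) powr (-s) :: complex) = real (pair_n k * pair_d k ^ 4) powr (- Re s)" for k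
    by (subst norm_powr_real_powr) auto
  ultimately show "summable (\<lambda>k. norm (complex_of_real (tail_coeff z (pair_d k))) * real (pair_n k * pair_d k ^ 4) powr (- Re s))"
    unfolding norm_mult by (simp only: sums_summable)
qed

text \<open>
  The mean value theorem saves a factor \<open>N\<close> but loses a power of the decay in \<open>Im s\<close>; the triangle
  inequality does the opposite. The geometric mean of both bounds with exponents \<open>1 - \<eta>\<close> and \<open>\<eta>\<close> is integrable
  along the line and costs only \<open>N powr \<eta>\<close>.
\<close>
lemma riesz_difference_bound:
  fixes N \<eta> :: real
  assumes N: "N > 0" and \<eta>: "0 < \<eta>" "\<eta> \<le> 1" and s: "Re s \<ge> 1 / 2"
  shows "norm ((of_real (N + 1) powr (s + 1) - of_real N powr (s + 1)) / (s * (s + 1))) \<le>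
           32 * (N + 1) powr (Re s + \<eta>) * (1 + \<bar>Im s\<bar>) powr (-1 - \<eta>)"
proof -
  define \<sigma> where "\<sigma> = Re s"
  define A where "A = norm (of_real (N + 1) powr (s + 1) - of_real N powr (s + 1))"
  define M where "M = N + 1"
  have M: "M > 0" using N by (simp add: M_def)
  define r where "r = (1 + \<bar>Im s\<bar>) / 4"
  have r: "r > 0" by (simp add: r_def)
  have rs: "r \<le> norm s" "r \<le> norm (s + 1)"
    using norm_vertical_ge_half[of s] norm_vertical_ge_half[of "s + 1"] s by (auto simp: r_def)
  have "A \<le> norm (s + 1) * M powr \<sigma> * (N + 1 - N)"
    unfolding A_def \<sigma>_def M_def using N s by (intro powr_diff_bound) (auto intro!: powr_mono2)
  hence A1: "A \<le> norm (s + 1) * M powr \<sigma>" by simp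
  have A2: "A \<le> 2 * M powr (\<sigma> + 1)"
  proof -
    have "A \<le> (N + 1) powr (\<sigma> + 1) + N powr (\<sigma> + 1)"
    proof -
      have "norm (complex_of_real x powr (s + 1)) = x powr (\<sigma> + 1)" if "x > 0" for x
        using that by (subst norm_powr_real_powr) (auto simp: \<sigma>_def)
      thus ?thesis unfolding A_def
        using N norm_triangle_ineq4[of "of_real (N + 1) powr (s + 1)" "of_real N powr (s + 1)"] by (simp del: of_real_add)
    qed
    also have "N powr (\<sigma> + 1) \<le> (N + 1) powr (\<sigma> + 1)" using N s by (intro powr_mono2) (auto simp: \<sigma>_def)
    finally show ?thesis by (simp add: M_def)
  qed
  have A0: "A \<ge> 0" by (simp add: A_def)
  have "A = A powr (1 - \<eta>) * A powr \<eta>" using A0 by (simp flip: powr_add)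
  also have "\<dots> \<le> (norm (s + 1) * M powr \<sigma>) powr (1 - \<eta>) * (2 * M powr (\<sigma> + 1)) powr \<eta>"
    using A0 A1 A2 \<eta> by (intro mult_mono powr_mono2) auto
  also have "\<dots> = norm (s + 1) powr (1 - \<eta>) * 2 powr \<eta> * M powr (\<sigma> * (1 - \<eta>) + (\<sigma> + 1) * \<eta>)"
    unfolding powr_add[of M "\<sigma> * (1 - \<eta>)"] using M by (simp add: powr_mult powr_powr)
  also have "\<sigma> * (1 - \<eta>) + (\<sigma> + 1) * \<eta> = \<sigma> + \<eta>" by (simp add: algebra_simps)
  finally have A3: "A \<le> norm (s + 1) powr (1 - \<eta>) * 2 powr \<eta> * M powr (\<sigma> + \<eta>)" .
  have "A / (norm s * norm (s + 1)) \<le> norm (s + 1) powr (1 - \<eta>) * 2 powr \<eta> * M powr (\<sigma> + \<eta>) / (norm s * norm (s + 1))"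
    using A3 by (intro divide_right_mono) auto
  also have "\<dots> = (norm (s + 1) powr (-\<eta>) * norm s powr (-1)) * (2 powr \<eta> * M powr (\<sigma> + \<eta>))"
    using rs r by (simp add: powr_diff powr_minus field_simps)
  also have "\<dots> \<le> (r powr (-\<eta>) * r powr (-1)) * (2 powr 1 * M powr (\<sigma> + \<eta>))"
  proof -
    have two: "2 powr \<eta> \<le> (2::real) powr 1" using \<eta> by (intro powr_mono) auto
    show ?thesis by (intro mult_mono powr_mono2' two order_refl) (use rs r \<eta> in auto)
  qed
  also have "r powr (-\<eta>) * r powr (-1) = r powr (-1 - \<eta>)"
    using powr_add[of r "-\<eta>" "-1"] by (simp add: add.commute)
  also have "\<dots> = (1 + \<bar>Im s\<bar>) powr (-1 - \<eta>) * 4 powr (1 + \<eta>)"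
    unfolding r_def by (subst powr_divide) (auto simp: powr_diff powr_minus powr_add field_simps)
  also have "\<dots> \<le> (1 + \<bar>Im s\<bar>) powr (-1 - \<eta>) * 4 powr 2"
    using \<eta> by (intro mult_left_mono powr_mono) auto
  finally have "A / (norm s * norm (s + 1)) \<le> (1 + \<bar>Im s\<bar>) powr (-1 - \<eta>) * 4 powr 2 * (2 powr 1 * M powr (\<sigma> + \<eta>))"
    by (simp add: mult_right_mono)
  thus ?thesis by (simp add: A_def M_def \<sigma>_def norm_divide norm_mult mult_ac)
qed

text \<open>
  Perron's formula for \<open>zeta s * moebius_tail z (4 * s)\<close> on \<open>Re s = 2\<close>, shifted across the pole
  of zeta at 1.
\<close>
lemma RH_tail_pairs_integral:
  fixes F :: "complex \<Rightarrow> complex"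
  assumes RH: "riemann_hypothesis" and \<delta>: "0 < \<delta>" "\<delta> < 1 / 2" and z: "z > 0" and x: "x > 0"
  defines "F \<equiv> (\<lambda>s. zeta s * moebius_tail z (4 * s) * (of_real x powr s / (s * (s + 1))))"
  shows "integrable lborel (\<lambda>t. F (Complex (1 / 2 + \<delta>) t))"
    and "(\<lambda>k. of_real (tail_coeff z (pair_d k)) * of_real (max 0 (1 - real (pair_n k * pair_d k ^ 4) / x))) sums
           (1 / (2 * pi) * (\<integral>t. F (Complex (1 / 2 + \<delta>) t) \<partial>lborel) + moebius_tail z 4 * x / 2)"
proof -
  define \<sigma> where "\<sigma> = 1 / 2 + \<delta>"
  define h where "h = (\<lambda>s. zeta_reg s * moebius_tail z (4 * s) * (of_real x powr s / (s * (s + 1))))"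
  have hF: "h s / (s - 1) = F s" if "s \<noteq> 1" for s using that by (simp add: h_def F_def zeta_reg_def)
  obtain C where C: "C \<ge> 0" "\<And>s. Re s \<ge> 1 / 2 + \<delta> \<Longrightarrow> \<bar>Im s\<bar> \<ge> 2 \<Longrightarrow> norm (zeta s) \<le> C * (1 + \<bar>Im s\<bar>) powr (1/2)"
  proof -
    have "\<delta> < 1" "(1/2::real) > 0" using \<delta> by auto
    from RH_zeta_bounds[OF RH \<delta>(1) this] show ?thesis using that by metis
  qed
  define K where "K = (\<Sum>n. real (Suc n) powr (- (2 + 4 * \<delta>)))"
  have K: "norm (moebius_tail z (4 * s)) \<le> K" if "Re s \<ge> \<sigma>" for s
    unfolding K_def by (rule norm_moebius_tail_le[OF z]) (use that \<delta> in \<open>auto simp: \<sigma>_def\<close>)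
  have K0: "K \<ge> 0" using order.trans[OF norm_ge_zero K[of "of_real \<sigma>"]] by simp
  define B where "B = 4 * (x powr \<sigma> + x powr 2)"
  note shift = contour_shift[where h = h and p = 1 and a = \<sigma> and b = 2 and S = "{s. Re s > 1 / 2}"
        and e = "-3/2" and T = 2 and C = "C * K * B"]
  have holo: "h holomorphic_on {s. Re s > 1 / 2}"
  proof -
    have "(\<lambda>s. moebius_tail z (4 * s)) holomorphic_on {s. Re s > 1 / 2}"
      by (rule holomorphic_on_compose_gen[OF _ moebius_tail_holomorphic[OF RH], of "\<lambda>s. 4 * s", unfolded o_def])
         (auto intro!: holomorphic_intros)
    moreover have "s \<noteq> 0" "s + 1 \<noteq> 0" if "Re s > 1 / 2" for s
      using that by (auto simp: complex_eq_iff)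
    ultimately show ?thesis
      unfolding h_def using x
      by (intro holomorphic_intros holomorphic_on_subset[OF zeta_reg_holomorphic]) auto
  qed
  have bound: "norm (h s / (s - 1)) \<le> C * K * B * (1 + \<bar>Im s\<bar>) powr (-3/2)"
    if s: "\<sigma> \<le> Re s" "Re s \<le> 2" "\<bar>Im s\<bar> \<ge> 2" for s
  proof -
    have s1: "s \<noteq> 1" using s by auto
    have "norm (of_real x powr s / (s * (s + of_real 1))) \<le> B * (1 + \<bar>Im s\<bar>) powr -2"
      unfolding B_def by (rule riesz_kernel_decay_strip) (use s x in auto)
    hence "norm (F s) \<le> (C * (1 + \<bar>Im s\<bar>) powr (1/2)) * K * (B * (1 + \<bar>Im s\<bar>) powr -2)"
      unfolding F_def norm_mult using C K[OF s(1)] K0 s unfolding norm_mult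
      by (intro mult_mono) (auto simp: \<sigma>_def)
    also have "\<dots> = C * K * B * ((1 + \<bar>Im s\<bar>) powr (1/2) * (1 + \<bar>Im s\<bar>) powr -2)" by (simp add: mult_ac)
    also have "(1 + \<bar>Im s\<bar>) powr (1/2) * (1 + \<bar>Im s\<bar>) powr -2 = (1 + \<bar>Im s\<bar>) powr (-3/2)"
      by (simp flip: powr_add)
    finally show ?thesis by (simp add: hF[OF s1])
  qed
  have line: "Complex \<sigma> t \<noteq> 1" "Complex 2 t \<noteq> 1" for t using \<delta> by (auto simp: complex_eq_iff \<sigma>_def)
  have "integrable lborel (\<lambda>t. h (Complex \<sigma> t) / (Complex \<sigma> t - 1))"
    by (rule shift(1)[OF holo _ _ _ _ bound]) (use \<delta> in \<open>auto simp: \<sigma>_def\<close>)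
  thus "integrable lborel (\<lambda>t. F (Complex (1 / 2 + \<delta>) t))"
    by (simp add: hF[OF line(1)] \<sigma>_def[symmetric])
  have "(\<integral>t. h (Complex 2 t) / (Complex 2 t - 1) \<partial>lborel) =
          (\<integral>t. h (Complex \<sigma> t) / (Complex \<sigma> t - 1) \<partial>lborel) + 2 * pi * h 1"
    by (rule shift(3)[OF holo _ _ _ _ bound]) (use \<delta> in \<open>auto simp: \<sigma>_def\<close>)
  hence eq: "(\<integral>t. F (Complex 2 t) \<partial>lborel) = (\<integral>t. F (Complex \<sigma> t) \<partial>lborel) + 2 * pi * (moebius_tail z 4 * x / 2)"
  proof -
    have "h 1 = moebius_tail z 4 * x / 2" using x by (simp add: h_def zeta_reg_def)
    with \<open>(\<integral>t. h (Complex 2 t) / (Complex 2 t - 1) \<partial>lborel) = _\<close> show ?thesis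
      unfolding hF[OF line(1)] hF[OF line(2)] by simp
  qed
  have "(\<lambda>k. of_real (tail_coeff z (pair_d k)) * of_real (max 0 (1 - (real (pair_n k * pair_d k ^ 4) / x) powr 1))) sums
          (1 / (2 * pi) * (\<integral>t. (zeta (Complex 2 t) * moebius_tail z (4 * Complex 2 t)) *
             (of_real x powr Complex 2 t / (Complex 2 t * (Complex 2 t + of_real 1))) \<partial>lborel))"
  proof (rule perron_riesz)
    show "real (pair_n k * pair_d k ^ 4) > 0" for k
      unfolding of_nat_0_less_iff by (simp add: pair_n_def pair_d_def)
    show "summable (\<lambda>k. norm (complex_of_real (tail_coeff z (pair_d k))) * real (pair_n k * pair_d k ^ 4) powr - 2)"
      using zeta_moebius_tail_pairs(1)[OF z, of "Complex 2 0"] by simp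
    show "(\<lambda>k. of_real (tail_coeff z (pair_d k)) * of_real (real (pair_n k * pair_d k ^ 4)) powr (- Complex 2 t)) sums
             (zeta (Complex 2 t) * moebius_tail z (4 * Complex 2 t))" for t
      by (rule zeta_moebius_tail_pairs(2)[OF z]) simp
  qed (use x in auto)
  also have "(\<integral>t. (zeta (Complex 2 t) * moebius_tail z (4 * Complex 2 t)) *
             (of_real x powr Complex 2 t / (Complex 2 t * (Complex 2 t + of_real 1))) \<partial>lborel) = (\<integral>t. F (Complex 2 t) \<partial>lborel)"
    by (simp add: F_def)
  also have "1 / (2 * pi) * \<dots> = 1 / (2 * pi) * (\<integral>t. F (Complex \<sigma> t) \<partial>lborel) + moebius_tail z 4 * x / 2"
    unfolding eq by (simp add: field_simps)
  finally show "(\<lambda>k. of_real (tail_coeff z (pair_d k)) * of_real (max 0 (1 - real (pair_n k * pair_d k ^ 4) / x))) sums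
           (1 / (2 * pi) * (\<integral>t. F (Complex (1 / 2 + \<delta>) t) \<partial>lborel) + moebius_tail z 4 * x / 2)"
    using x by (simp add: \<sigma>_def)
qed

text \<open>
  The previous lemma at \<open>x = N + 1\<close> and \<open>x = N\<close>. For integers \<open>m\<close>,
  \<open>max 0 (N + 1 - m) - max 0 (N - m)\<close> is 1 or 0 according as \<open>m \<le> N\<close> or not, so the difference of
  the Riesz means is the sharp sum over \<open>n * d ^ 4 \<le> N\<close>. The difference of the integrands is bounded
  by \<open>riesz_difference_bound\<close>.
\<close>
lemma RH_tail_pairs_asymptotics:
  assumes RH: "riemann_hypothesis" and \<delta>: "0 < \<delta>" "\<delta> < 1 / 8" and \<eta>: "0 < \<eta>" "\<eta> \<le> 1"
  obtains C where "C \<ge> 0" "\<And>z N. z > 0 \<Longrightarrow> N > 0 \<Longrightarrow> \<exists>W.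
    (\<lambda>k. of_real (tail_coeff z (pair_d k)) * (if pair_n k * pair_d k ^ 4 \<le> N then 1 else 0)) sums W \<and>
    norm (W - of_nat N * moebius_tail z 4) \<le> C * (1 + (real N + 1) powr (1 / 2 + \<delta> + \<eta>) * z powr (-3/2))"
proof -
  define \<sigma> where "\<sigma> = 1 / 2 + \<delta>"
  \<comment> \<open>Spending \<open>\<eta> / 4\<close> on zeta and on the tail leaves the integrable exponent \<open>-1 - \<eta> / 2\<close>.\<close>
  have \<eta>4: "0 < \<eta> / 4" "\<eta> / 4 \<le> 1 / 2" and \<delta>2: "\<delta> < 1 / 2" and \<theta>: "0 < 4 * \<delta>" "4 * \<delta> < 1 / 2" using \<eta> \<delta> by auto
  obtain C1 where C1: "C1 \<ge> 0" "\<And>t. norm (zeta (Complex \<sigma> t)) \<le> C1 * (1 + \<bar>t\<bar>) powr (\<eta> / 4)"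
    using RH_zeta_line_bound[OF RH \<delta>(1) \<delta>2 \<eta>4(1)] unfolding \<sigma>_def by metis
  obtain C2 where C2: "C2 \<ge> 0" "\<And>z s. z > 0 \<Longrightarrow> Re s = 2 + 4 * \<delta> \<Longrightarrow>
    norm (moebius_tail z s) \<le> C2 * z powr (-3/2) * (1 + \<bar>Im s\<bar>) powr (\<eta> / 4)"
    using RH_moebius_tail_bound[OF RH \<theta> \<eta>4] by metis
  define e where "e = -1 - \<eta> / 2"
  define J :: real where "J = (\<integral>t. (1 + \<bar>t\<bar>) powr e \<partial>lborel)"
  have J_int: "integrable lborel (\<lambda>t::real. (1 + \<bar>t\<bar>) powr e)"
    by (rule integrable_majorant) (use \<eta> in \<open>simp add: e_def\<close>)
  have J0: "J \<ge> 0" unfolding J_def by (intro integral_nonneg_AE) auto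
  define K where "K = (\<Sum>n. real (Suc n) powr (- 4))"
  have K: "norm (moebius_tail z 4) \<le> K" if "z > 0" for z
    unfolding K_def by (rule norm_moebius_tail_le[OF that]) auto
  have K0: "K \<ge> 0" using order.trans[OF norm_ge_zero K[of 1]] by simp
  define C3 where "C3 = C1 * C2 * 4 * 32"
  have C3: "C3 \<ge> 0" using C1 C2 by (simp add: C3_def)
  show thesis
  proof (rule that[of "K + C3 * J"])
    fix z :: real and N :: nat assume z: "z > 0" and N: "N > 0"
    let ?a = "\<lambda>k. complex_of_real (tail_coeff z (pair_d k))" and ?l = "\<lambda>k. real (pair_n k * pair_d k ^ 4)"
    define P where "P = (real N + 1) powr (1 / 2 + \<delta> + \<eta>) * z powr (-3/2)"
    define F where "F = (\<lambda>x s. zeta s * moebius_tail z (4 * s) * (of_real x powr s / (s * (s + 1))))"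
    define I where "I = (\<lambda>x. (\<integral>t. F x (Complex \<sigma> t) \<partial>lborel))"
    define x0 where "x0 = real N"
    define x1 where "x1 = real N + 1"
    have x: "x0 > 0" "x1 > 0" using N by (auto simp: x0_def x1_def)
    have int: "integrable lborel (\<lambda>t. F x (Complex \<sigma> t))"
      and sums: "(\<lambda>k. ?a k * of_real (max 0 (1 - ?l k / x))) sums
           (1 / (2 * pi) * I x + moebius_tail z 4 * x / 2)" if "x > 0" for x
      using RH_tail_pairs_integral[OF RH \<delta>(1) \<delta>2 z that] unfolding F_def I_def \<sigma>_def by auto
    define W where "W = of_real x1 * (1 / (2 * pi) * I x1 + moebius_tail z 4 * x1 / 2) -
                        of_real x0 * (1 / (2 * pi) * I x0 + moebius_tail z 4 * x0 / 2)"
    have "(\<lambda>k. of_real x1 * (?a k * of_real (max 0 (1 - ?l k / x1))) -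
               of_real x0 * (?a k * of_real (max 0 (1 - ?l k / x0)))) sums W"
      unfolding W_def by (intro sums_diff sums_mult sums x)
    also have "(\<lambda>k. of_real x1 * (?a k * of_real (max 0 (1 - ?l k / x1))) -
               of_real x0 * (?a k * of_real (max 0 (1 - ?l k / x0)))) =
            (\<lambda>k. ?a k * (if pair_n k * pair_d k ^ 4 \<le> N then 1 else 0) :: complex)"
    proof
      fix k
      define m where "m = pair_n k * pair_d k ^ 4"
      have "x1 * max 0 (1 - real m / x1) - x0 * max 0 (1 - real m / x0) = (if m \<le> N then 1 else 0)"
      proof (cases "m \<le> N")
        case True
        have *: "x * max 0 (1 - real m / x) = x - real m" if "x > 0" "real m \<le> x" for x
          using that by (simp add: max_def field_simps)
        show ?thesis using *[of x0] *[of x1] x True by (simp add: x0_def x1_def)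
      next
        case False
        hence "real m / x1 \<ge> 1" "real m / x0 \<ge> 1" using N by (auto simp: x0_def x1_def field_simps)
        thus ?thesis using False by simp
      qed
      from arg_cong[OF this, of complex_of_real]
      have key: "of_real x1 * of_real (max 0 (1 - real m / x1)) - of_real x0 * of_real (max 0 (1 - real m / x0)) = (if m \<le> N then 1 else 0 :: complex)"
        by (simp only: of_real_diff of_real_mult) simp
      have "of_real x1 * (t * u) - of_real x0 * (t * v) = t * (of_real x1 * u - of_real x0 * v)" for t u v :: complex
        by (simp add: algebra_simps)
      thus "of_real x1 * (?a k * of_real (max 0 (1 - ?l k / x1))) -
               of_real x0 * (?a k * of_real (max 0 (1 - ?l k / x0))) =
            ?a k * (if pair_n k * pair_d k ^ 4 \<le> N then 1 else 0 :: complex)"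
        unfolding m_def[symmetric] by (simp only: key)
    qed
    finally have Wsums: "(\<lambda>k. ?a k * (if pair_n k * pair_d k ^ 4 \<le> N then 1 else 0)) sums W" .
    define D where "D = of_real x1 * I x1 - of_real x0 * I x0"
    have "W = 1 / (2 * pi) * D + moebius_tail z 4 * ((x1 ^ 2 - x0 ^ 2) / 2)"
      by (simp add: W_def D_def power2_eq_square algebra_simps diff_divide_distrib)
    also have "complex_of_real ((x1 ^ 2 - x0 ^ 2) / 2) = of_nat N + 1 / 2"
      by (simp add: x0_def x1_def power2_eq_square algebra_simps add_divide_distrib)
    finally have Weq: "W - of_nat N * moebius_tail z 4 = 1 / (2 * pi) * D + moebius_tail z 4 * (1 / 2)"
      by (simp add: algebra_simps)
    have "D = (\<integral>t. of_real x1 * F x1 (Complex \<sigma> t) - of_real x0 * F x0 (Complex \<sigma> t) \<partial>lborel)"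
      unfolding D_def I_def using int[OF x(1)] int[OF x(2)]
      by (subst Bochner_Integration.integral_diff) auto
    also have "norm \<dots> \<le> (\<integral>t. C3 * P * (1 + \<bar>t\<bar>) powr e \<partial>lborel)"
    proof (rule Bochner_Integration.integral_norm_bound_integral)
      show "complex_integrable lborel (\<lambda>t. of_real x1 * F x1 (Complex \<sigma> t) - of_real x0 * F x0 (Complex \<sigma> t))"
        by (intro Bochner_Integration.integrable_diff Bochner_Integration.integrable_mult_right int x)
      show "integrable lborel (\<lambda>t. C3 * P * (1 + \<bar>t\<bar>) powr e)"
        by (intro Bochner_Integration.integrable_mult_right J_int)
      fix t :: real
      define s where "s = Complex \<sigma> t"
      have s: "Re s = \<sigma>" "Im s = t" by (simp_all add: s_def)
      define Y where "Y = 1 + \<bar>t\<bar>"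
      have Y: "Y > 0" by (simp add: Y_def)
      have "of_real x1 * F x1 s - of_real x0 * F x0 s = zeta s * moebius_tail z (4 * s) *
              ((of_real x1 powr (s + 1) - of_real x0 powr (s + 1)) / (s * (s + 1)))"
      proof -
        have "of_real x powr (s + 1) = of_real x * of_real x powr s" if "x > 0" for x
          using that by (simp add: powr_add mult.commute)
        hence p: "of_real x1 powr (s + 1) = of_real x1 * of_real x1 powr s"
          "of_real x0 powr (s + 1) = of_real x0 * of_real x0 powr s" using x by simp_all
        have "a * (Z * (u / q)) - b * (Z * (v / q)) = Z * ((a * u - b * v) / q)" for a b Z u v q :: complex
          by (simp add: right_diff_distrib diff_divide_distrib mult_ac)
        thus ?thesis unfolding F_def p .
      qed
      also have "norm \<dots> \<le> (C1 * Y powr (\<eta> / 4)) * (C2 * z powr (-3/2) * (4 * Y powr (\<eta> / 4))) *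
                   (32 * (real N + 1) powr (1 / 2 + \<delta> + \<eta>) * Y powr (-1 - \<eta>))"
      proof -
        have b1: "norm (zeta s) \<le> C1 * Y powr (\<eta> / 4)" using C1(2)[of t] by (simp add: s_def Y_def)
        have b2: "norm (moebius_tail z (4 * s)) \<le> C2 * z powr (-3/2) * (4 * Y powr (\<eta> / 4))"
        proof -
          have "norm (moebius_tail z (4 * s)) \<le> C2 * z powr (-3/2) * (1 + \<bar>Im (4 * s)\<bar>) powr (\<eta> / 4)"
            by (rule C2(2)[OF z]) (simp add: s \<sigma>_def)
          also have "(1 + \<bar>Im (4 * s)\<bar>) powr (\<eta> / 4) \<le> (4 * Y) powr (\<eta> / 4)"
            using \<eta> by (intro powr_mono2) (auto simp: s Y_def abs_mult)
          also have "\<dots> = 4 powr (\<eta> / 4) * Y powr (\<eta> / 4)" using Y by (simp add: powr_mult)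
          also have "\<dots> \<le> 4 powr 1 * Y powr (\<eta> / 4)" using \<eta> by (intro mult_right_mono powr_mono) auto
          finally show ?thesis using C2(1) by (simp add: mult_left_mono)
        qed
        have b3: "norm ((of_real x1 powr (s + 1) - of_real x0 powr (s + 1)) / (s * (s + 1))) \<le>
                  32 * (real N + 1) powr (1 / 2 + \<delta> + \<eta>) * Y powr (-1 - \<eta>)"
          using riesz_difference_bound[of x0 \<eta> s] x \<eta> \<delta> s by (simp add: x0_def x1_def Y_def \<sigma>_def)
        show ?thesis unfolding norm_mult[of "zeta s * moebius_tail z (4 * s)"] norm_mult[of "zeta s"]
          using b1 b2 b3 C1(1) C2(1) by (intro mult_mono mult_nonneg_nonneg) auto
      qed
      also have "\<dots> = C3 * P * (Y powr (\<eta> / 4) * Y powr (\<eta> / 4) * Y powr (-1 - \<eta>))"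
        by (simp add: C3_def P_def mult_ac)
      also have "Y powr (\<eta> / 4) * Y powr (\<eta> / 4) * Y powr (-1 - \<eta>) = Y powr e"
      proof -
        have "\<eta> / 4 + \<eta> / 4 + (-1 - \<eta>) = e" by (simp add: e_def)
        thus ?thesis by (simp only: powr_add[symmetric])
      qed
      finally show "norm (of_real x1 * F x1 (Complex \<sigma> t) - of_real x0 * F x0 (Complex \<sigma> t)) \<le> C3 * P * (1 + \<bar>t\<bar>) powr e"
        by (simp only: s_def Y_def)
    qed
    also have "\<dots> = C3 * P * J" by (simp add: J_def)
    finally have D: "norm D \<le> C3 * J * P" by (simp add: mult_ac)
    have "norm (W - of_nat N * moebius_tail z 4) \<le> norm (1 / (2 * pi) * D) + norm (moebius_tail z 4 * (1 / 2))"
      unfolding Weq by (rule norm_triangle_ineq)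
    moreover have "norm (1 / (2 * pi) * D) \<le> 1 * norm D"
      unfolding norm_mult using pi_ge_two by (intro mult_right_mono) (auto simp: norm_divide norm_mult field_simps)
    moreover have "norm (moebius_tail z 4 * (1 / 2)) \<le> K" using K[OF z] K0 by (simp add: norm_mult)
    moreover have "1 * norm D + K \<le> (K + C3 * J) * (1 + P)"
    proof -
      have "P \<ge> 0" by (simp add: P_def)
      hence "0 \<le> K * P" "0 \<le> C3 * J" using K0 C3 J0 by simp_all
      thus ?thesis using D by (simp add: algebra_simps)
    qed
    ultimately have "norm (W - of_nat N * moebius_tail z 4) \<le> (K + C3 * J) * (1 + P)" by linarith
    thus "\<exists>W. (\<lambda>k. ?a k * (if pair_n k * pair_d k ^ 4 \<le> N then 1 else 0)) sums W \<and>
      norm (W - of_nat N * moebius_tail z 4) \<le> (K + C3 * J) * (1 + (real N + 1) powr (1 / 2 + \<delta> + \<eta>) * z powr (-3/2))"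
      using Wsums unfolding P_def by (intro exI[of _ W] conjI)
  qed (use K0 C3 J0 in auto)
qed

section \<open>Counting integers free of fourth powers\<close>

definition pairs_upto :: "nat \<Rightarrow> (nat \<times> nat) set" where
  "pairs_upto N = {(n, d). 1 \<le> n \<and> 1 \<le> d \<and> n * d ^ 4 \<le> N}"

lemma pairs_upto_Sigma:
  assumes "\<And>d. 1 \<le> d \<Longrightarrow> d ^ 4 \<le> N \<Longrightarrow> d \<in> D" "finite D" "0 \<notin> D"
  shows "(\<Sum>(n, d)\<in>pairs_upto N. f d) = (\<Sum>d\<in>D. real (N div d ^ 4) * f d)"
proof -
  have "(\<Sum>(n, d)\<in>pairs_upto N. f d) = (\<Sum>(d, n)\<in>Sigma D (\<lambda>d. {1..N div d ^ 4}). f d)"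
  proof (rule sum.reindex_bij_witness[where i = "\<lambda>(d, n). (n, d)" and j = "\<lambda>(n, d). (d, n)"])
    fix p assume "p \<in> pairs_upto N"
    then obtain n d where p: "p = (n, d)" "1 \<le> n" "1 \<le> d" "n * d ^ 4 \<le> N" by (auto simp: pairs_upto_def)
    have "d ^ 4 \<le> n * d ^ 4" using p(2) by simp
    hence "d ^ 4 \<le> N" using p(4) by linarith
    hence "d \<in> D" using p(3) by (intro assms(1)) auto
    thus "(case p of (n, d) \<Rightarrow> (d, n)) \<in> Sigma D (\<lambda>d. {1..N div d ^ 4})"
      using p by (auto simp: less_eq_div_iff_mult_less_eq)
  next
    fix p assume "p \<in> Sigma D (\<lambda>d. {1..N div d ^ 4})"
    then obtain n d where p: "p = (d, n)" "d \<in> D" "1 \<le> n" "n \<le> N div d ^ 4" by auto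
    have "d > 0" using p assms(3) by (intro Nat.gr0I) auto
    thus "(case p of (d, n) \<Rightarrow> (n, d)) \<in> pairs_upto N"
      using p by (auto simp: pairs_upto_def less_eq_div_iff_mult_less_eq)
  qed auto
  also have "\<dots> = (\<Sum>d\<in>D. \<Sum>n\<in>{1..N div d ^ 4}. f d)"
    using assms(2) by (subst sum.Sigma) auto
  finally show ?thesis by simp
qed

lemma sum_free4_pairs: "(\<Sum>m\<in>{1..N}. free4 m) = (\<Sum>(n, d)\<in>pairs_upto N. real_of_int (moebius_mu d))"
proof -
  have fin: "finite {d. d ^ 4 dvd m}" if "m \<in> {1..N}" for m :: nat
  proof (rule finite_subset)
    show "{d. d ^ 4 dvd m} \<subseteq> {..m}"
    proof
      fix d assume "d \<in> {d. d ^ 4 dvd m}"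
      hence "d ^ 4 \<le> m" using that by (auto dest: dvd_imp_le)
      moreover have "1 \<le> d" using that \<open>d \<in> _\<close> by (cases "d = 0") auto
      hence "d \<le> d ^ 4" by (rule self_le_power) simp
      ultimately show "d \<in> {..m}" by simp
    qed
  qed auto
  have "(\<Sum>m\<in>{1..N}. free4 m) = (\<Sum>m\<in>{1..N}. \<Sum>d | d ^ 4 dvd m. real_of_int (moebius_mu d))"
    by (intro sum.cong refl sum_moebius_mu_fourth_powers[symmetric]) auto
  also have "\<dots> = (\<Sum>(m, d)\<in>(SIGMA m:{1..N}. {d. d ^ 4 dvd m}). real_of_int (moebius_mu d))"
    using fin by (subst sum.Sigma) auto
  also have "\<dots> = (\<Sum>(n, d)\<in>pairs_upto N. real_of_int (moebius_mu d))"
    by (rule sum.reindex_bij_witness[where i = "\<lambda>(n, d). (n * d ^ 4, d)" and j = "\<lambda>(m, d). (m div d ^ 4, d)"])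
       (auto simp: pairs_upto_def Suc_le_eq mult.commute intro!: Nat.gr0I elim!: dvdE)
  finally show ?thesis .
qed

lemma bij_betw_pair_code:
  "bij_betw (\<lambda>k. (pair_n k, pair_d k)) {k. pair_n k * pair_d k ^ 4 \<le> N} (pairs_upto N)"
proof (rule bij_betw_byWitness[where f' = "\<lambda>(n, d). prod_encode (n - 1, d - 1)"])
  show "(\<lambda>k. (pair_n k, pair_d k)) ` {k. pair_n k * pair_d k ^ 4 \<le> N} \<subseteq> pairs_upto N"
    by (auto simp: pairs_upto_def pair_n_def pair_d_def)
  show "(\<lambda>(n, d). prod_encode (n - 1, d - 1)) ` pairs_upto N \<subseteq> {k. pair_n k * pair_d k ^ 4 \<le> N}"
  proof clarify
    fix n d assume "(n, d) \<in> pairs_upto N"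
    hence "1 \<le> n" "1 \<le> d" "n * d ^ 4 \<le> N" by (auto simp: pairs_upto_def)
    moreover from this have "pair_n (prod_encode (n - 1, d - 1)) = n" "pair_d (prod_encode (n - 1, d - 1)) = d"
      by (simp_all add: pair_n_def pair_d_def)
    ultimately show "pair_n (prod_encode (n - 1, d - 1)) * pair_d (prod_encode (n - 1, d - 1)) ^ 4 \<le> N"
      by (simp only:)
  qed
qed (auto simp: pairs_upto_def pair_n_def pair_d_def)

lemma finite_pairs_upto: "finite (pairs_upto N)"
proof (rule finite_subset)
  show "pairs_upto N \<subseteq> {..N} \<times> {..N}"
  proof
    fix p assume "p \<in> pairs_upto N"
    then obtain n d where p: "p = (n, d)" "1 \<le> n" "1 \<le> d" "n * d ^ 4 \<le> N" by (auto simp: pairs_upto_def)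
    have "d \<le> d ^ 4" using p(3) by (rule self_le_power) simp
    moreover have "n \<le> n * d ^ 4" "d ^ 4 \<le> n * d ^ 4" using p(2,3) by simp_all
    ultimately have "n \<le> N" "d \<le> N" using p(4) by linarith+
    thus "p \<in> {..N} \<times> {..N}" using p(1) by simp
  qed
qed auto

lemma tail_pairs_sums:
  "(\<lambda>k. of_real (tail_coeff z (pair_d k)) * (if pair_n k * pair_d k ^ 4 \<le> N then 1 else 0) :: complex)
     sums of_real (\<Sum>(n, d)\<in>pairs_upto N. tail_coeff z d)"
proof -
  define K where "K = {k. pair_n k * pair_d k ^ 4 \<le> N}"
  have "finite K" using bij_betw_finite[OF bij_betw_pair_code] finite_pairs_upto by (simp add: K_def)
  hence "(\<lambda>k. of_real (tail_coeff z (pair_d k)) * (if pair_n k * pair_d k ^ 4 \<le> N then 1 else 0) :: complex)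
     sums (\<Sum>k\<in>K. of_real (tail_coeff z (pair_d k)) * (if pair_n k * pair_d k ^ 4 \<le> N then 1 else 0))"
    by (rule sums_finite) (auto simp: K_def)
  also have "(\<Sum>k\<in>K. of_real (tail_coeff z (pair_d k)) * (if pair_n k * pair_d k ^ 4 \<le> N then 1 else 0) :: complex) =
               (\<Sum>k\<in>K. (\<lambda>(n, d). of_real (tail_coeff z d)) (pair_n k, pair_d k))"
    by (intro sum.cong) (auto simp: K_def)
  also have "\<dots> = (\<Sum>p\<in>pairs_upto N. (\<lambda>(n, d). of_real (tail_coeff z d)) p)"
    unfolding K_def by (rule sum.reindex_bij_betw[OF bij_betw_pair_code])
  also have "\<dots> = of_real (\<Sum>(n, d)\<in>pairs_upto N. tail_coeff z d)"
    by (simp add: case_prod_unfold)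
  finally show ?thesis .
qed

definition inv_zeta4 :: real where
  "inv_zeta4 = infsum (\<lambda>d. moebius_mu d * real d powr (-4)) {0<..}"

lemma zeta_inv_4: "zeta_inv 4 = of_real inv_zeta4"
proof -
  define f where "f = (\<lambda>d. moebius_mu d * real d powr (-4))"
  have "(\<lambda>d. \<bar>f d\<bar>) summable_on {0<..}" unfolding f_def by (rule moebius_euler_product(1)) simp
  hence "(f has_sum inv_zeta4) {0<..}"
    unfolding inv_zeta4_def f_def[symmetric] by (intro has_sum_infsum) (rule abs_summable_summable, simp)
  also have "?this \<longleftrightarrow> ((\<lambda>n. f (Suc n)) has_sum inv_zeta4) UNIV"
    by (rule has_sum_reindex_bij_witness[where i = Suc and j = "\<lambda>n. n - 1"]) auto
  finally have "(\<lambda>n. f (Suc n)) sums inv_zeta4" by (rule has_sum_imp_sums)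
  hence "(\<lambda>n. complex_of_real (f (Suc n))) sums of_real inv_zeta4" by (rule sums_of_real)
  also have "(\<lambda>n. complex_of_real (f (Suc n))) = (\<lambda>n. of_int (moebius_mu (Suc n)) * of_nat (Suc n) powr (-4))"
  proof
    fix n
    have "complex_of_real (real (Suc n) powr (-4)) = of_nat (Suc n) powr (-4)"
      using powr_of_real[of "real (Suc n)" "-4"] by simp
    thus "complex_of_real (f (Suc n)) = of_int (moebius_mu (Suc n)) * of_nat (Suc n) powr (-4)"
      by (simp add: f_def del: of_nat_Suc)
  qed
  finally show ?thesis using zeta_inv_sums[of 4] sums_unique2 by fastforce
qed

text \<open>
  With \<open>z = N powr (1 / 5)\<close> the error \<open>z\<close> from rounding \<open>N / d ^ 4\<close> for \<open>d \<le> z\<close> and the error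
  \<open>N powr (1 / 2) * z powr (-3 / 2)\<close> of the tail balance.
\<close>
lemma RH_free4_count_nat:
  assumes RH: "riemann_hypothesis" and \<epsilon>: "0 < \<epsilon>" "\<epsilon> < 1 / 4"
  obtains C where "C \<ge> 0"
    "\<And>N. N \<ge> 1 \<Longrightarrow> \<bar>(\<Sum>m\<in>{1..N}. free4 m) - inv_zeta4 * real N\<bar> \<le> C * real N powr (1 / 5 + \<epsilon>)"
proof -
  have e: "0 < \<epsilon> / 2" "\<epsilon> / 2 < 1 / 8" "\<epsilon> / 2 \<le> 1" using \<epsilon> by auto
  obtain C where C: "C \<ge> 0" "\<And>z N. z > 0 \<Longrightarrow> N > 0 \<Longrightarrow> \<exists>W.
    (\<lambda>k. of_real (tail_coeff z (pair_d k)) * (if pair_n k * pair_d k ^ 4 \<le> N then 1 else 0)) sums W \<and>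
    norm (W - of_nat N * moebius_tail z 4) \<le> C * (1 + (real N + 1) powr (1 / 2 + \<epsilon> / 2 + \<epsilon> / 2) * z powr (-3/2))"
    by (rule RH_tail_pairs_asymptotics[OF RH e(1,2) e(1,3)], rule that)
  show thesis
  proof (rule that[of "5 * C + 1"])
    fix N :: nat assume N: "N \<ge> 1"
    define z where "z = real N powr (1/5)"
    have z1: "z \<ge> 1" unfolding z_def using N by (intro ge_one_powr_ge_zero) auto
    have z0: "z > 0" using z1 by simp
    have zN: "z \<le> real N" unfolding z_def using N powr_mono[of "1/5" 1 "real N"] by simp
    define X where "X = real N powr (1 / 5 + \<epsilon>)"
    have zX: "z \<le> X" unfolding z_def X_def using N \<epsilon> by (intro powr_mono) auto
    define T where "T = (\<Sum>(n, d)\<in>pairs_upto N. tail_coeff z d)"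
    obtain W where W: "(\<lambda>k. of_real (tail_coeff z (pair_d k)) * (if pair_n k * pair_d k ^ 4 \<le> N then 1 else 0)) sums W"
      "norm (W - of_nat N * moebius_tail z 4) \<le> C * (1 + (real N + 1) powr (1 / 2 + \<epsilon> / 2 + \<epsilon> / 2) * z powr (-3/2))"
      using C(2)[of z N] z0 N by auto
    have "W = of_real T" using sums_unique2[OF W(1) tail_pairs_sums] by (simp add: T_def)
    moreover have "(real N + 1) powr (1 / 2 + \<epsilon> / 2 + \<epsilon> / 2) * z powr (-3/2) \<le> 4 * X"
    proof -
      have "1 / 2 + \<epsilon> / 2 + \<epsilon> / 2 = 1/2 + \<epsilon>" by simp
      moreover have "(real N + 1) powr (1/2 + \<epsilon>) \<le> (2 * real N) powr (1/2 + \<epsilon>)"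
        using N \<epsilon> by (intro powr_mono2) auto
      ultimately have "(real N + 1) powr (1 / 2 + \<epsilon> / 2 + \<epsilon> / 2) \<le> (2 * real N) powr (1/2 + \<epsilon>)"
        by (simp only:)
      also have "\<dots> = 2 powr (1/2 + \<epsilon>) * real N powr (1/2 + \<epsilon>)" by (simp add: powr_mult)
      also have "\<dots> \<le> 2 powr 2 * real N powr (1/2 + \<epsilon>)" using \<epsilon> by (intro mult_right_mono powr_mono) auto
      finally have "(real N + 1) powr (1 / 2 + \<epsilon> / 2 + \<epsilon> / 2) * z powr (-3/2) \<le> (2 powr 2 * real N powr (1/2 + \<epsilon>)) * z powr (-3/2)"
        by (intro mult_right_mono) auto
      also have "z powr (-3/2) = real N powr (-3/10)" by (simp add: z_def powr_powr)
      also have "(2 powr 2 * real N powr (1/2 + \<epsilon>)) * real N powr (-3/10) = 4 * (real N powr (1/2 + \<epsilon>) * real N powr (-3/10))"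
        by simp
      also have "real N powr (1/2 + \<epsilon>) * real N powr (-3/10) = X"
        unfolding X_def powr_add[symmetric] by (simp add: algebra_simps)
      finally show ?thesis by (simp only: \<open>z powr (-3/2) = real N powr (-3/10)\<close>)
    qed
    ultimately have T: "norm (of_real T - of_nat N * moebius_tail z 4) \<le> C * (1 + 4 * X)"
      using W(2) C(1) by (meson add_left_mono mult_left_mono order.trans)
    define D where "D = {d::nat. 1 \<le> d \<and> real d \<le> z}"
    have finD: "finite D" unfolding D_def by (rule finite_nat_le)
    have cardD: "real (card D) \<le> z"
    proof -
      have "D = {1..nat \<lfloor>z\<rfloor>}" using z0 by (auto simp: D_def le_nat_floor) linarith
      thus ?thesis using z0 by simp
    qed
    define Hd where "Hd = (\<Sum>d\<in>D. real_of_int (moebius_mu d) * cutoff z d * real d powr (-4))"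
    have Hd: "moebius_head z 4 = of_real Hd"
    proof -
      have "complex_of_real (real d powr (-4)) = of_nat d powr (-4)" for d
        using powr_of_real[of "real d" "-4"] by simp
      thus ?thesis unfolding moebius_head_def Hd_def D_def[symmetric] by simp
    qed
    define M where "M = (\<Sum>(n, d)\<in>pairs_upto N. real_of_int (moebius_mu d) * cutoff z d)"
    have M: "M = (\<Sum>d\<in>D. real (N div d ^ 4) * (real_of_int (moebius_mu d) * cutoff z d))"
    proof -
      define D' where "D' = {1..N}"
      have "M = (\<Sum>d\<in>D'. real (N div d ^ 4) * (real_of_int (moebius_mu d) * cutoff z d))"
        unfolding M_def
      proof (rule pairs_upto_Sigma)
        fix d :: nat assume "1 \<le> d" "d ^ 4 \<le> N"
        moreover have "d \<le> d ^ 4" using \<open>1 \<le> d\<close> by (intro self_le_power) auto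
        ultimately show "d \<in> D'" by (simp add: D'_def)
      qed (auto simp: D'_def)
      also have "\<dots> = (\<Sum>d\<in>D. real (N div d ^ 4) * (real_of_int (moebius_mu d) * cutoff z d))"
      proof (rule sum.mono_neutral_right)
        show "D \<subseteq> D'" using zN by (auto simp: D_def D'_def)
        show "\<forall>d\<in>D' - D. real (N div d ^ 4) * (real_of_int (moebius_mu d) * cutoff z d) = 0"
        proof
          fix d assume "d \<in> D' - D"
          hence "real d \<ge> z" by (auto simp: D_def D'_def)
          thus "real (N div d ^ 4) * (real_of_int (moebius_mu d) * cutoff z d) = 0"
            by (simp add: cutoff_eq_0[OF z0])
        qed
      qed (simp add: D'_def)
      finally show ?thesis .
    qed
    have "\<bar>M - real N * Hd\<bar> = \<bar>\<Sum>d\<in>D. (real (N div d ^ 4) - real N * real d powr (-4)) * (real_of_int (moebius_mu d) * cutoff z d)\<bar>"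
      unfolding M Hd_def sum_distrib_left by (simp add: algebra_simps flip: sum_subtractf)
    also have "\<dots> \<le> (\<Sum>d\<in>D. 1)"
    proof (rule order.trans[OF sum_abs], rule sum_mono)
      fix d assume "d \<in> D"
      hence d: "d \<ge> 1" by (simp add: D_def)
      have "real N * real d powr (-4) = real N / real (d ^ 4)"
        using d by (simp add: powr_minus powr_numeral field_simps)
      moreover have "\<bar>real (N div d ^ 4) - real N / real (d ^ 4)\<bar> \<le> 1"
      proof -
        have "real (N div d ^ 4) = of_int \<lfloor>real N / real (d ^ 4)\<rfloor>"
          by (simp only: floor_divide_of_nat_eq of_int_of_nat_eq)
        thus ?thesis by linarith
      qed
      moreover have "\<bar>real_of_int (moebius_mu d) * cutoff z d\<bar> \<le> 1"
      proof -
        have "\<bar>real_of_int (moebius_mu d)\<bar> \<le> 1" using abs_moebius_mu_le[of d] by (simp flip: of_int_abs)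
        thus ?thesis using cutoff_bounds[of z d] by (simp add: abs_mult mult_le_one)
      qed
      ultimately show "\<bar>(real (N div d ^ 4) - real N * real d powr (-4)) * (real_of_int (moebius_mu d) * cutoff z d)\<bar> \<le> 1"
        unfolding abs_mult by (simp add: mult_le_one)
    qed
    finally have MH: "\<bar>M - real N * Hd\<bar> \<le> z" using cardD by simp
    have Q: "(\<Sum>m\<in>{1..N}. free4 m) = T + M"
      unfolding sum_free4_pairs T_def M_def tail_coeff_def
      by (simp add: case_prod_unfold algebra_simps flip: sum.distrib)
    have "complex_of_real (T - real N * (inv_zeta4 - Hd)) = of_real T - of_nat N * moebius_tail z 4"
      by (simp add: moebius_tail_def zeta_inv_4 Hd)
    hence "\<bar>T - real N * (inv_zeta4 - Hd)\<bar> \<le> C * (1 + 4 * X)" using T by (metis norm_of_real)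
    hence "\<bar>(\<Sum>m\<in>{1..N}. free4 m) - inv_zeta4 * real N\<bar> \<le> C * (1 + 4 * X) + z"
      using MH unfolding Q by (simp add: algebra_simps)
    also have "\<dots> \<le> C * (X + 4 * X) + X" using zX z1 C(1) by (intro add_mono mult_left_mono) auto
    finally show "\<bar>(\<Sum>m\<in>{1..N}. free4 m) - inv_zeta4 * real N\<bar> \<le> (5 * C + 1) * real N powr (1 / 5 + \<epsilon>)"
      by (simp add: X_def algebra_simps)
  qed (use C(1) in auto)
qed

lemma RH_free4_count:
  assumes RH: "riemann_hypothesis" and \<epsilon>: "0 < \<epsilon>" "\<epsilon> < 1 / 4"
  obtains C where "C \<ge> 0"
    "\<And>y. y > 0 \<Longrightarrow> \<bar>(\<Sum>m | 1 \<le> m \<and> real m \<le> y. free4 m) - inv_zeta4 * y\<bar> \<le> C * y powr (1 / 5 + \<epsilon>)"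
proof -
  obtain C where C: "C \<ge> 0"
    "\<And>N. N \<ge> 1 \<Longrightarrow> \<bar>(\<Sum>m\<in>{1..N}. free4 m) - inv_zeta4 * real N\<bar> \<le> C * real N powr (1 / 5 + \<epsilon>)"
    by (rule RH_free4_count_nat[OF assms], rule that)
  show thesis
  proof (rule that[of "C + \<bar>inv_zeta4\<bar>"])
    fix y :: real assume y: "y > 0"
    define N where "N = nat \<lfloor>y\<rfloor>"
    have set_eq: "{m. 1 \<le> m \<and> real m \<le> y} = {1..N}"
      using y by (auto simp: N_def le_nat_floor) linarith
    have N: "real N \<le> y" "y - real N \<le> 1" using y by (auto simp: N_def) linarith
    show "\<bar>(\<Sum>m | 1 \<le> m \<and> real m \<le> y. free4 m) - inv_zeta4 * y\<bar> \<le> (C + \<bar>inv_zeta4\<bar>) * y powr (1 / 5 + \<epsilon>)"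
    proof (cases "y \<ge> 1")
      case True
      hence N1: "N \<ge> 1" by (simp add: N_def le_nat_floor)
      have "(\<Sum>m\<in>{1..N}. free4 m) - inv_zeta4 * y = ((\<Sum>m\<in>{1..N}. free4 m) - inv_zeta4 * real N) - inv_zeta4 * (y - real N)"
        by (simp add: algebra_simps)
      also have "\<bar>\<dots>\<bar> \<le> C * real N powr (1 / 5 + \<epsilon>) + \<bar>inv_zeta4 * (y - real N)\<bar>"
        using C(2)[OF N1] by linarith
      also have "\<dots> \<le> C * y powr (1 / 5 + \<epsilon>) + \<bar>inv_zeta4\<bar> * y powr (1 / 5 + \<epsilon>)"
      proof (intro add_mono mult_left_mono C powr_mono2)
        have "y powr (1 / 5 + \<epsilon>) \<ge> 1" using True \<epsilon> by (intro ge_one_powr_ge_zero) auto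
        thus "\<bar>inv_zeta4 * (y - real N)\<bar> \<le> \<bar>inv_zeta4\<bar> * y powr (1 / 5 + \<epsilon>)"
          unfolding abs_mult using N by (intro mult_left_mono) auto
      qed (use \<epsilon> N in auto)
      finally show ?thesis unfolding set_eq by (simp add: algebra_simps)
    next
      case False
      hence "N = 0" using y by (simp add: N_def floor_eq_iff)
      hence "\<bar>(\<Sum>m | 1 \<le> m \<and> real m \<le> y. free4 m) - inv_zeta4 * y\<bar> = \<bar>inv_zeta4\<bar> * y"
        using y unfolding set_eq by (simp add: abs_mult)
      also have "y \<le> y powr (1 / 5 + \<epsilon>)" using powr_mono'[of "1/5 + \<epsilon>" 1 y] y False \<epsilon> by simp
      hence "\<bar>inv_zeta4\<bar> * y \<le> (C + \<bar>inv_zeta4\<bar>) * y powr (1 / 5 + \<epsilon>)" using C(1) y by (intro mult_mono) auto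
      finally show ?thesis .
    qed
  qed (use C(1) in auto)
qed

section \<open>Exponentially squarefree integers\<close>

lemma sum_exp_moebius_convolution:
  "(\<Sum>n | 1 \<le> n \<and> real n \<le> x. real_of_int \<bar>exp_moebius n\<bar>) =
     (\<Sum>m | 1 \<le> m \<and> real m \<le> x. cofactor m * (\<Sum>d | 1 \<le> d \<and> real d \<le> x / real m. free4 d))"
proof -
  have "(\<Sum>n | 1 \<le> n \<and> real n \<le> x. real_of_int \<bar>exp_moebius n\<bar>) =
          (\<Sum>n | 1 \<le> n \<and> real n \<le> x. \<Sum>d | d dvd n. free4 d * cofactor (n div d))"
    by (intro sum.cong refl abs_exp_moebius_convolution) auto
  also have "\<dots> = (\<Sum>(n, d)\<in>(SIGMA n:{n. 1 \<le> n \<and> real n \<le> x}. {d. d dvd n}). free4 d * cofactor (n div d))"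
    using finite_nat_le by (subst sum.Sigma) auto
  also have "\<dots> = (\<Sum>(m, d)\<in>(SIGMA m:{m. 1 \<le> m \<and> real m \<le> x}. {d. 1 \<le> d \<and> real d \<le> x / real m}). cofactor m * free4 d)"
  proof (rule sum.reindex_bij_witness[where i = "\<lambda>(m, d). (m * d, d)" and j = "\<lambda>(n, d). (n div d, d)"])
    fix p assume "p \<in> (SIGMA n:{n. 1 \<le> n \<and> real n \<le> x}. {d. d dvd n})"
    then obtain n d where p: "p = (n, d)" "1 \<le> n" "real n \<le> x" "d dvd n" by auto
    then obtain m where m: "n = d * m" "d > 0" "m > 0" by (auto elim!: dvdE)
    have nx: "real d * real m \<le> x" using p m by simp
    have "1 * real m \<le> real d * real m" using m by (intro mult_right_mono) auto
    hence "real m \<le> x" using nx by linarith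
    thus "(case p of (n, d) \<Rightarrow> (n div d, d)) \<in> (SIGMA m:{m. 1 \<le> m \<and> real m \<le> x}. {d. 1 \<le> d \<and> real d \<le> x / real m})"
      using p m nx by (auto simp: field_simps)
    show "(case case p of (n, d) \<Rightarrow> (n div d, d) of (m, d) \<Rightarrow> (m * d, d)) = p"
      using p m by simp
    show "(case case p of (n, d) \<Rightarrow> (n div d, d) of (m, d) \<Rightarrow> cofactor m * free4 d) = (case p of (n, d) \<Rightarrow> free4 d * cofactor (n div d))"
      using p by simp
  next
    fix p assume "p \<in> (SIGMA m:{m. 1 \<le> m \<and> real m \<le> x}. {d. 1 \<le> d \<and> real d \<le> x / real m})"
    then obtain m d where p: "p = (m, d)" "1 \<le> m" "real m \<le> x" "1 \<le> d" "real d \<le> x / real m" by auto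
    have "real (m * d) \<le> x" using p by (simp add: field_simps)
    thus "(case p of (m, d) \<Rightarrow> (m * d, d)) \<in> (SIGMA n:{n. 1 \<le> n \<and> real n \<le> x}. {d. d dvd n})"
      using p by auto
    show "(case case p of (m, d) \<Rightarrow> (m * d, d) of (n, d) \<Rightarrow> (n div d, d)) = p" using p by simp
  qed
  also have "\<dots> = (\<Sum>m | 1 \<le> m \<and> real m \<le> x. cofactor m * (\<Sum>d | 1 \<le> d \<and> real d \<le> x / real m. free4 d))"
    using finite_nat_le by (subst sum.Sigma[symmetric]) (auto simp: sum_distrib_left)
  finally show ?thesis .
qed

theorem theorem3:
  fixes \<epsilon> :: real
  assumes "riemann_hypothesis" and "\<epsilon> > 0"
  shows "(\<lambda>x::real. (\<Sum>n | 1 \<le> n \<and> real n \<le> x. real_of_int \<bar>exp_moebius n\<bar>)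
           - (\<Prod>p. if prime p then euler_factor p else 1) * x)
         \<in> O[at_top](\<lambda>x. x powr (1 / 5 + \<epsilon>))"
proof -
  \<comment> \<open>A smaller \<open>\<epsilon>\<close> proves more; the exponent has to stay below 1 for the range \<open>y < 1\<close>.\<close>
  define \<epsilon>' where "\<epsilon>' = min \<epsilon> (1/5)"
  have \<epsilon>': "0 < \<epsilon>'" "\<epsilon>' < 1 / 4" "\<epsilon>' \<le> \<epsilon>" using assms(2) by (auto simp: \<epsilon>'_def)
  define e where "e = 1 / 5 + \<epsilon>'"
  define Q where "Q = (\<lambda>y. \<Sum>m | 1 \<le> m \<and> real m \<le> y. free4 m)"
  obtain C where C: "C \<ge> 0"
    "\<And>y. y > 0 \<Longrightarrow> \<bar>(\<Sum>m | 1 \<le> m \<and> real m \<le> y. free4 m) - inv_zeta4 * y\<bar> \<le> C * y powr (1 / 5 + \<epsilon>')"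
    by (rule RH_free4_count[OF assms(1) \<epsilon>'(1,2)], rule that)
  have CQ: "\<bar>Q y - inv_zeta4 * y\<bar> \<le> C * y powr e" if "y > 0" for y
    using C(2)[OF that] by (simp only: Q_def e_def)
  have H1: "((\<lambda>m. cofactor m * real m powr (-1)) has_sum infsum (\<lambda>n. cofactor n * real n powr (-1)) {0<..}) {0<..}"
    by (intro has_sum_infsum, rule abs_summable_summable) (use cofactor_euler_product(1)[of 1] in simp)
  define H where "H = infsum (\<lambda>m. \<bar>cofactor m * real m powr (-e)\<bar>) {0<..}"
  have He: "((\<lambda>m. \<bar>cofactor m * real m powr (-e)\<bar>) has_sum H) {0<..}"
    unfolding H_def by (intro has_sum_infsum cofactor_euler_product(1)) (use \<epsilon>' in \<open>simp add: e_def\<close>)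
  have bound: "\<bar>(\<Sum>n | 1 \<le> n \<and> real n \<le> x. real_of_int \<bar>exp_moebius n\<bar>)
           - (\<Prod>p. if prime p then euler_factor p else 1) * x\<bar> \<le> (C * H) * x powr e" if x: "x > 0" for x
  proof -
    define S where "S = (\<Sum>n | 1 \<le> n \<and> real n \<le> x. real_of_int \<bar>exp_moebius n\<bar>)"
    define E where "E = (\<Prod>p. if prime p then euler_factor p else 1)"
    have "((\<lambda>m. cofactor m * Q (x / real m)) has_sum S) {m. 1 \<le> m \<and> real m \<le> x}"
      unfolding S_def sum_exp_moebius_convolution Q_def using finite_nat_le by (rule has_sum_finite)
    \<comment> \<open>For \<open>m > x\<close> the count is 0, so the finite sum can be compared with the full series.\<close>
    also have "?this \<longleftrightarrow> ((\<lambda>m. cofactor m * Q (x / real m)) has_sum S) {0<..}"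
    proof (rule has_sum_cong_neutral)
      fix m :: nat assume "m \<in> {0<..} - {m. 1 \<le> m \<and> real m \<le> x}"
      hence "x / real m < 1" using x by (auto simp: field_simps)
      hence "{d. 1 \<le> d \<and> real d \<le> x / real m} = {}" by auto
      thus "cofactor m * Q (x / real m) = 0" by (simp only: Q_def) simp
    qed auto
    finally have S: "((\<lambda>m. cofactor m * Q (x / real m)) has_sum S) {0<..}" .
    have "((\<lambda>m. cofactor m * real m powr (-1) * - (inv_zeta4 * x)) has_sum - (E * x)) {0<..}"
      using has_sum_cmult_left[OF H1, of "- (inv_zeta4 * x)"] by (simp add: E_def euler_constant inv_zeta4_def mult_ac)
    from has_sum_add[OF S this]
    have diff: "((\<lambda>m. cofactor m * Q (x / real m) - cofactor m * real m powr (-1) * (inv_zeta4 * x)) has_sum (S - E * x)) {0<..}"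
      by simp
    have "norm (S - E * x) \<le> C * x powr e * H"
    proof (rule norm_infsum_le[OF diff has_sum_cmult_right[OF He]])
      fix m :: nat assume "m \<in> {0<..}"
      hence m: "real m > 0" by simp
      have "cofactor m * Q (x / real m) - cofactor m * real m powr (-1) * (inv_zeta4 * x) = cofactor m * (Q (x / real m) - inv_zeta4 * (x / real m))"
        using m by (simp add: powr_minus field_simps)
      hence "norm (cofactor m * Q (x / real m) - cofactor m * real m powr (-1) * (inv_zeta4 * x)) \<le> \<bar>cofactor m\<bar> * (C * (x / real m) powr e)"
        using CQ[of "x / real m"] m x by (simp add: abs_mult mult_left_mono)
      also have "(x / real m) powr e = x powr e * real m powr (-e)"
        using m x by (simp add: powr_divide powr_minus field_simps)
      finally show "norm (cofactor m * Q (x / real m) - cofactor m * real m powr (-1) * (inv_zeta4 * x)) \<le> C * x powr e * \<bar>cofactor m * real m powr (-e)\<bar>"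
        by (simp add: abs_mult mult_ac)
    qed
    thus ?thesis by (simp add: S_def E_def mult_ac)
  qed
  show ?thesis
  proof (rule bigoI)
    show "\<forall>\<^sub>F x in at_top. norm ((\<Sum>n | 1 \<le> n \<and> real n \<le> x. real_of_int \<bar>exp_moebius n\<bar>)
           - (\<Prod>p. if prime p then euler_factor p else 1) * x) \<le> \<bar>C * H\<bar> * norm (x powr (1 / 5 + \<epsilon>))"
      using eventually_ge_at_top[of 1]
    proof eventually_elim
      case (elim x)
      have "x powr e \<le> x powr (1 / 5 + \<epsilon>)" using elim \<epsilon>' by (intro powr_mono) (auto simp: e_def)
      hence "(C * H) * x powr e \<le> \<bar>C * H\<bar> * x powr (1 / 5 + \<epsilon>)" by (intro mult_mono) auto
      thus ?case using bound[of x] elim by simp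
    qed
  qed
qed

end
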